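(* Let $X=\{X_t\}_{t\ge 0}$ be a doubly Feller process on $\mathbb{R}^d$ with generator $L$, and let $\Omega\subset\mathbb{R}^d$ be a regular bounded domain. Suppose that $C_0^2(\mathbb{R}^d)$ is a core for $L$, so that $Lf(x)=L^\sharp f(x)=L^p f(x)$ for every $x\in\mathbb{R}^d$ and every $f\in C_0^2(\mathbb{R}^d)$. Let $L_\Omega$ be the generator, with domain $\mathcal{D}(L_\Omega)$, of the semigroup of the killed process on $C_0(\Omega)$. Then: (1) for every $f\in\mathcal{D}(L_\Omega)$ there exists a sequence $f_n\in C_0^2(\Omega)$ such that $f_n\to f$ uniformly and $L^p f_n$ converges to $L_\Omega f$ uniformly on compact subsets of $\Omega$; (2) if $f_n\in C_0^2(\Omega)$ is a sequence such that $f_n\to f\in C_0(\Omega)$ uniformly and $L^p f_n\to g\in C_0(\Omega)$ uniformly on compact subsets of $\Omega$, then $f\in\mathcal{D}(L_\Omega)$ and $L_\Omega f=g$. In particular, if $f\in C_0^2(\Omega)$ and $L^p f\in C_0(\Omega)$, then $f\in\mathcal{D}(L_\Omega)$ and $L_\Omega f(x)=L^p f(x)$ for every $x\in\Omega$.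
   Context: $C_0(\mathbb{R}^d)$ is the Banach space of continuous functions $\mathbb{R}^d\to\mathbb{R}$ vanishing at infinity, with the supremum norm. $C_0^2(\mathbb{R}^d)$ is the set of $f\in C_0(\mathbb{R}^d)$ whose derivatives up to order 2 also belong to $C_0(\mathbb{R}^d)$. A Feller process $X$ on $\mathbb{R}^d$ is a Markov process for which $P_tf(x)=\mathbb{E}^x[f(X_t)]$ defines a strongly continuous contraction semigroup on $C_0(\mathbb{R}^d)$; its generator is $Lf=\lim_{t\searrow 0}(P_tf-f)/t$ (limit in $C_0(\mathbb{R}^d)$), with domain $\mathcal{D}(L)$. The process is strong Feller if for every bounded measurable $f:\mathbb{R}^d\to\mathbb{R}$ with compact support (and $t>0$), $P_tf$ is bounded and continuous; it is doubly Feller if it is both Feller and strong Feller. The pointwise generator is $$L^\sharp f(x)=\lim_{t\searrow 0}\frac{\mathbb{E}^x[f(X_t)]-f(x)}{t}.$$ $L^p$ denotes the pseudodifferential form of the generator: $$L^pf(x)=-c(x)f(x)+l(x)\cdot\nabla f(x)+\nabla\cdot Q(x)\nabla f(x)+\int_{\mathbb{R}^d\setminus\{0\}}\bigl(f(x+y)-f(x)-\nabla f(x)\cdot y\,I_{B_1}(y)\bigr)\,N(x,dy),$$ where $B_1$ is the unit ball, $c(x)\ge 0$, $l(x)\in\mathbb{R}^d$, $Q(x)\in\mathbb{R}^{d\times d}$ is symmetric positive (semi)definite, the second-order term means $\sum_{i,j}Q_{ij}(x)\partial_i\partial_jf(x)$, and $N(x,\cdot)$ is a positive measure with $\int_{\mathbb{R}^d\setminus\{0\}}\min(|y|^2,1)N(x,dy)<\infty$.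 These coefficients are the ones (whose existence is known for Feller generators with $C_c^\infty(\mathbb{R}^d)\subset\mathcal{D}(L)$) for which $Lf=L^pf$ on $C_0^2(\mathbb{R}^d)$. A bounded domain is a bounded connected open set. $\tau_\Omega=\inf\{t>0:X_t\notin\Omega\}$. $\Omega$ is regular if $\mathbb{P}^x(\tau_\Omega=0)=1$ for every boundary point $x$ of $\Omega$. The killed process is $X_t^\Omega=X_t$ for $t<\tau_\Omega$ and $X^\Omega_t=\partial$ (a cemetery point, where functions are taken to be $0$) for $t\ge\tau_\Omega$. $C_0(\Omega)$ is the Banach space (supremum norm) of continuous real functions on $\Omega$ tending to zero as $x\in\Omega$ approaches the boundary. Under the stated hypotheses $P^\Omega_tf(x)=\mathbb{E}^x[f(X^\Omega_t)]$ is a Feller semigroup on $C_0(\Omega)$, and $L_\Omega f=\lim_{t\searrow 0}(P_t^\Omega f-f)/t$ in $C_0(\Omega)$. $C_0^2(\Omega)$ is the set of functions in $C_0(\Omega)$ whose first and second order partial derivatives are continuous at every $x\in\Omega$ (the derivatives need not be bounded near the boundary nor tend to $0$ there). For $f\in C_0^2(\Omega)$ and $x\in\Omega$, $L^pf(x)$ is computed by applying the formula to the zero extension of $f$ (i.e. $f=0$ outside $\Omega$). *)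

theory Defs
  imports "HOL-Probability.Probability"
begin

section \<open>Function spaces\<close>

text \<open>
  Convergence in the supremum norm over \<open>S\<close> is the library's \<^const>\<open>uniform_limit\<close>.
  An element of \<open>C\<^sub>0(\<Omega>)\<close> is represented by its zero extension, so that functions on \<open>\<Omega>\<close>
  are total functions vanishing off \<open>\<Omega>\<close>.
\<close>

definition C0_space :: "(real ^ 'n \<Rightarrow> real) set" where
  "C0_space = {f. continuous_on UNIV f \<and> (f \<longlongrightarrow> 0) at_infinity}"

definition C0_dom :: "(real ^ 'n) set \<Rightarrow> (real ^ 'n \<Rightarrow> real) set" where
  "C0_dom \<Omega> = {f. continuous_on \<Omega> f \<and> (\<forall>b \<in> frontier \<Omega>. (f \<longlongrightarrow> 0) (at b within \<Omega>)) \<and>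
                  (\<forall>x. x \<notin> \<Omega> \<longrightarrow> f x = 0)}"

definition has_partial :: "'n \<Rightarrow> (real ^ 'n \<Rightarrow> real) \<Rightarrow> real ^ 'n \<Rightarrow> bool" where
  "has_partial i f x \<longleftrightarrow> (\<lambda>h::real. f (x + h *\<^sub>R axis i 1)) differentiable (at 0)"

definition partial :: "'n \<Rightarrow> (real ^ 'n \<Rightarrow> real) \<Rightarrow> real ^ 'n \<Rightarrow> real" where
  "partial i f x = deriv (\<lambda>h::real. f (x + h *\<^sub>R axis i 1)) 0"

definition gradient :: "(real ^ 'n \<Rightarrow> real) \<Rightarrow> real ^ 'n \<Rightarrow> real ^ 'n" where
  "gradient f x = (\<chi> i. partial i f x)"

definition twice_partial_on :: "(real ^ 'n) set \<Rightarrow> (real ^ 'n \<Rightarrow> real) \<Rightarrow> bool" where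
  "twice_partial_on S f \<longleftrightarrow>
     (\<forall>x\<in>S. \<forall>i. has_partial i f x \<and> (\<forall>j. has_partial j (partial i f) x))"

definition C02_space :: "(real ^ 'n \<Rightarrow> real) set" where
  "C02_space = {f \<in> C0_space. twice_partial_on UNIV f \<and>
     (\<forall>i. partial i f \<in> C0_space) \<and> (\<forall>i j. partial j (partial i f) \<in> C0_space)}"

definition C02_dom :: "(real ^ 'n) set \<Rightarrow> (real ^ 'n \<Rightarrow> real) set" where
  "C02_dom \<Omega> = {f \<in> C0_dom \<Omega>. twice_partial_on \<Omega> f \<and>
     (\<forall>i. continuous_on \<Omega> (partial i f)) \<and> (\<forall>i j. continuous_on \<Omega> (partial j (partial i f)))}"

section \<open>Semigroups and generators\<close>

text \<open>\<open>C\<close> is a set of functions that is a Banach space under the supremum norm over \<open>S\<close>.\<close>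

definition contraction_semigroup ::
    "'s set \<Rightarrow> ('s \<Rightarrow> real) set \<Rightarrow> (real \<Rightarrow> ('s \<Rightarrow> real) \<Rightarrow> 's \<Rightarrow> real) \<Rightarrow> bool" where
  "contraction_semigroup S C T \<longleftrightarrow>
     (\<forall>t\<ge>0. \<forall>f\<in>C. T t f \<in> C) \<and>
     (\<forall>t\<ge>0. \<forall>f\<in>C. \<forall>g\<in>C. \<forall>a b. \<forall>x\<in>S. T t (\<lambda>y. a * f y + b * g y) x = a * T t f x + b * T t g x) \<and>
     (\<forall>f\<in>C. \<forall>x\<in>S. T 0 f x = f x) \<and>
     (\<forall>s\<ge>0. \<forall>t\<ge>0. \<forall>f\<in>C. \<forall>x\<in>S. T (s + t) f x = T s (T t f) x) \<and>
     (\<forall>t\<ge>0. \<forall>f\<in>C. (SUP x\<in>S. \<bar>T t f x\<bar>) \<le> (SUP x\<in>S. \<bar>f x\<bar>)) \<and>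
     (\<forall>f\<in>C. uniform_limit S (\<lambda>t. T t f) f (at_right 0))"

definition generator_graph ::
    "'s set \<Rightarrow> ('s \<Rightarrow> real) set \<Rightarrow> (real \<Rightarrow> ('s \<Rightarrow> real) \<Rightarrow> 's \<Rightarrow> real) \<Rightarrow>
     (('s \<Rightarrow> real) \<times> ('s \<Rightarrow> real)) set" where
  "generator_graph S C T =
     {(f, g). f \<in> C \<and> g \<in> C \<and> uniform_limit S (\<lambda>t x. (T t f x - f x) / t) g (at_right 0)}"

definition generator_dom ::
    "'s set \<Rightarrow> ('s \<Rightarrow> real) set \<Rightarrow> (real \<Rightarrow> ('s \<Rightarrow> real) \<Rightarrow> 's \<Rightarrow> real) \<Rightarrow> ('s \<Rightarrow> real) set" where
  "generator_dom S C T = Domain (generator_graph S C T)"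

definition generator ::
    "'s set \<Rightarrow> ('s \<Rightarrow> real) set \<Rightarrow> (real \<Rightarrow> ('s \<Rightarrow> real) \<Rightarrow> 's \<Rightarrow> real) \<Rightarrow> ('s \<Rightarrow> real) \<Rightarrow> 's \<Rightarrow> real" where
  "generator S C T f = (THE g. (f, g) \<in> generator_graph S C T)"

definition is_core ::
    "'s set \<Rightarrow> ('s \<Rightarrow> real) set \<Rightarrow> (real \<Rightarrow> ('s \<Rightarrow> real) \<Rightarrow> 's \<Rightarrow> real) \<Rightarrow> ('s \<Rightarrow> real) set \<Rightarrow> bool" where
  "is_core S C T D \<longleftrightarrow> D \<subseteq> generator_dom S C T \<and>
     (\<forall>f \<in> generator_dom S C T. \<exists>fn :: nat \<Rightarrow> 's \<Rightarrow> real. (\<forall>n. fn n \<in> D) \<and>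
        uniform_limit S fn f sequentially \<and>
        uniform_limit S (\<lambda>n. generator S C T (fn n)) (generator S C T f) sequentially)"

definition pointwise_generator ::
    "(real \<Rightarrow> ('s \<Rightarrow> real) \<Rightarrow> 's \<Rightarrow> real) \<Rightarrow> ('s \<Rightarrow> real) \<Rightarrow> 's \<Rightarrow> real" where
  "pointwise_generator T f x = Lim (at_right 0) (\<lambda>t. (T t f x - f x) / t)"

section \<open>Doubly Feller processes\<close>

text \<open>
  Feller semigroups need not be conservative (the generator may contain a killing rate
  \<open>c \<ge> 0\<close>), so a process takes values in the state space with a cemetery point
  \<^term>\<open>None\<close> adjoined, at which every function is taken to be \<open>0\<close>.
\<close>

definition ext0 :: "('s \<Rightarrow> real) \<Rightarrow> 's option \<Rightarrow> real" where
  "ext0 f z = (case z of None \<Rightarrow> 0 | Some y \<Rightarrow> f y)"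

definition state_borel :: "'s::topological_space option measure" where
  "state_borel = sigma UNIV ((`) Some ` sets borel)"

text \<open>
  The completion has no effect on measurable integrands. It is needed for the killed process,
  since the exit time of a right-continuous process is only measurable up to null sets.
\<close>

definition transition ::
    "('s \<Rightarrow> 'w measure) \<Rightarrow> (real \<Rightarrow> 'w \<Rightarrow> 's option) \<Rightarrow> real \<Rightarrow> ('s \<Rightarrow> real) \<Rightarrow> 's \<Rightarrow> real" where
  "transition P X t f x = (\<integral>w. ext0 f (X t w) \<partial>completion (P x))"

definition natural_filtration ::
    "'w measure \<Rightarrow> (real \<Rightarrow> 'w \<Rightarrow> 's::topological_space option) \<Rightarrow> real \<Rightarrow> 'w measure" where
  "natural_filtration M X t =
     sigma (space M) (\<Union>u\<in>{0..t}. {X u -` A \<inter> space M | A. A \<in> sets state_borel})"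

definition markov_process ::
    "'w measure \<Rightarrow> ('s::topological_space \<Rightarrow> 'w measure) \<Rightarrow> (real \<Rightarrow> 'w \<Rightarrow> 's option) \<Rightarrow> bool" where
  "markov_process M P X \<longleftrightarrow>
     (\<forall>x. prob_space (P x) \<and> sets (P x) = sets M) \<and>
     (\<forall>t\<ge>0. X t \<in> measurable M state_borel) \<and>
     (\<forall>t\<ge>0. (\<lambda>x. distr (P x) state_borel (X t)) \<in> measurable borel (prob_algebra state_borel)) \<and>
     (\<forall>x. AE w in P x. X 0 w = Some x) \<and>
     (\<forall>x. \<forall>s\<ge>0. \<forall>t\<ge>0. \<forall>f \<in> borel_measurable borel. bounded (range f) \<longrightarrow>
        (AE w in P x. real_cond_exp (P x) (natural_filtration M X t) (\<lambda>w. ext0 f (X (t + s) w)) w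
                      = ext0 (transition P X s f) (X t w)))"

text \<open>
  The standard path regularity: \<^term>\<open>None\<close> is absorbing, and paths are right-continuous with
  left limits in the one-point compactification, \<^term>\<open>None\<close> being the point at infinity.
\<close>

definition regular_paths ::
    "('s::topological_space \<Rightarrow> 'w measure) \<Rightarrow> (real \<Rightarrow> 'w \<Rightarrow> 's option) \<Rightarrow> bool" where
  "regular_paths P X \<longleftrightarrow> (\<forall>x. AE w in P x.
     (\<forall>s\<ge>0. \<forall>t\<ge>s. X s w = None \<longrightarrow> X t w = None) \<and>
     (\<forall>t\<ge>0. limitin (Alexandroff_compactification euclidean) (\<lambda>s. X s w) (X t w) (at_right t)) \<and>
     (\<forall>t>0. \<exists>z. limitin (Alexandroff_compactification euclidean) (\<lambda>s. X s w) z (at_left t)))"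

definition feller_process ::
    "'w measure \<Rightarrow> (real ^ 'n \<Rightarrow> 'w measure) \<Rightarrow> (real \<Rightarrow> 'w \<Rightarrow> (real ^ 'n) option) \<Rightarrow> bool" where
  "feller_process M P X \<longleftrightarrow> markov_process M P X \<and> regular_paths P X \<and>
     contraction_semigroup UNIV C0_space (transition P X)"

definition strong_feller ::
    "(real ^ 'n \<Rightarrow> 'w measure) \<Rightarrow> (real \<Rightarrow> 'w \<Rightarrow> (real ^ 'n) option) \<Rightarrow> bool" where
  "strong_feller P X \<longleftrightarrow>
     (\<forall>t>0. \<forall>f \<in> borel_measurable borel. bounded (range f) \<and> compact (closure {x. f x \<noteq> 0}) \<longrightarrow>
        bounded (range (transition P X t f)) \<and> continuous_on UNIV (transition P X t f))"

definition doubly_feller ::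
    "'w measure \<Rightarrow> (real ^ 'n \<Rightarrow> 'w measure) \<Rightarrow> (real \<Rightarrow> 'w \<Rightarrow> (real ^ 'n) option) \<Rightarrow> bool" where
  "doubly_feller M P X \<longleftrightarrow> feller_process M P X \<and> strong_feller P X"

section \<open>Exit times and the killed process\<close>

definition exit_time :: "(real \<Rightarrow> 'w \<Rightarrow> 's option) \<Rightarrow> 's set \<Rightarrow> 'w \<Rightarrow> ereal" where
  "exit_time X \<Omega> w = Inf (ereal ` {t. t > 0 \<and> X t w \<notin> Some ` \<Omega>})"

definition killed :: "(real \<Rightarrow> 'w \<Rightarrow> 's option) \<Rightarrow> 's set \<Rightarrow> real \<Rightarrow> 'w \<Rightarrow> 's option" where
  "killed X \<Omega> t w = (if ereal t < exit_time X \<Omega> w then X t w else None)"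

definition regular_domain ::
    "('s::topological_space \<Rightarrow> 'w measure) \<Rightarrow> (real \<Rightarrow> 'w \<Rightarrow> 's option) \<Rightarrow> 's set \<Rightarrow> bool" where
  "regular_domain P X \<Omega> \<longleftrightarrow> (\<forall>x \<in> frontier \<Omega>. AE w in P x. exit_time X \<Omega> w = 0)"

section \<open>The pseudodifferential form of the generator\<close>

definition levy_coefficients ::
    "(real ^ 'n \<Rightarrow> real) \<Rightarrow> (real ^ 'n \<Rightarrow> real ^ 'n) \<Rightarrow> (real ^ 'n \<Rightarrow> real ^ 'n ^ 'n) \<Rightarrow>
     (real ^ 'n \<Rightarrow> (real ^ 'n) measure) \<Rightarrow> bool" where
  "levy_coefficients c l Q N \<longleftrightarrow> (\<forall>x.
     c x \<ge> 0 \<and>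
     transpose (Q x) = Q x \<and> (\<forall>v. v \<bullet> (Q x *v v) \<ge> 0) \<and>
     sets (N x) = sets borel \<and>
     (\<integral>\<^sup>+ y\<in>-{0}. ennreal (min ((norm y)\<^sup>2) 1) \<partial>N x) < \<infinity>)"

definition Lp ::
    "(real ^ 'n \<Rightarrow> real) \<Rightarrow> (real ^ 'n \<Rightarrow> real ^ 'n) \<Rightarrow> (real ^ 'n \<Rightarrow> real ^ 'n ^ 'n) \<Rightarrow>
     (real ^ 'n \<Rightarrow> (real ^ 'n) measure) \<Rightarrow> (real ^ 'n \<Rightarrow> real) \<Rightarrow> real ^ 'n \<Rightarrow> real" where
  "Lp c l Q N f x =
     - c x * f x + l x \<bullet> gradient f x
     + (\<Sum>i\<in>UNIV. \<Sum>j\<in>UNIV. Q x $ i $ j * partial i (partial j f) x)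
     + (LINT y:-{0}|N x. f (x + y) - f x - gradient f x \<bullet> y * indicat_real (ball 0 1) y)"

end

theory Submission
  imports Defs
begin

text \<open>
  Write \<open>T\<^sub>t\<close> for the semigroup of \<open>X\<close> on \<open>C\<^sub>0(\<real>\<^sup>d)\<close> and \<open>T\<^sub>t\<^sup>\<Omega>\<close> for the killed one. Functions in
  \<open>C\<^sub>0(\<Omega>)\<close> are identified with their zero extensions, which lie in \<open>C\<^sub>0(\<real>\<^sup>d)\<close>. Everything rests on one
  observation. If a path has left \<open>\<Omega>\<close> before time \<open>h\<close>, then at the exit a function \<open>f \<in> C\<^sub>0(\<Omega>)\<close> has
  the value \<open>0\<close>, so by the Markov property its expectation at time \<open>h\<close> is at most
  \<open>e(h) = sup {\<parallel>T\<^sub>s f - f\<parallel>. s \<le> h}\<close>, which tends to \<open>0\<close> with \<open>h\<close>. Hence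
  \<open>\<bar>T\<^sub>h f(x) - T\<^sub>h\<^sup>\<Omega> f(x)\<bar> \<le> e(h) P\<^sup>x(\<tau>\<^sub>\<Omega> \<le> h)\<close> (lemma \<open>dead_bound\<close>).

  \<^emph>\<open>Approximation.\<close> For \<open>x\<close> in a compact part of \<open>\<Omega>\<close> the exit probability is \<open>O(h)\<close>, as testing with a cut-off
  function shows (\<open>dead_probability_bound\<close>). So \<open>(T\<^sub>h f - f) / h\<close> and \<open>(T\<^sub>h\<^sup>\<Omega> f - f) / h\<close> have the same locally
  uniform limit \<open>L\<^sub>\<Omega> f\<close>. The first one is \<open>L u\<close> for the average \<open>u\<close> of \<open>T\<^sub>s f\<close> over \<open>s \<le> h\<close>, so the core
  provides \<open>p \<in> C\<^sub>0\<^sup>2(\<real>\<^sup>d)\<close> close to \<open>f\<close> with \<open>L p\<close> close to \<open>L\<^sub>\<Omega> f\<close> on compact sets. It remains to cut \<open>p\<close>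
  off near the boundary. By the positive maximum principle the generator feels a change of \<open>p\<close> far away
  from \<open>x\<close> only through its supremum norm (\<open>gen_far_bound\<close>), and \<open>p\<close> is small where it is cut off.

  \<^emph>\<open>Closedness.\<close> Conversely each \<open>f\<^sub>n \<in> C\<^sub>0\<^sup>2(\<Omega>)\<close> is changed near the boundary into a function in
  \<open>C\<^sub>0\<^sup>2(\<real>\<^sup>d)\<close> that is uniformly close to it and has nearly the same image under \<open>L\<^sup>p\<close> in the interior
  (\<open>C02_dom_approx\<close>); there the tail of the jump measure is controlled by \<open>- L \<phi>\<close> for a cut-off function
  \<open>\<phi>\<close>. Therefore \<open>(f, g)\<close> is, locally in \<open>\<Omega>\<close>, a limit of pairs \<open>(U, L U)\<close>. Dynkin's formula for such \<open>U\<close>, stopped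
  before the boundary, gives in the limit
  \<open>\<bar>T\<^sub>h\<^sup>\<Omega> f(x) - f(x) - h g(x)\<bar> \<le> 2 h e(h)\<close> for all \<open>x \<in> \<Omega>\<close>, with \<open>e\<close> now formed for \<open>g\<close>
  (\<open>killed_increment\<close>); this says that \<open>g = L\<^sub>\<Omega> f\<close>.

  The stopping arguments are carried out on the grids \<open>k h / 2\<^sup>n\<close>, where the simple Markov property is
  enough and no measurability question arises. Paths are classified by whether their depth, the distance to the
  complement of \<open>\<Omega>\<close>, stays bounded away from \<open>0\<close> at dyadic times. That this event is almost surely
  \<open>{h < \<tau>\<^sub>\<Omega>}\<close> requires a form of quasi-left-continuity, that is, that a path does not creep up to the
  boundary and then jump back inside. It follows from the same observation, applied to the depth function
  on short intervals (\<open>AE_inside_imp_safe\<close>).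
\<close>


section \<open>Functions vanishing at infinity\<close>

lemma C0_space_iff:
  "f \<in> C0_space \<longleftrightarrow> continuous_on UNIV f \<and> (\<forall>e>0. \<exists>R. \<forall>x. R \<le> norm x \<longrightarrow> \<bar>f x\<bar> < e)"
  by (simp add: C0_space_def tendsto_iff eventually_at_infinity)

lemma C0_space_bounded:
  assumes "f \<in> C0_space"
  obtains B where "B \<ge> 0" "\<And>x. \<bar>f x\<bar> \<le> B"
proof -
  obtain R where R: "\<And>x. R \<le> norm x \<Longrightarrow> \<bar>f x\<bar> < 1"
    using assms unfolding C0_space_iff by (meson zero_less_one)
  have "compact (f ` cball 0 R)"
    using assms by (intro compact_continuous_image) (auto simp: C0_space_def intro: continuous_on_subset)
  then obtain b where b: "\<And>x. norm x \<le> R \<Longrightarrow> \<bar>f x\<bar> \<le> b"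
    using compact_imp_bounded[of "f ` cball 0 R"] unfolding bounded_iff
    by (metis imageI mem_cball_0 real_norm_def)
  have "\<bar>f x\<bar> \<le> max 1 b" for x
    using R[of x] b[of x] by linarith
  then show thesis by (intro that[of "max 1 b"]) auto
qed

lemma C0_space_lincomb:
  assumes "f \<in> C0_space" "g \<in> C0_space"
  shows "(\<lambda>x. a * f x + b * g x) \<in> C0_space"
  using assms unfolding C0_space_def
  by (auto intro!: continuous_intros tendsto_eq_intros)

lemma C0_space_scale: "f \<in> C0_space \<Longrightarrow> (\<lambda>x. a * f x) \<in> C0_space"
  using C0_space_lincomb[of f f a 0] by simp

lemma C0_space_diff: "f \<in> C0_space \<Longrightarrow> g \<in> C0_space \<Longrightarrow> (\<lambda>x. f x - g x) \<in> C0_space"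
  using C0_space_lincomb[of f g 1 "-1"] by simp

lemma C0_space_zero: "(\<lambda>x. 0) \<in> C0_space"
  by (simp add: C0_space_def)

lemma C0_space_sum:
  assumes "\<And>k. k < (n::nat) \<Longrightarrow> f k \<in> C0_space"
  shows "(\<lambda>x. \<Sum>k<n. f k x) \<in> C0_space"
  using assms
proof (induction n)
  case (Suc n)
  then show ?case using C0_space_lincomb[of "\<lambda>x. \<Sum>k<n. f k x" "f n" 1 1] by simp
qed (simp add: C0_space_zero)

lemma C0_space_closed:
  assumes "\<And>e. e > 0 \<Longrightarrow> \<exists>g\<in>C0_space. \<forall>x. \<bar>g x - f x\<bar> \<le> e"
  shows "f \<in> C0_space"
proof -
  have "\<exists>g. \<forall>n::nat. g n \<in> C0_space \<and> (\<forall>x. \<bar>g n x - f x\<bar> \<le> inverse (real (Suc n)))"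
    using assms by (intro choice) (metis inverse_positive_iff_positive of_nat_0_less_iff zero_less_Suc)
  then obtain g where g: "\<And>n. g n \<in> C0_space" "\<And>n x. \<bar>g n x - f x\<bar> \<le> inverse (real (Suc n))"
    by blast
  have "uniform_limit UNIV g f sequentially"
  proof (rule uniform_limitI)
    fix e :: real assume "e > 0"
    have "\<forall>\<^sub>F n in sequentially. inverse (real (Suc n)) < e"
      using LIMSEQ_inverse_real_of_nat \<open>e > 0\<close> by (rule order_tendstoD)
    then show "\<forall>\<^sub>F n in sequentially. \<forall>x\<in>UNIV. dist (g n x) (f x) < e"
      by eventually_elim (auto simp: dist_real_def intro: le_less_trans[OF g(2)])
  qed
  then have "continuous_on UNIV f"
    by (rule uniform_limit_theorem[rotated]) (use g(1) in \<open>auto simp: C0_space_def\<close>)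
  moreover have "\<exists>R. \<forall>x. R \<le> norm x \<longrightarrow> \<bar>f x\<bar> < e" if e: "e > 0" for e
  proof -
    obtain u where u: "u \<in> C0_space" "\<And>x. \<bar>u x - f x\<bar> \<le> e/2"
      using assms[of "e/2"] e by (meson half_gt_zero)
    obtain R where "\<And>x. R \<le> norm x \<Longrightarrow> \<bar>u x\<bar> < e/2"
      using u(1) e unfolding C0_space_iff by (meson half_gt_zero)
    then have "\<bar>f x\<bar> < e" if "R \<le> norm x" for x
      using u(2)[of x] that by (smt (verit) field_sum_of_halves)
    then show ?thesis by blast
  qed
  ultimately show ?thesis by (simp add: C0_space_iff)
qed

section \<open>Feller semigroups and their generators\<close>

locale feller_semigroup =
  fixes T :: "real \<Rightarrow> (real ^ 'n \<Rightarrow> real) \<Rightarrow> real ^ 'n \<Rightarrow> real"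
  assumes T_C0: "t \<ge> 0 \<Longrightarrow> f \<in> C0_space \<Longrightarrow> T t f \<in> C0_space"
    and T_lincomb: "t \<ge> 0 \<Longrightarrow> f \<in> C0_space \<Longrightarrow> g \<in> C0_space \<Longrightarrow>
          T t (\<lambda>y. a * f y + b * g y) x = a * T t f x + b * T t g x"
    and T_zero: "f \<in> C0_space \<Longrightarrow> T 0 f x = f x"
    and T_add: "s \<ge> 0 \<Longrightarrow> t \<ge> 0 \<Longrightarrow> f \<in> C0_space \<Longrightarrow> T (s + t) f x = T s (T t f) x"
    and T_le: "t \<ge> 0 \<Longrightarrow> f \<in> C0_space \<Longrightarrow> B \<ge> 0 \<Longrightarrow> (\<And>y. f y \<le> B) \<Longrightarrow> T t f x \<le> B"
    and T_cont: "f \<in> C0_space \<Longrightarrow> uniform_limit UNIV (\<lambda>t. T t f) f (at_right 0)"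
begin

lemma T_scale: "t \<ge> 0 \<Longrightarrow> f \<in> C0_space \<Longrightarrow> T t (\<lambda>y. a * f y) x = a * T t f x"
  using T_lincomb[of t f f a 0] by simp

lemma T_diff:
  "t \<ge> 0 \<Longrightarrow> f \<in> C0_space \<Longrightarrow> g \<in> C0_space \<Longrightarrow> T t (\<lambda>y. f y - g y) x = T t f x - T t g x"
  using T_lincomb[of t f g 1 "-1"] by simp

lemma T_sum:
  assumes "t \<ge> 0" "\<And>k. k < (n::nat) \<Longrightarrow> f k \<in> C0_space"
  shows "T t (\<lambda>y. \<Sum>k<n. f k y) x = (\<Sum>k<n. T t (f k) x)"
  using assms(2)
proof (induction n)
  case 0
  then show ?case using T_scale[of t "\<lambda>x. 0" 0] assms(1) by (simp add: C0_space_zero)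
next
  case (Suc n)
  then show ?case
    using T_lincomb[of t "\<lambda>x. \<Sum>k<n. f k x" "f n" 1 1] C0_space_sum[of n f] assms(1) by simp
qed

lemma T_abs_le:
  assumes "t \<ge> 0" "f \<in> C0_space" "\<And>y. \<bar>f y\<bar> \<le> B"
  shows "\<bar>T t f x\<bar> \<le> B"
proof -
  have B: "B \<ge> 0" using assms(3)[of 0] by linarith
  have "T t f x \<le> B" by (rule T_le) (use assms B abs_le_iff in auto)
  moreover have "T t (\<lambda>y. - 1 * f y) x \<le> B"
    by (rule T_le) (use assms B C0_space_scale[of f "-1"] abs_le_iff in auto)
  then have "- T t f x \<le> B" using T_scale[of t f "-1" x] assms by simp
  ultimately show ?thesis by linarith
qed

lemma T_abs_diff_le:
  assumes "t \<ge> 0" "f \<in> C0_space" "g \<in> C0_space" "\<And>y. \<bar>f y - g y\<bar> \<le> B"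
  shows "\<bar>T t f x - T t g x\<bar> \<le> B"
  using T_abs_le[of t "\<lambda>y. f y - g y" B x] assms by (simp add: T_diff C0_space_diff)

lemma T_small:
  assumes "f \<in> C0_space" "e > 0"
  obtains \<delta> where "\<delta> > 0" "\<And>r x. 0 \<le> r \<Longrightarrow> r < \<delta> \<Longrightarrow> \<bar>T r f x - f x\<bar> \<le> e"
proof -
  have "\<forall>\<^sub>F t in at_right 0. \<forall>x\<in>UNIV. dist (T t f x) (f x) < e"
    using T_cont[OF assms(1)] assms(2) by (rule uniform_limitD)
  then obtain \<delta> where \<delta>: "\<delta> > 0" "\<And>r x. 0 < r \<Longrightarrow> r < \<delta> \<Longrightarrow> \<bar>T r f x - f x\<bar> < e"
    unfolding eventually_at_right_field by (auto simp: dist_real_def)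
  have "\<bar>T r f x - f x\<bar> \<le> e" if "0 \<le> r" "r < \<delta>" for r x
    using \<delta>(2)[of r x] that T_zero[OF assms(1), of x] assms(2) by (cases "r = 0") auto
  then show thesis using \<delta>(1) that by blast
qed

lemma T_shift_le:
  assumes "s \<ge> 0" "r \<ge> 0" "f \<in> C0_space" "\<And>y. \<bar>T r f y - f y\<bar> \<le> e"
  shows "\<bar>T (s + r) f x - T s f x\<bar> \<le> e"
  using T_abs_diff_le[of s "T r f" f e x] assms T_add[of s r f x] T_C0 by simp

lemma continuous_on_orbit:
  assumes f: "f \<in> C0_space"
  shows "continuous_on {0..} (\<lambda>s. T s f x)"
proof (rule continuous_onI)
  fix s e :: real assume s: "s \<in> {0..}" and e: "e > 0"
  obtain \<delta> where \<delta>: "\<delta> > 0" "\<And>r x. 0 \<le> r \<Longrightarrow> r < \<delta> \<Longrightarrow> \<bar>T r f x - f x\<bar> \<le> e"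
    using T_small[OF f e] by blast
  have *: "\<bar>T b f x - T a f x\<bar> \<le> e" if "0 \<le> a" "a \<le> b" "b - a < \<delta>" for a b
    using T_shift_le[of a "b - a" f e x] that \<delta>(2)[of "b - a"] f by simp
  show "\<exists>d>0. \<forall>t\<in>{0..}. dist t s < d \<longrightarrow> dist (T t f x) (T s f x) \<le> e"
  proof (intro exI conjI ballI impI)
    fix t assume "t \<in> {0..}" "dist t s < \<delta>"
    then show "dist (T t f x) (T s f x) \<le> e"
      using *[of s t] *[of t s] s by (cases "s \<le> t") (auto simp: dist_real_def abs_minus_commute)
  qed (rule \<delta>(1))
qed

lemma integrable_orbit:
  assumes "f \<in> C0_space" "0 \<le> a"
  shows "(\<lambda>s. T s f x) integrable_on {a..b}"
  by (rule integrable_continuous_interval, rule continuous_on_subset[OF continuous_on_orbit[OF assms(1)]])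
     (use assms in auto)

lemma orbit_integral_close:
  assumes f: "f \<in> C0_space" and a: "0 \<le> a" and r: "0 \<le> r"
    and e: "\<And>s y. 0 \<le> s \<Longrightarrow> s \<le> r \<Longrightarrow> \<bar>T s f y - f y\<bar> \<le> e"
  shows "\<bar>integral {a..a + r} (\<lambda>s. T s f x) - r * T a f x\<bar> \<le> r * e"
proof -
  have e0: "e \<ge> 0" using e[of 0 0] r by auto
  have i: "((\<lambda>s. T s f x - T a f x) has_integral (integral {a..a + r} (\<lambda>s. T s f x) - r * T a f x)) {a..a+r}"
    using has_integral_diff[OF integrable_integral[OF integrable_orbit[OF f a, of x "a+r"]]
        has_integral_const_real[of "T a f x" a "a+r"]] r by simp
  have "norm (integral {a..a + r} (\<lambda>s. T s f x) - r * T a f x) \<le> e * measure lborel (cbox a (a+r))"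
  proof (rule has_integral_bound[OF e0])
    show "((\<lambda>s. T s f x - T a f x) has_integral (integral {a..a + r} (\<lambda>s. T s f x) - r * T a f x)) (cbox a (a + r))"
      using i by simp
    fix s assume "s \<in> cbox a (a + r)"
    then show "norm (T s f x - T a f x) \<le> e"
      using T_shift_le[of a "s - a" f e x] e[of "s - a"] f a by auto
  qed
  then show ?thesis using r by (simp add: mult.commute)
qed

text \<open>Riemann sums of the orbit approximate its integral uniformly in the space variable; this is
  what lets a bounded operator be exchanged with the integral.\<close>

lemma orbit_riemann_sum:
  assumes f: "f \<in> C0_space" and a: "0 \<le> a" and r: "0 \<le> r"
    and e: "\<And>s y. 0 \<le> s \<Longrightarrow> s \<le> r \<Longrightarrow> \<bar>T s f y - f y\<bar> \<le> e"
  shows "\<bar>integral {a..a + real n * r} (\<lambda>s. T s f x) - (\<Sum>k<n. r * T (a + real k * r) f x)\<bar> \<le> real n * r * e"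
proof (induction n)
  case (Suc n)
  let ?b = "a + real n * r"
  have "integral {a..?b + r} (\<lambda>s. T s f x) =
      integral {a..?b} (\<lambda>s. T s f x) + integral {?b..?b + r} (\<lambda>s. T s f x)"
    using Henstock_Kurzweil_Integration.integral_combine[of a ?b "?b + r" "\<lambda>s. T s f x"]
      integrable_orbit[OF f a] r by simp
  moreover have "\<bar>integral {?b..?b + r} (\<lambda>s. T s f x) - r * T ?b f x\<bar> \<le> r * e"
    using orbit_integral_close[OF f _ r e, of ?b x] a r by simp
  ultimately have "\<bar>integral {a..?b + r} (\<lambda>s. T s f x) - (\<Sum>k<Suc n. r * T (a + real k * r) f x)\<bar>
      \<le> real n * r * e + r * e"
    using Suc by simp
  then show ?case by (simp add: algebra_simps)
qed simp

lemma riemann_approx: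
  assumes f: "f \<in> C0_space" and h: "h > 0" and e: "e > 0"
  obtains n where "n > 0" "\<And>a x. 0 \<le> a \<Longrightarrow>
    \<bar>integral {a..a + h} (\<lambda>s. T s f x) - (\<Sum>k<n. h / real n * T (a + real k * (h / real n)) f x)\<bar> \<le> e"
proof -
  obtain \<delta> where \<delta>: "\<delta> > 0" "\<And>r x. 0 \<le> r \<Longrightarrow> r < \<delta> \<Longrightarrow> \<bar>T r f x - f x\<bar> \<le> e/h"
    using T_small[OF f, of "e/h"] e h by auto
  obtain n :: nat where n: "h / \<delta> < real n" using reals_Archimedean2 by blast
  have n0: "n > 0" using n h \<delta>(1) by (metis divide_pos_pos less_trans of_nat_0_less_iff)
  have "h / real n < \<delta>" using n n0 \<delta>(1) by (simp add: field_simps)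
  then have "\<bar>integral {a..a + h} (\<lambda>s. T s f x) - (\<Sum>k<n. h / real n * T (a + real k * (h / real n)) f x)\<bar> \<le> e"
    if "0 \<le> a" for a x
    using orbit_riemann_sum[OF f that, of "h / real n" "e/h" n x] \<delta>(2) n0 h by simp
  then show thesis using n0 that by blast
qed

abbreviation gen :: "((real ^ 'n \<Rightarrow> real) \<times> (real ^ 'n \<Rightarrow> real)) set" where
  "gen \<equiv> generator_graph UNIV C0_space T"

lemma gen_iff:
  "(f, g) \<in> gen \<longleftrightarrow> f \<in> C0_space \<and> g \<in> C0_space \<and>
     (\<forall>e>0. \<exists>\<delta>>0. \<forall>t>0. t < \<delta> \<longrightarrow> (\<forall>x. \<bar>(T t f x - f x) / t - g x\<bar> < e))"
  unfolding generator_graph_def uniform_limit_iff eventually_at_right_field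
  by (simp add: dist_real_def)

lemma gen_quotient_close:
  assumes "(f, g) \<in> gen" "e > 0"
  obtains \<delta> where "\<delta> > 0" "\<And>t x. 0 < t \<Longrightarrow> t < \<delta> \<Longrightarrow> \<bar>(T t f x - f x) / t - g x\<bar> < e"
proof -
  have "\<forall>e>0. \<exists>\<delta>>0. \<forall>t>0. t < \<delta> \<longrightarrow> (\<forall>x. \<bar>(T t f x - f x) / t - g x\<bar> < e)"
    using assms(1) unfolding gen_iff by simp
  from this[rule_format, OF assms(2)] obtain \<delta> where "\<delta> > 0"
    "\<And>t x. 0 < t \<Longrightarrow> t < \<delta> \<Longrightarrow> \<bar>(T t f x - f x) / t - g x\<bar> < e" by auto
  then show thesis by (rule that)
qed

lemma gen_lincomb:
  assumes "(f, g) \<in> gen" "(f', g') \<in> gen"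
  shows "((\<lambda>x. a * f x + b * f' x), (\<lambda>x. a * g x + b * g' x)) \<in> gen"
proof -
  have C: "f \<in> C0_space" "g \<in> C0_space" "f' \<in> C0_space" "g' \<in> C0_space"
    using assms by (auto simp: generator_graph_def)
  have 1: "uniform_limit UNIV (\<lambda>t x. a * ((T t f x - f x) / t) + b * ((T t f' x - f' x) / t))
      (\<lambda>x. a * g x + b * g' x) (at_right 0)"
    using assms unfolding generator_graph_def
    by (intro uniform_limit_add bounded_linear.uniform_limit[OF bounded_linear_mult_right]) auto
  have "uniform_limit UNIV (\<lambda>t x. (T t (\<lambda>x. a * f x + b * f' x) x - (a * f x + b * f' x)) / t)
      (\<lambda>x. a * g x + b * g' x) (at_right 0)"
  proof (rule uniform_limit_cong[THEN iffD1, OF _ _ 1])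
    show "\<forall>\<^sub>F t in at_right 0. \<forall>x\<in>UNIV. a * ((T t f x - f x) / t) + b * ((T t f' x - f' x) / t) =
        (T t (\<lambda>x. a * f x + b * f' x) x - (a * f x + b * f' x)) / t"
      unfolding eventually_at_right_field
      by (intro exI[of _ 1]) (auto simp: T_lincomb C field_simps)
  qed auto
  then show ?thesis using C by (auto simp: generator_graph_def C0_space_lincomb)
qed

lemma gen_diff: "(f, g) \<in> gen \<Longrightarrow> (f', g') \<in> gen \<Longrightarrow> ((\<lambda>x. f x - f' x), (\<lambda>x. g x - g' x)) \<in> gen"
  using gen_lincomb[of f g f' g' 1 "-1"] by simp

lemma gen_scale: "(f, g) \<in> gen \<Longrightarrow> ((\<lambda>x. a * f x), (\<lambda>x. a * g x)) \<in> gen"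
  using gen_lincomb[of f g f g a 0] by simp

lemma generator_eq: "(f, g) \<in> gen \<Longrightarrow> generator UNIV C0_space T f = g"
  unfolding generator_def
proof (rule the_equality)
  fix g' assume "(f, g) \<in> gen" "(f, g') \<in> gen"
  then have "uniform_limit UNIV (\<lambda>t x. (T t f x - f x) / t) g (at_right 0)"
    "uniform_limit UNIV (\<lambda>t x. (T t f x - f x) / t) g' (at_right 0)"
    by (auto simp: generator_graph_def)
  then have "g' x = g x" for x
    using tendsto_unique[OF trivial_limit_at_right_real]
    by (meson UNIV_I tendsto_uniform_limitI)
  then show "g' = g" by blast
qed

text \<open>The positive maximum principle: at a nonnegative global maximum, a positive contraction
  can only decrease the value.\<close>

lemma gen_max_principle:
  assumes g: "(f, g) \<in> gen" and max: "\<And>y. f y \<le> f x" and nonneg: "f x \<ge> 0"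
  shows "g x \<le> 0"
proof (rule tendsto_le[OF trivial_limit_at_right_real tendsto_const])
  show "((\<lambda>t. (T t f x - f x) / t) \<longlongrightarrow> g x) (at_right 0)"
    using g by (auto simp: generator_graph_def intro: tendsto_uniform_limitI)
  have "f \<in> C0_space" using g by (simp add: gen_iff)
  then show "\<forall>\<^sub>F t in at_right 0. (T t f x - f x) / t \<le> 0"
    unfolding eventually_at_right_field using max nonneg
    by (intro exI[of _ 1]) (auto intro!: divide_nonpos_pos T_le)
qed

text \<open>If \<open>\<phi>\<close> is \<open>1\<close> at \<open>x\<close> and \<open>u\<close> is dominated by \<open>1 - \<phi>\<close>, then \<open>B\<phi> \<pm> u\<close> is maximal at \<open>x\<close>; so
  the generator sees the far-away part of a function only through its supremum norm.\<close>

lemma gen_far_bound: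
  assumes u: "(u, Lu) \<in> gen" and \<phi>: "(\<phi>, L\<phi>) \<in> gen" and \<phi>x: "\<phi> x = 1"
    and le: "\<And>y. \<bar>u y\<bar> \<le> B * (1 - \<phi> y)" and B: "B \<ge> 0"
  shows "\<bar>Lu x\<bar> \<le> - B * L\<phi> x"
proof -
  have ux: "u x = 0" using le[of x] \<phi>x by simp
  have "s * Lu x + B * L\<phi> x \<le> 0" if "s = 1 \<or> s = -1" for s
  proof (rule gen_max_principle[OF gen_lincomb[OF u \<phi>, of s B], of x])
    show "s * u y + B * \<phi> y \<le> s * u x + B * \<phi> x" for y
      using le[of y] ux \<phi>x that by (auto simp: algebra_simps)
    show "0 \<le> s * u x + B * \<phi> x" using ux \<phi>x B by simp
  qed
  from this[of 1] this[of "-1"] show ?thesis by auto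
qed

text \<open>The increment over \<open>[0, h]\<close> is a telescoping sum of \<open>n\<close> increments over steps of length \<open>h / n\<close>,
  each of size about \<open>h / n\<close> times the bound on the generator; contractivity passes these bounds on to
  later times.\<close>

lemma T_gen_le:
  assumes fg: "(f, g) \<in> gen" and B: "\<And>y. \<bar>g y\<bar> \<le> B" and h: "h \<ge> 0"
  shows "\<bar>T h f x - f x\<bar> \<le> h * B"
proof (cases "h = 0")
  case True
  then show ?thesis using fg by (simp add: gen_iff T_zero)
next
  case False
  then have h: "h > 0" using h by simp
  have f: "f \<in> C0_space" using fg by (simp add: gen_iff)
  show ?thesis
  proof (rule field_le_epsilon)
    fix e :: real assume e: "e > 0"
    obtain \<delta> where \<delta>: "\<delta> > 0" "\<And>t x. 0 < t \<Longrightarrow> t < \<delta> \<Longrightarrow> \<bar>(T t f x - f x) / t - g x\<bar> < e/h"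
      using gen_quotient_close[OF fg divide_pos_pos[OF e h]] by blast
    obtain n :: nat where n: "h / \<delta> < real n" using reals_Archimedean2 by blast
    have n0: "n > 0" using n h \<delta>(1) by (metis divide_pos_pos less_trans of_nat_0_less_iff)
    define r where "r = h / real n"
    have r: "0 < r" "r < \<delta>" using n n0 \<delta>(1) h by (simp_all add: r_def field_simps)
    have 1: "\<bar>T r f y - f y\<bar> \<le> r * (B + e/h)" for y
    proof -
      have "\<bar>(T r f y - f y) / r\<bar> \<le> B + e/h"
        using \<delta>(2)[OF r, of y] B[of y] by linarith
      then show ?thesis using r by (simp add: abs_divide pos_divide_le_eq mult.commute)
    qed
    have "\<bar>T (real k * r) f x - f x\<bar> \<le> real k * r * (B + e/h)" for k
    proof (induction k)
      case 0
      then show ?case using f by (simp add: T_zero)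
    next
      case (Suc k)
      have "\<bar>T (real k * r + r) f x - T (real k * r) f x\<bar> \<le> r * (B + e/h)"
        using T_shift_le[OF _ _ f 1, of "real k * r" x] r by simp
      then show ?case using Suc by (simp add: algebra_simps)
    qed
    from this[of n] show "\<bar>T h f x - f x\<bar> \<le> h * B + e"
      using n0 h by (simp add: r_def algebra_simps)
  qed
qed

text \<open>Shifting \<open>u = \<integral>\<^sub>0\<^sup>h T\<^sub>s f ds\<close> by a small time \<open>t\<close> replaces the piece over \<open>[0, t]\<close> by the piece over
  \<open>[h, h + t]\<close>; the difference is about \<open>t (T\<^sub>h f - f)\<close>.\<close>

lemma gen_integral:
  assumes f: "f \<in> C0_space" and h: "h > 0"
  shows "((\<lambda>x. integral {0..h} (\<lambda>s. T s f x)), (\<lambda>x. T h f x - f x)) \<in> gen"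
proof -
  define u where "u = (\<lambda>x. integral {0..h} (\<lambda>s. T s f x))"
  define R where "R = (\<lambda>n a x. \<Sum>k<n. h / real n * T (a + real k * (h / real n)) f x)"
  have R: "R n a \<in> C0_space" if "a \<ge> 0" for n a
    unfolding R_def using that h f by (intro C0_space_sum C0_space_scale T_C0) auto
  have approx: "\<exists>n. \<forall>a\<ge>0. \<forall>x. \<bar>integral {a..a + h} (\<lambda>s. T s f x) - R n a x\<bar> \<le> e" if "e > 0" for e
    unfolding R_def by (rule riemann_approx[OF f h that]) blast
  have u: "u \<in> C0_space"
  proof (rule C0_space_closed)
    fix e :: real assume "e > 0"
    then obtain n where n: "\<And>a x. a \<ge> 0 \<Longrightarrow> \<bar>integral {a..a + h} (\<lambda>s. T s f x) - R n a x\<bar> \<le> e"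
      using approx by blast
    show "\<exists>g\<in>C0_space. \<forall>x. \<bar>g x - u x\<bar> \<le> e"
      using n[of 0] R[of 0 n] by (intro bexI[of _ "R n 0"]) (auto simp: u_def abs_minus_commute)
  qed
  have Tu: "T t u x = integral {t..t + h} (\<lambda>s. T s f x)" if t: "t \<ge> 0" for t x
  proof -
    have "\<bar>T t u x - integral {t..t + h} (\<lambda>s. T s f x)\<bar> \<le> e" if e: "e > 0" for e
    proof -
      obtain n where n: "\<And>a x. a \<ge> 0 \<Longrightarrow> \<bar>integral {a..a + h} (\<lambda>s. T s f x) - R n a x\<bar> \<le> e/2"
        using approx[of "e/2"] e by (meson half_gt_zero)
      have "T t (R n 0) x = (\<Sum>k<n. T t (\<lambda>y. h / real n * T (0 + real k * (h / real n)) f y) x)"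
        unfolding R_def
        by (rule T_sum[OF t], rule C0_space_scale, rule T_C0) (use h f in auto)
      also have "\<dots> = R n t x"
        unfolding R_def
      proof (rule sum.cong[OF refl])
        fix k
        let ?s = "0 + real k * (h / real n)" and ?c = "h / real n"
        have s: "?s \<ge> 0" using h by simp
        show "T t (\<lambda>y. ?c * T ?s f y) x = ?c * T (t + real k * (h / real n)) f x"
          using T_scale[OF t T_C0[OF s f], of ?c x] T_add[OF t s f, of x] by (simp only: add_0)
      qed
      finally have "T t (R n 0) x = R n t x" .
      moreover have "\<bar>T t u x - T t (R n 0) x\<bar> \<le> e/2"
        by (rule T_abs_diff_le) (use t u R[of 0 n] n[of 0] in \<open>auto simp: u_def\<close>)
      ultimately show ?thesis using n[of t x] t by linarith
    qed
    then have "\<bar>T t u x - integral {t..t + h} (\<lambda>s. T s f x)\<bar> \<le> 0"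
      by (metis add_0 field_le_epsilon)
    then show ?thesis by simp
  qed
  have "\<exists>\<delta>>0. \<forall>t>0. t < \<delta> \<longrightarrow> (\<forall>x. \<bar>(T t u x - u x) / t - (T h f x - f x)\<bar> < e)" if e: "e > 0" for e
  proof -
    obtain \<delta> where \<delta>: "\<delta> > 0" "\<And>r x. 0 \<le> r \<Longrightarrow> r < \<delta> \<Longrightarrow> \<bar>T r f x - f x\<bar> \<le> e/3"
      by (rule T_small[OF f, of "e/3"]) (use e in auto)
    have "\<bar>(T t u x - u x) / t - (T h f x - f x)\<bar> < e" if t: "t > 0" "t < \<delta>" for t x
    proof -
      let ?I = "\<lambda>a b. integral {a..b} (\<lambda>s. T s f x)"
      have "?I 0 t + ?I t (t + h) = ?I 0 (t + h)" "?I 0 h + ?I h (h + t) = ?I 0 (h + t)"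
        using t h by (auto intro!: Henstock_Kurzweil_Integration.integral_combine integrable_orbit[OF f])
      then have "T t u x - u x = ?I h (h + t) - ?I 0 t"
        using Tu[of t x] t by (simp add: u_def[THEN fun_cong, of x] add.commute)
      moreover have "\<bar>?I h (h + t) - t * T h f x\<bar> \<le> t * (e/3)"
        by (rule orbit_integral_close[OF f]) (use t h \<delta>(2) in auto)
      moreover have "\<bar>?I 0 t - t * f x\<bar> \<le> t * (e/3)"
        using orbit_integral_close[OF f, of 0 t "e/3" x] t \<delta>(2) by (auto simp: T_zero f)
      moreover have "t * (T h f x - f x) = t * T h f x - t * f x" "t * (2*e/3) = t * (e/3) + t * (e/3)"
        by (simp_all add: algebra_simps)
      ultimately have "\<bar>(T t u x - u x) - t * (T h f x - f x)\<bar> \<le> t * (2*e/3)"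
        by linarith
      moreover have "(T t u x - u x) / t - (T h f x - f x) = ((T t u x - u x) - t * (T h f x - f x)) / t"
        using t by (simp add: field_simps)
      ultimately have "\<bar>(T t u x - u x) / t - (T h f x - f x)\<bar> \<le> 2*e/3"
        using t by (simp add: abs_divide pos_divide_le_eq mult.commute)
      then show ?thesis using e by linarith
    qed
    then show ?thesis using \<delta>(1) by blast
  qed
  then show ?thesis
    using u f h by (auto simp: gen_iff u_def C0_space_diff T_C0)
qed

text \<open>Time averages of an orbit lie in the domain and approximate its starting point. Hence the
  domain is dense.\<close>

lemma gen_average:
  assumes f: "f \<in> C0_space" and h: "h > 0"
  obtains u where "(u, (\<lambda>x. (T h f x - f x) / h)) \<in> gen"
    "\<And>x e. (\<And>s y. 0 \<le> s \<Longrightarrow> s \<le> h \<Longrightarrow> \<bar>T s f y - f y\<bar> \<le> e) \<Longrightarrow> \<bar>u x - f x\<bar> \<le> e"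
proof (rule that)
  let ?u = "\<lambda>x. inverse h * integral {0..h} (\<lambda>s. T s f x)"
  show "(?u, (\<lambda>x. (T h f x - f x) / h)) \<in> gen"
    using gen_scale[OF gen_integral[OF f h], of "inverse h"] by (simp add: field_simps)
  fix x e assume e: "\<And>s y. 0 \<le> s \<Longrightarrow> s \<le> h \<Longrightarrow> \<bar>T s f y - f y\<bar> \<le> e"
  have "\<bar>integral {0..h} (\<lambda>s. T s f x) - h * f x\<bar> \<le> h * e"
    using orbit_integral_close[OF f, of 0 h e x] h e by (simp add: T_zero f)
  moreover have "?u x - f x = (integral {0..h} (\<lambda>s. T s f x) - h * f x) / h"
    using h by (simp add: field_simps)
  ultimately show "\<bar>?u x - f x\<bar> \<le> e"
    using h by (simp add: abs_divide pos_divide_le_eq mult.commute)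
qed

lemma gen_dense:
  assumes f: "f \<in> C0_space" and e: "e > 0"
  obtains u v where "(u, v) \<in> gen" "\<And>x. \<bar>u x - f x\<bar> \<le> e"
proof -
  obtain \<delta> where \<delta>: "\<delta> > 0" "\<And>r x. 0 \<le> r \<Longrightarrow> r < \<delta> \<Longrightarrow> \<bar>T r f x - f x\<bar> \<le> e"
    using T_small[OF f e] by blast
  have "\<delta>/2 > 0" using \<delta>(1) by simp
  then obtain u where "(u, (\<lambda>x. (T (\<delta>/2) f x - f x) / (\<delta>/2))) \<in> gen"
    "\<And>x e. (\<And>s y. 0 \<le> s \<Longrightarrow> s \<le> \<delta>/2 \<Longrightarrow> \<bar>T s f y - f y\<bar> \<le> e) \<Longrightarrow> \<bar>u x - f x\<bar> \<le> e"
    using gen_average[OF f] by blast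
  moreover have "\<bar>T s f y - f y\<bar> \<le> e" if "0 \<le> s" "s \<le> \<delta>/2" for s y
    using \<delta> that by simp
  ultimately show thesis using that by blast
qed

end


section \<open>Partial derivatives\<close>

text \<open>Differentiability is phrased through partial derivatives, one coordinate at a time, because this is how
  the function spaces are defined.\<close>

definition C1_on :: "(real ^ 'n) set \<Rightarrow> (real ^ 'n \<Rightarrow> real) \<Rightarrow> bool" where
  "C1_on S f \<longleftrightarrow> continuous_on S f \<and>
     (\<forall>i. (\<forall>x\<in>S. has_partial i f x) \<and> continuous_on S (partial i f))"

definition C2_on :: "(real ^ 'n) set \<Rightarrow> (real ^ 'n \<Rightarrow> real) \<Rightarrow> bool" where
  "C2_on S f \<longleftrightarrow> C1_on S f \<and> (\<forall>i. C1_on S (partial i f))"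

lemma has_partial_derivative:
  "has_partial i f x \<Longrightarrow> ((\<lambda>h. f (x + h *\<^sub>R axis i 1)) has_real_derivative partial i f x) (at 0)"
  unfolding has_partial_def partial_def by (simp add: DERIV_deriv_iff_real_differentiable)

lemma partialI:
  assumes "((\<lambda>h. f (x + h *\<^sub>R axis i 1)) has_real_derivative D) (at 0)"
  shows "has_partial i f x" "partial i f x = D"
  using assms unfolding has_partial_def partial_def
  by (auto simp: DERIV_imp_deriv real_differentiable_def)

lemma partial_cong_open:
  assumes S: "open S" "x \<in> S" and eq: "\<And>y. y \<in> S \<Longrightarrow> f y = g y"
  shows "has_partial i f x \<longleftrightarrow> has_partial i g x" "partial i f x = partial i g x"
proof -
  have "((\<lambda>h::real. x + h *\<^sub>R axis i 1) \<longlongrightarrow> x) (nhds 0)"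
    using continuous_on_def by (intro tendsto_eq_intros) (auto simp: filterlim_ident)
  then have ev: "\<forall>\<^sub>F h::real in nhds 0. f (x + h *\<^sub>R axis i 1) = g (x + h *\<^sub>R axis i 1)"
    by (rule eventually_mono[OF topological_tendstoD[OF _ S]]) (rule eq)
  have D: "((\<lambda>h. f (x + h *\<^sub>R axis i 1)) has_real_derivative D) (at 0) \<longleftrightarrow>
      ((\<lambda>h. g (x + h *\<^sub>R axis i 1)) has_real_derivative D) (at 0)" for D
    by (rule DERIV_cong_ev) (use ev in auto)
  show "has_partial i f x \<longleftrightarrow> has_partial i g x"
    unfolding has_partial_def real_differentiable_def using D by simp
  show "partial i f x = partial i g x"
    unfolding partial_def deriv_def using D by simp
qed

lemma partial_zero_open:
  assumes "open S" "x \<in> S" "\<And>y. y \<in> S \<Longrightarrow> f y = 0"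
  shows "has_partial i f x" "partial i f x = 0"
  using partial_cong_open[OF assms(1,2), of f "\<lambda>_. 0" i] assms(3) partialI[of "\<lambda>_. 0" x i 0] by auto

lemma C1_on_cong:
  assumes "open S" "\<And>y. y \<in> S \<Longrightarrow> f y = g y"
  shows "C1_on S f \<longleftrightarrow> C1_on S g"
proof -
  have "continuous_on S f = continuous_on S g" by (rule continuous_on_cong) (use assms in auto)
  moreover have "continuous_on S (partial i f) = continuous_on S (partial i g)" for i
    by (rule continuous_on_cong) (use partial_cong_open[OF assms(1), of _ f g] assms(2) in auto)
  ultimately show ?thesis
    unfolding C1_on_def using partial_cong_open(1)[OF assms(1), of _ f g] assms(2) by auto
qed

lemma C1_on_Un: "open S \<Longrightarrow> open S' \<Longrightarrow> C1_on S f \<Longrightarrow> C1_on S' f \<Longrightarrow> C1_on (S \<union> S') f"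
  unfolding C1_on_def by (auto intro: continuous_on_open_Un)

lemma C2_on_Un: "open S \<Longrightarrow> open S' \<Longrightarrow> C2_on S f \<Longrightarrow> C2_on S' f \<Longrightarrow> C2_on (S \<union> S') f"
  unfolding C2_on_def by (auto intro: C1_on_Un)

lemma C1_on_subset: "C1_on S f \<Longrightarrow> S' \<subseteq> S \<Longrightarrow> C1_on S' f"
  unfolding C1_on_def by (auto intro: continuous_on_subset)

lemma C2_on_subset: "C2_on S f \<Longrightarrow> S' \<subseteq> S \<Longrightarrow> C2_on S' f"
  unfolding C2_on_def by (auto intro: C1_on_subset)

lemma C2_on_imp_C1_on: "C2_on S f \<Longrightarrow> C1_on S f"
  by (simp add: C2_on_def)

lemma partial_lincomb:
  assumes "has_partial i f x" "has_partial i g x"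
  shows "has_partial i (\<lambda>x. a * f x + b * g x) x"
    "partial i (\<lambda>x. a * f x + b * g x) x = a * partial i f x + b * partial i g x"
proof -
  have "((\<lambda>h. a * f (x + h *\<^sub>R axis i 1) + b * g (x + h *\<^sub>R axis i 1)) has_real_derivative
      a * partial i f x + b * partial i g x) (at 0)"
    by (intro DERIV_add DERIV_cmult has_partial_derivative assms)
  from partialI[OF this] show "has_partial i (\<lambda>x. a * f x + b * g x) x"
    "partial i (\<lambda>x. a * f x + b * g x) x = a * partial i f x + b * partial i g x" by auto
qed

lemma partial_mult:
  assumes "has_partial i f x" "has_partial i g x"
  shows "has_partial i (\<lambda>x. f x * g x) x"
    "partial i (\<lambda>x. f x * g x) x = partial i f x * g x + f x * partial i g x"
proof -
  have "((\<lambda>h. f (x + h *\<^sub>R axis i 1) * g (x + h *\<^sub>R axis i 1)) has_real_derivative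
      partial i f x * g x + f x * partial i g x) (at 0)"
    using DERIV_mult[OF has_partial_derivative[OF assms(1)] has_partial_derivative[OF assms(2)]]
    by (simp add: mult.commute add.commute)
  from partialI[OF this] show "has_partial i (\<lambda>x. f x * g x) x"
    "partial i (\<lambda>x. f x * g x) x = partial i f x * g x + f x * partial i g x" by auto
qed

lemma partial_compose:
  assumes "has_partial i f x" "\<And>s. (p has_real_derivative p' s) (at s)"
  shows "has_partial i (\<lambda>x. p (f x)) x" "partial i (\<lambda>x. p (f x)) x = p' (f x) * partial i f x"
proof -
  have "((\<lambda>h. p (f (x + h *\<^sub>R axis i 1))) has_real_derivative p' (f x) * partial i f x) (at 0)"
    using DERIV_chain2[OF assms(2) has_partial_derivative[OF assms(1)]] by simp
  from partialI[OF this] show "has_partial i (\<lambda>x. p (f x)) x"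
    "partial i (\<lambda>x. p (f x)) x = p' (f x) * partial i f x" by auto
qed

lemma C1_on_lincomb:
  assumes "C1_on S f" "C1_on S g"
  shows "C1_on S (\<lambda>x. a * f x + b * g x)"
proof -
  have "continuous_on S (partial i (\<lambda>x. a * f x + b * g x))" for i
    by (subst continuous_on_cong[OF refl partial_lincomb(2)])
       (use assms in \<open>auto simp: C1_on_def intro!: continuous_intros\<close>)
  then show ?thesis
    using assms unfolding C1_on_def by (auto intro!: continuous_intros partial_lincomb)
qed

lemma C1_on_mult:
  assumes "C1_on S f" "C1_on S g"
  shows "C1_on S (\<lambda>x. f x * g x)"
proof -
  have "continuous_on S (partial i (\<lambda>x. f x * g x))" for i
    by (subst continuous_on_cong[OF refl partial_mult(2)])
       (use assms in \<open>auto simp: C1_on_def intro!: continuous_intros\<close>)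
  then show ?thesis
    using assms unfolding C1_on_def by (auto intro!: continuous_intros partial_mult)
qed

lemma C1_on_compose:
  assumes f: "C1_on S f" and p: "\<And>s. (p has_real_derivative p' s) (at s)"
    and p': "continuous_on UNIV p'"
  shows "C1_on S (\<lambda>x. p (f x))"
proof -
  have pc: "continuous_on UNIV p" using p by (auto intro: DERIV_isCont continuous_at_imp_continuous_on)
  have "continuous_on S (partial i (\<lambda>x. p (f x)))" for i
    by (subst continuous_on_cong[OF refl partial_compose(2)[OF _ p]])
       (use f in \<open>auto simp: C1_on_def intro!: continuous_intros continuous_on_compose2[OF p']\<close>)
  then show ?thesis
    using f unfolding C1_on_def
    by (auto intro!: continuous_on_compose2[OF pc] partial_compose(1)[OF _ p])
qed

lemma C2_onI:
  assumes S: "open S" and f: "C1_on S f"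
    and D: "\<And>i x. x \<in> S \<Longrightarrow> partial i f x = g i x" and g: "\<And>i. C1_on S (g i)"
  shows "C2_on S f"
  unfolding C2_on_def using f g C1_on_cong[OF S, of "partial _ f" "g _"] D by auto

lemma C2_on_lincomb:
  assumes S: "open S" and f: "C2_on S f" and g: "C2_on S g"
  shows "C2_on S (\<lambda>x. a * f x + b * g x)"
proof (rule C2_onI[OF S])
  show "C1_on S (\<lambda>x. a * f x + b * g x)" using f g by (simp add: C1_on_lincomb C2_on_def)
  show "partial i (\<lambda>x. a * f x + b * g x) x = a * partial i f x + b * partial i g x" if "x \<in> S" for i x
    by (rule partial_lincomb) (use f g that in \<open>auto simp: C2_on_def C1_on_def\<close>)
  show "C1_on S (\<lambda>x. a * partial i f x + b * partial i g x)" for i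
    using f g by (simp add: C1_on_lincomb C2_on_def)
qed

lemma C2_on_mult:
  assumes S: "open S" and f: "C2_on S f" and g: "C2_on S g"
  shows "C2_on S (\<lambda>x. f x * g x)"
proof (rule C2_onI[OF S])
  show "C1_on S (\<lambda>x. f x * g x)" using f g by (simp add: C1_on_mult C2_on_def)
  show "partial i (\<lambda>x. f x * g x) x = partial i f x * g x + f x * partial i g x" if "x \<in> S" for i x
    by (rule partial_mult) (use f g that in \<open>auto simp: C2_on_def C1_on_def\<close>)
  show "C1_on S (\<lambda>x. partial i f x * g x + f x * partial i g x)" for i
    using C1_on_lincomb[OF C1_on_mult C1_on_mult, of S "partial i f" g f "partial i g" 1 1] f g
    by (simp add: C2_on_def)
qed

lemma C2_on_compose:
  assumes S: "open S" and f: "C2_on S f" and p: "\<And>s. (p has_real_derivative p' s) (at s)"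
    and p': "\<And>s. (p' has_real_derivative p'' s) (at s)" and p'': "continuous_on UNIV p''"
  shows "C2_on S (\<lambda>x. p (f x))"
proof (rule C2_onI[OF S])
  have p'c: "continuous_on UNIV p'" using p' by (auto intro: DERIV_isCont continuous_at_imp_continuous_on)
  show "C1_on S (\<lambda>x. p (f x))" using f by (auto intro: C1_on_compose p p'c C2_on_imp_C1_on)
  show "partial i (\<lambda>x. p (f x)) x = p' (f x) * partial i f x" if "x \<in> S" for i x
    by (rule partial_compose[OF _ p]) (use f that in \<open>auto simp: C2_on_def C1_on_def\<close>)
  show "C1_on S (\<lambda>x. p' (f x) * partial i f x)" for i
    using f by (intro C1_on_mult C1_on_compose[OF _ p' p'']) (auto simp: C2_on_def)
qed

lemma C2_on_const:
  fixes S :: "(real ^ 'n) set"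
  shows "C2_on S (\<lambda>_. a)"
proof -
  have D: "partial i (\<lambda>_. b) = (\<lambda>_. 0)" for i :: 'n and b
    using partialI(2)[of "\<lambda>_. b" _ i 0] by auto
  have "C1_on S (\<lambda>_. b)" for b
    unfolding C1_on_def D by (auto intro: partialI(1)[of _ _ _ 0])
  then show ?thesis unfolding C2_on_def D by auto
qed

lemma C2_on_affine: "open S \<Longrightarrow> C2_on S f \<Longrightarrow> C2_on S (\<lambda>x. a * f x + b)"
  using C2_on_lincomb[OF _ _ C2_on_const, of S f a 1 b] by simp

lemma C02_space_iff:
  "f \<in> C02_space \<longleftrightarrow> C2_on UNIV f \<and> f \<in> C0_space \<and> (\<forall>i. partial i f \<in> C0_space) \<and>
     (\<forall>i j. partial j (partial i f) \<in> C0_space)"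
  unfolding C02_space_def C2_on_def C1_on_def twice_partial_on_def by (auto simp: C0_space_def)

lemma C02_dom_iff: "f \<in> C02_dom \<Omega> \<longleftrightarrow> C2_on \<Omega> f \<and> f \<in> C0_dom \<Omega>"
  unfolding C02_dom_def C2_on_def C1_on_def twice_partial_on_def by (auto simp: C0_dom_def)

lemma C02_space_lincomb:
  assumes f: "f \<in> C02_space" and g: "g \<in> C02_space"
  shows "(\<lambda>x. a * f x + b * g x) \<in> C02_space"
proof -
  have p: "has_partial i f x" "has_partial i g x" "has_partial j (partial i f) x"
      "has_partial j (partial i g) x" for i j x
    using f g by (auto simp: C02_space_def twice_partial_on_def)
  have D: "partial i (\<lambda>x. a * f x + b * g x) = (\<lambda>x. a * partial i f x + b * partial i g x)" for i
    using partial_lincomb(2)[OF p(1,2)] by blast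
  have D2: "partial j (\<lambda>x. a * partial i f x + b * partial i g x) =
      (\<lambda>x. a * partial j (partial i f) x + b * partial j (partial i g) x)" for i j
    using partial_lincomb(2)[OF p(3,4)] by blast
  show ?thesis
    using f g unfolding C02_space_iff by (auto intro!: C2_on_lincomb C0_space_lincomb simp: D D2)
qed

lemma C02_space_diff: "f \<in> C02_space \<Longrightarrow> g \<in> C02_space \<Longrightarrow> (\<lambda>x. f x - g x) \<in> C02_space"
  using C02_space_lincomb[of f g 1 "-1"] by simp

lemma C0_space_compact_support:
  assumes "continuous_on UNIV f" "bounded K" "\<And>x. x \<notin> K \<Longrightarrow> f x = 0"
  shows "f \<in> C0_space"
  unfolding C0_space_iff
proof (intro conjI allI impI)
  fix e :: real assume "e > 0"
  obtain b where "\<And>x. x \<in> K \<Longrightarrow> norm x \<le> b" using assms(2) by (auto simp: bounded_iff)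
  then have "\<forall>x. b + 1 \<le> norm x \<longrightarrow> f x = 0" using assms(3) by (metis add_le_same_cancel1 not_one_le_zero order_trans)
  then show "\<exists>R. \<forall>x. R \<le> norm x \<longrightarrow> \<bar>f x\<bar> < e" using \<open>e > 0\<close> by (intro exI[of _ "b+1"]) auto
qed (rule assms(1))

text \<open>Off \<open>K\<close> the function is locally zero, so smoothness on the two open sets \<open>\<Omega>\<close> and \<open>- K\<close> patches
  together.\<close>

lemma C02_space_compact_support:
  assumes f: "C2_on \<Omega> f" and \<Omega>: "open \<Omega>" and K: "compact K" "K \<subseteq> \<Omega>"
    and zero: "\<And>x. x \<notin> K \<Longrightarrow> f x = 0"
  shows "f \<in> C02_space"
proof -
  have oK: "open (- K)" using K(1) by (simp add: compact_imp_closed open_Compl)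
  have pz: "partial i f x = 0" if "x \<notin> K" for i x
    using partial_zero_open(2)[OF oK, of x f i] that zero by simp
  have ppz: "partial j (partial i f) x = 0" if "x \<notin> K" for i j x
    using partial_zero_open(2)[OF oK, of x "partial i f" j] that pz by simp
  have "C2_on (- K) f"
  proof (rule C2_onI[OF oK])
    have 1: "C1_on (- K) (\<lambda>_. 0)" by (rule C2_on_imp_C1_on[OF C2_on_const])
    then show "C1_on (- K) f" using C1_on_cong[OF oK, of f "\<lambda>_. 0"] zero by simp
    show "partial i f x = 0" if "x \<in> - K" for i x using pz that by simp
    show "C1_on (- K) (\<lambda>x. 0)" by (rule 1)
  qed
  then have "C2_on (\<Omega> \<union> - K) f" using C2_on_Un[OF \<Omega> oK f] by simp
  moreover have "\<Omega> \<union> - K = UNIV" using K by auto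
  ultimately have C2: "C2_on UNIV f" by simp
  then show ?thesis
    unfolding C02_space_iff using K(1) zero pz ppz
    by (auto simp: C2_on_def C1_on_def intro!: C0_space_compact_support[of _ K] compact_imp_bounded)
qed


section \<open>Zero extensions and the distance to the complement\<close>

definition depth :: "(real ^ 'n) set \<Rightarrow> real ^ 'n \<Rightarrow> real" where
  "depth \<Omega> y = infdist y (- \<Omega>)"

lemma depth_nonneg: "0 \<le> depth \<Omega> y"
  by (simp add: depth_def infdist_nonneg)

lemma continuous_on_depth: "continuous_on S (depth \<Omega>)"
  unfolding depth_def by (intro continuous_intros)

lemma depth_outside: "y \<notin> \<Omega> \<Longrightarrow> depth \<Omega> y = 0"
  by (simp add: depth_def)

lemma depth_pos:
  assumes "open \<Omega>" "bounded \<Omega>" "y \<in> \<Omega>"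
  shows "0 < depth \<Omega> y"
proof -
  have "- \<Omega> \<noteq> {}" using assms(2) not_bounded_UNIV by (metis Compl_empty_eq double_complement)
  then have "depth \<Omega> y \<noteq> 0"
    using in_closed_iff_infdist_zero[of "- \<Omega>" y] assms by (auto simp: depth_def)
  then show ?thesis using depth_nonneg[of \<Omega> y] by linarith
qed

lemma in_domain_if_depth_pos: "0 < a \<Longrightarrow> a \<le> depth \<Omega> y \<Longrightarrow> y \<in> \<Omega>"
  using depth_outside[of y \<Omega>] by force

lemma open_depth_greater: "open {y. a < depth \<Omega> y}"
  by (intro open_Collect_less continuous_on_const continuous_on_depth)

lemma compact_depth_ge:
  assumes "bounded \<Omega>" "0 < a"
  shows "compact {y. a \<le> depth \<Omega> y}"
  unfolding compact_eq_bounded_closed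
proof
  show "bounded {y. a \<le> depth \<Omega> y}"
    by (rule bounded_subset[OF assms(1)]) (use in_domain_if_depth_pos[OF assms(2)] in auto)
  show "closed {y. a \<le> depth \<Omega> y}"
    by (intro closed_Collect_le continuous_on_const continuous_on_depth)
qed

lemma compact_depth_bound:
  assumes "open \<Omega>" "bounded \<Omega>" "compact K" "K \<subseteq> \<Omega>"
  obtains a where "0 < a" "\<And>x. x \<in> K \<Longrightarrow> a \<le> depth \<Omega> x"
proof (cases "K = {}")
  case True
  then show ?thesis using that[of 1] by auto
next
  case False
  then obtain z where "z \<in> K" "\<And>x. x \<in> K \<Longrightarrow> depth \<Omega> z \<le> depth \<Omega> x"
    using continuous_attains_inf[OF assms(3) False continuous_on_depth] by blast
  then show ?thesis using that depth_pos[OF assms(1,2)] assms(4) by blast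
qed

lemma depth_in_C0_space:
  assumes "bounded \<Omega>"
  shows "depth \<Omega> \<in> C0_space"
  by (rule C0_space_compact_support[OF continuous_on_depth assms depth_outside])

text \<open>The set where the function is not small is compact and contained in \<open>\<Omega>\<close>, hence at a positive distance
  from the complement.\<close>

lemma small_near_boundary:
  fixes f :: "real ^ 'n \<Rightarrow> real"
  assumes \<Omega>: "open \<Omega>" "bounded \<Omega>" and f: "f \<in> C0_space" "\<And>y. y \<notin> \<Omega> \<Longrightarrow> f y = 0" and e: "e > 0"
  obtains a where "0 < a" "\<And>y. depth \<Omega> y < a \<Longrightarrow> \<bar>f y\<bar> \<le> e"
proof -
  let ?K = "{y. e \<le> \<bar>f y\<bar>}"
  have sub: "?K \<subseteq> \<Omega>" using f(2) e by force
  have "continuous_on UNIV f" using f(1) by (simp add: C0_space_def)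
  then have "closed ?K" by (intro closed_Collect_le continuous_intros)
  then have "compact ?K" using bounded_subset[OF \<Omega>(2) sub] by (simp add: compact_eq_bounded_closed)
  from compact_depth_bound[OF \<Omega> this sub] obtain a
    where a: "0 < a" "\<And>x. x \<in> ?K \<Longrightarrow> a \<le> depth \<Omega> x" by blast
  have "\<bar>f y\<bar> \<le> e" if "depth \<Omega> y < a" for y
    using a(2)[of y] that by (cases "e \<le> \<bar>f y\<bar>") auto
  then show thesis using a(1) that by blast
qed

text \<open>The zero extension is continuous at a boundary point because it tends to \<open>0\<close> from inside and is
  \<open>0\<close> outside.\<close>

lemma C0_dom_imp_C0_space:
  assumes \<Omega>: "open \<Omega>" "bounded \<Omega>" and f: "f \<in> C0_dom \<Omega>"
  shows "f \<in> C0_space"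
proof (rule C0_space_compact_support[OF _ \<Omega>(2)])
  have zero: "f x = 0" if "x \<notin> \<Omega>" for x using f that by (simp add: C0_dom_def)
  then show "\<And>x. x \<notin> \<Omega> \<Longrightarrow> f x = 0" .
  have "(f \<longlongrightarrow> f x) (at x)" for x
  proof (cases "x \<in> \<Omega>")
    case True
    then show ?thesis
      using f \<Omega>(1) by (simp add: C0_dom_def continuous_on_eq_continuous_at isCont_def)
  next
    case False
    have "(f \<longlongrightarrow> 0) (at x within \<Omega>)"
    proof (cases "x \<in> closure \<Omega>")
      case True
      then show ?thesis using f False \<Omega>(1) by (simp add: C0_dom_def frontier_def interior_open)
    next
      case False
      then have "at x within \<Omega> = bot"
        using closure_def trivial_limit_within by fastforce
      then show ?thesis by simp
    qed
    moreover have "(f \<longlongrightarrow> 0) (at x within - \<Omega>)"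
      by (rule tendsto_eventually) (simp add: eventually_at_filter zero)
    ultimately have "(f \<longlongrightarrow> 0) (at x within \<Omega> \<union> - \<Omega>)" by (rule Lim_Un)
    then show ?thesis using zero[OF False] by simp
  qed
  then show "continuous_on UNIV f" by (simp add: continuous_on_def)
qed

lemma C0_space_imp_C0_dom:
  assumes "open \<Omega>" "f \<in> C0_space" "\<And>x. x \<notin> \<Omega> \<Longrightarrow> f x = 0"
  shows "f \<in> C0_dom \<Omega>"
  unfolding C0_dom_def
proof (intro CollectI conjI ballI allI impI)
  have c: "continuous_on UNIV f" using assms(2) by (simp add: C0_space_def)
  then show "continuous_on \<Omega> f" by (rule continuous_on_subset) simp
  fix b assume "b \<in> frontier \<Omega>"
  then have "f b = 0" using assms(1,3) by (simp add: frontier_def interior_open)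
  then show "(f \<longlongrightarrow> 0) (at b within \<Omega>)"
    using c by (metis UNIV_I continuous_on_def tendsto_within_subset top_greatest)
qed (rule assms(3))

section \<open>Smooth cut-off functions from a smooth core\<close>

lemma DERIV_cubic_ramp:
  "((\<lambda>s::real. (max 0 s)^3) has_real_derivative 3 * (max 0 s)^2) (at s)"
  "((\<lambda>s::real. 3 * (max 0 s)^2) has_real_derivative 6 * max 0 s) (at s)"
proof -
  have pos: "((\<lambda>s::real. (max 0 s)^n) has_real_derivative real n * (max 0 s)^(n-1)) (at s)"
    if "s > 0" "n > 0" for n
  proof (rule DERIV_cong_ev[THEN iffD1])
    show "((\<lambda>s::real. s^n) has_real_derivative real n * s^(n-1)) (at s)" using DERIV_pow[of n s] by simp
    show "\<forall>\<^sub>F x in nhds s. x^n = (max 0 x)^n"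
      using eventually_nhds_in_open[of "{0<..}" s] that(1) by (auto elim!: eventually_mono)
  qed (use that in auto)
  have neg: "((\<lambda>s::real. (max 0 s)^n) has_real_derivative real n * (max 0 s)^(n-1)) (at s)"
    if "s < 0" "n > 1" for n
  proof (rule DERIV_cong_ev[THEN iffD1])
    show "((\<lambda>s::real. 0) has_real_derivative 0) (at s)" by simp
    show "\<forall>\<^sub>F x in nhds s. 0 = (max 0 x)^n"
      using eventually_nhds_in_open[of "{..<0}" s] that by (auto elim!: eventually_mono)
  qed (use that in auto)
  have zero: "((\<lambda>s::real. (max 0 s)^n) has_real_derivative 0) (at 0)" if "n > 1" for n
    unfolding has_field_derivative_iff
  proof (rule Lim_null_comparison)
    show "((\<lambda>y::real. \<bar>y\<bar>^(n-1)) \<longlongrightarrow> 0) (at 0)"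
      using that by (auto intro!: tendsto_eq_intros)
    show "\<forall>\<^sub>F y::real in at 0. norm (((max 0 y)^n - (max 0 0)^n) / (y - 0)) \<le> \<bar>y\<bar>^(n-1)"
      using that by (intro always_eventually allI)
        (auto simp: max_def power_eq_if[of _ n] abs_mult abs_divide)
  qed
  show "((\<lambda>s::real. (max 0 s)^3) has_real_derivative 3 * (max 0 s)^2) (at s)"
    using pos[of 3] neg[of 3] zero[of 3] by (cases s "0::real" rule: linorder_cases) auto
  have "((\<lambda>s::real. (max 0 s)^2) has_real_derivative 2 * max 0 s) (at s)"
    using pos[of 2] neg[of 2] zero[of 2] by (cases s "0::real" rule: linorder_cases) auto
  from DERIV_cmult[OF this, of 3]
  show "((\<lambda>s::real. 3 * (max 0 s)^2) has_real_derivative 6 * max 0 s) (at s)" by simp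
qed

text \<open>A \<open>C\<^sup>2\<close> step function rising from \<open>0\<close> at \<open>e\<close> to \<open>1\<close> at \<open>2 * e\<close>.\<close>

definition smooth_step :: "real \<Rightarrow> real \<Rightarrow> real" where
  "smooth_step e s = 1 - (max 0 (1 - (max 0 (s / e - 1))^3))^3"

lemma smooth_step_range: "0 \<le> smooth_step e s" "smooth_step e s \<le> 1"
proof -
  have "max 0 (1 - (max 0 (s / e - 1))^3) \<le> 1" by simp
  then have "(max 0 (1 - (max 0 (s / e - 1))^3))^3 \<le> 1" by (intro power_le_one) auto
  then show "0 \<le> smooth_step e s" "smooth_step e s \<le> 1"
    unfolding smooth_step_def by (simp_all del: max_less_iff_conj)
qed

lemma smooth_step_low: "e > 0 \<Longrightarrow> s \<le> e \<Longrightarrow> smooth_step e s = 0"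
  by (simp add: smooth_step_def max_def field_simps)

lemma smooth_step_high:
  assumes "e > 0" "2 * e \<le> s" shows "smooth_step e s = 1"
proof -
  have "1 \<le> s / e - 1" using assms by (simp add: field_simps)
  then have "1 \<le> (max 0 (s / e - 1))^3" by (intro one_le_power) auto
  then show ?thesis by (simp add: smooth_step_def)
qed

lemma C2_on_smooth_step:
  assumes "open S" "C2_on S f"
  shows "C2_on S (\<lambda>x. smooth_step e (f x))"
proof -
  have cub: "C2_on S (\<lambda>x. (max 0 (g x))^3)" if "C2_on S g" for g
    by (rule C2_on_compose[OF assms(1) that DERIV_cubic_ramp]) (intro continuous_intros)
  have 1: "C2_on S (\<lambda>x. (max 0 (f x / e - 1))^3)"
    using cub[OF C2_on_affine[OF assms, of "1/e" "-1"]] by simp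
  have 2: "C2_on S (\<lambda>x. (max 0 (1 - (max 0 (f x / e - 1))^3))^3)"
    using cub[OF C2_on_affine[OF assms(1) 1, of "-1" 1]] by simp
  show ?thesis
    using C2_on_affine[OF assms(1) 2, of "-1" 1] by (simp add: smooth_step_def)
qed

text \<open>All smoothness enters through the core \<open>C\<^sub>0\<^sup>2(\<real>\<^sup>d)\<close>, which is dense in \<open>C\<^sub>0(\<real>\<^sup>d)\<close> because
  the domain of the generator is.\<close>

locale feller_core = feller_semigroup T
  for T :: "real \<Rightarrow> (real ^ 'n \<Rightarrow> real) \<Rightarrow> real ^ 'n \<Rightarrow> real" +
  assumes core: "is_core UNIV C0_space T C02_space"
begin

abbreviation L :: "(real ^ 'n \<Rightarrow> real) \<Rightarrow> real ^ 'n \<Rightarrow> real" where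
  "L \<equiv> generator UNIV C0_space T"

lemma C02_gen: "f \<in> C02_space \<Longrightarrow> (f, L f) \<in> gen"
  using core generator_eq unfolding is_core_def generator_dom_def by blast

lemma L_bounded:
  assumes "f \<in> C02_space"
  obtains B where "B \<ge> 0" "\<And>x. \<bar>L f x\<bar> \<le> B"
  using C02_gen[OF assms] C0_space_bounded[of "L f"] unfolding gen_iff by blast

lemma core_approx:
  assumes uv: "(u, v) \<in> gen" and e: "e > 0"
  obtains p :: "real ^ 'n \<Rightarrow> real" where "p \<in> C02_space" "\<And>x. \<bar>p x - u x\<bar> \<le> e" "\<And>x. \<bar>L p x - v x\<bar> \<le> e"
proof -
  have "u \<in> generator_dom UNIV C0_space T" using uv by (auto simp: generator_dom_def)
  then obtain p :: "nat \<Rightarrow> real ^ 'n \<Rightarrow> real" where p: "\<And>n. p n \<in> C02_space"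
    "uniform_limit UNIV p u sequentially" "uniform_limit UNIV (\<lambda>n. L (p n)) (L u) sequentially"
    using core unfolding is_core_def by blast
  have "\<forall>\<^sub>F n in sequentially. (\<forall>x\<in>UNIV. dist (p n x) (u x) < e) \<and> (\<forall>x\<in>UNIV. dist (L (p n) x) (L u x) < e)"
    using uniform_limitD[OF p(2) e] uniform_limitD[OF p(3) e] by (rule eventually_conj)
  then obtain n where "\<And>x. dist (p n x) (u x) < e" "\<And>x. dist (L (p n) x) (L u x) < e"
    unfolding eventually_sequentially by blast
  then show thesis
    using that[of "p n"] p(1) by (simp add: dist_real_def generator_eq[OF uv] less_imp_le)
qed

lemma C02_dense:
  fixes f :: "real ^ 'n \<Rightarrow> real"
  assumes f: "f \<in> C0_space" and e: "e > 0"
  obtains p where "p \<in> C02_space" "\<And>x. \<bar>p x - f x\<bar> \<le> e"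
proof -
  have e2: "e/2 > 0" using e by simp
  obtain u v where uv: "(u, v) \<in> gen" and u: "\<And>x. \<bar>u x - f x\<bar> \<le> e/2" using gen_dense[OF f e2] by blast
  obtain p where p: "p \<in> C02_space" "\<And>x. \<bar>p x - u x\<bar> \<le> e/2" using core_approx[OF uv e2] by blast
  have "\<bar>p x - f x\<bar> \<le> e" for x using u[of x] p(2)[of x] by linarith
  then show thesis using that p(1) by blast
qed

text \<open>The density of \<open>C\<^sub>0\<^sup>2\<close> replaces explicit bump functions: a smooth step composed with a good
  \<open>C\<^sub>0\<^sup>2\<close> approximation of the depth function is a cut-off function.\<close>

lemma cutoff:
  fixes \<Omega> :: "(real ^ 'n) set"
  assumes \<Omega>: "open \<Omega>" "bounded \<Omega>" and a: "a > 0"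
  obtains \<phi> where "\<phi> \<in> C02_space" "\<And>y. 0 \<le> \<phi> y" "\<And>y. \<phi> y \<le> 1"
    "\<And>y. a \<le> depth \<Omega> y \<Longrightarrow> \<phi> y = 1" "\<And>y. depth \<Omega> y < a/8 \<Longrightarrow> \<phi> y = 0"
proof -
  obtain p where p: "p \<in> C02_space" "\<And>x. \<bar>p x - depth \<Omega> x\<bar> \<le> a/4"
    using C02_dense[OF depth_in_C0_space[OF \<Omega>(2)], of "a/4"] a by (metis divide_pos_pos zero_less_numeral)
  define \<phi> where "\<phi> = (\<lambda>x. smooth_step (3*a/8) (p x))"
  have zero: "\<phi> y = 0" if "depth \<Omega> y < a/8" for y
    unfolding \<phi>_def using p(2)[of y] that a by (intro smooth_step_low) linarith+
  have one: "\<phi> y = 1" if "a \<le> depth \<Omega> y" for y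
    unfolding \<phi>_def using p(2)[of y] that a by (intro smooth_step_high) linarith+
  have "\<phi> \<in> C02_space"
  proof (rule C02_space_compact_support)
    show "C2_on UNIV \<phi>"
      unfolding \<phi>_def using p(1) by (intro C2_on_smooth_step) (auto simp: C02_space_iff)
    show "compact {y. a/8 \<le> depth \<Omega> y}" by (rule compact_depth_ge[OF \<Omega>(2)]) (use a in simp)
  qed (use zero in auto)
  then show thesis using that[of \<phi>] zero one smooth_step_range by (simp add: \<phi>_def)
qed

lemma cutoff_mult_C02:
  fixes \<Omega> :: "(real ^ 'n) set"
  assumes \<Omega>: "open \<Omega>" "bounded \<Omega>" and a: "a > 0" and \<phi>: "\<phi> \<in> C02_space"
    and zero: "\<And>y. depth \<Omega> y < a \<Longrightarrow> \<phi> y = 0" and f: "C2_on \<Omega> f"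
  shows "(\<lambda>y. \<phi> y * f y) \<in> C02_space" "(\<lambda>y. \<phi> y * f y) \<in> C02_dom \<Omega>"
proof -
  have C2: "C2_on \<Omega> (\<lambda>y. \<phi> y * f y)"
    by (rule C2_on_mult[OF \<Omega>(1) _ f], rule C2_on_subset[of UNIV]) (use \<phi> in \<open>auto simp: C02_space_iff\<close>)
  show C02: "(\<lambda>y. \<phi> y * f y) \<in> C02_space"
    by (rule C02_space_compact_support[OF C2 \<Omega>(1) compact_depth_ge[OF \<Omega>(2) a]])
       (use zero in_domain_if_depth_pos[OF a] in auto)
  show "(\<lambda>y. \<phi> y * f y) \<in> C02_dom \<Omega>"
    unfolding C02_dom_iff using C2 C02 zero a
    by (auto intro!: C0_space_imp_C0_dom[OF \<Omega>(1)] simp: C02_space_iff depth_outside)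
qed

end

section \<open>The pseudodifferential form\<close>

locale feller_levy = feller_core T
  for T :: "real \<Rightarrow> (real ^ 'n \<Rightarrow> real) \<Rightarrow> real ^ 'n \<Rightarrow> real" +
  fixes c :: "real ^ 'n \<Rightarrow> real" and l :: "real ^ 'n \<Rightarrow> real ^ 'n"
    and Q :: "real ^ 'n \<Rightarrow> real ^ 'n ^ 'n" and N :: "real ^ 'n \<Rightarrow> (real ^ 'n) measure"
  assumes levy: "levy_coefficients c l Q N"
    and L_eq: "f \<in> C02_space \<Longrightarrow> L f x = Lp c l Q N f x"
begin

lemma sets_N [measurable_cong]: "sets (N x) = sets borel"
  using levy by (simp add: levy_coefficients_def)

text \<open>Away from the origin the Levy measure is finite, so a bounded function that vanishes near \<open>x\<close> can be
  integrated against it.\<close>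

lemma levy_tail_integrable:
  fixes w :: "real ^ 'n \<Rightarrow> real"
  assumes cont: "continuous_on UNIV w" and b: "\<And>y. \<bar>w y\<bar> \<le> b" and S: "open S" "x \<in> S"
    and zero: "\<And>y. y \<in> S \<Longrightarrow> w y = 0"
  shows "set_integrable (N x) (- {0}) (\<lambda>y. w (x + y))"
proof -
  obtain r where r: "r > 0" "ball x r \<subseteq> S" using S by (meson openE)
  define m where "m = min (r\<^sup>2) 1"
  have m: "m > 0" using r(1) by (simp add: m_def)
  have w[measurable]: "w \<in> borel_measurable borel" using cont by (rule borel_measurable_continuous_onI)
  have b0: "b \<ge> 0" using b[of 0] by linarith
  have int: "integrable (N x) (\<lambda>y. indicator (- {0}) y * min ((norm y)\<^sup>2) 1)"
  proof (rule integrableI_bounded)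
    have "(\<integral>\<^sup>+ y. ennreal (norm (indicator (- {0}) y * min ((norm y)\<^sup>2) 1)) \<partial>N x) =
        (\<integral>\<^sup>+ y\<in>- {0}. ennreal (min ((norm y)\<^sup>2) 1) \<partial>N x)"
      by (intro nn_integral_cong) (auto split: split_indicator)
    then show "(\<integral>\<^sup>+ y. ennreal (norm (indicator (- {0}) y * min ((norm y)\<^sup>2) 1)) \<partial>N x) < \<infinity>"
      using levy by (simp add: levy_coefficients_def)
  qed measurable
  show ?thesis
    unfolding set_integrable_def
  proof (rule Bochner_Integration.integrable_bound)
    show "integrable (N x) (\<lambda>y. b / m * (indicator (- {0}) y * min ((norm y)\<^sup>2) 1))"
      using int by (rule integrable_mult_right)
    have "norm (indicator (- {0}) y *\<^sub>R w (x + y)) \<le> norm (b / m * (indicator (- {0}) y * min ((norm y)\<^sup>2) 1))" for y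
    proof (cases "y = 0 \<or> norm y < r")
      case True
      moreover have "w (x + y) = 0" if "norm y < r"
        using zero r(2) that by (metis add_diff_cancel_left' dist_commute dist_norm in_mono mem_ball)
      ultimately show ?thesis using b0 m by auto
    next
      case False
      then have "m \<le> min ((norm y)\<^sup>2) 1" using r(1) by (auto simp: m_def min.coboundedI1 power_mono)
      then have "b * m \<le> b * min ((norm y)\<^sup>2) 1" using b0 by (rule mult_left_mono)
      then have "b \<le> b / m * min ((norm y)\<^sup>2) 1" using m by (simp add: field_simps)
      then have "\<bar>w (x + y)\<bar> \<le> b / m * min ((norm y)\<^sup>2) 1" using b[of "x + y"] by linarith
      then show ?thesis using False m b0 by (simp add: abs_mult)
    qed
    then show "AE y in N x. norm (indicator (- {0}) y *\<^sub>R w (x + y)) \<le>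
        norm (b / m * (indicator (- {0}) y * min ((norm y)\<^sup>2) 1))" by simp
  qed measurable
qed

text \<open>Partial derivatives are local and annihilate constants. The constant \<open>k\<close> is \<open>1\<close> when a cut-off function is
  added, and \<open>0\<close> when a function is changed only far away from \<open>x\<close>.\<close>

lemma local_terms_cong:
  assumes S: "open S" "x \<in> S" and f: "C2_on S f" and eq: "\<And>y. y \<in> S \<Longrightarrow> g y = f y + k"
  shows "gradient g x = gradient f x" "partial i (partial j g) x = partial i (partial j f) x"
proof -
  have 1: "partial i g y = partial i f y" if "y \<in> S" for i y
  proof -
    have "partial i g y = partial i (\<lambda>y. 1 * f y + k * 1) y"
      by (rule partial_cong_open[OF S(1) that]) (use eq in auto)
    also have "\<dots> = 1 * partial i f y + k * partial i (\<lambda>_. 1) y"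
      by (rule partial_lincomb(2))
         (use f that C2_on_const[of S 1] in \<open>auto simp: C2_on_def C1_on_def\<close>)
    also have "partial i (\<lambda>_. 1::real) y = 0" by (rule partialI(2)) simp
    finally show ?thesis by simp
  qed
  show "gradient g x = gradient f x" unfolding gradient_def using 1[OF S(2)] by simp
  show "partial i (partial j g) x = partial i (partial j f) x"
    by (rule partial_cong_open(2)[OF S]) (rule 1)
qed

abbreviation levy_integrand :: "(real ^ 'n \<Rightarrow> real) \<Rightarrow> real ^ 'n \<Rightarrow> real ^ 'n \<Rightarrow> real" where
  "levy_integrand f x y \<equiv> f (x + y) - f x - gradient f x \<bullet> y * indicat_real (ball 0 1) y"

lemma Lp_flat:
  assumes S: "open S" "x \<in> S" and one: "\<And>y. y \<in> S \<Longrightarrow> \<phi> y = 1"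
  shows "Lp c l Q N \<phi> x = - c x - (LINT y:-{0}|N x. 1 - \<phi> (x + y))"
    "gradient \<phi> x = 0"
proof -
  have loc: "gradient \<phi> x = gradient (\<lambda>_. 0) x" "partial i (partial j \<phi>) x = partial i (partial j (\<lambda>_. 0)) x" for i j
    using local_terms_cong[OF S C2_on_const[of S 0], of \<phi> 1] one by auto
  have z: "partial i (\<lambda>_. 0::real) = (\<lambda>_. 0)" for i :: 'n
    using partialI(2)[of "\<lambda>_. 0" _ i 0] by auto
  show g: "gradient \<phi> x = 0" unfolding loc by (simp add: gradient_def z vec_eq_iff)
  have "(LINT y:-{0}|N x. levy_integrand \<phi> x y) = - (LINT y:-{0}|N x. 1 - \<phi> (x + y))"
    unfolding set_lebesgue_integral_def Bochner_Integration.integral_minus[symmetric]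
    by (rule Bochner_Integration.integral_cong) (use one[OF S(2)] in \<open>auto simp: g split: split_indicator\<close>)
  then show "Lp c l Q N \<phi> x = - c x - (LINT y:-{0}|N x. 1 - \<phi> (x + y))"
    unfolding Lp_def loc(2) using g one[OF S(2)] by (simp add: z)
qed

text \<open>At a point where \<open>\<phi>\<close> is flat, \<open>- L \<phi>\<close> is the sum of the killing rate and the integral of
  \<open>1 - \<phi>(x + y)\<close> against the jump measure. Since \<open>L \<phi>\<close> is bounded, so is this integral, uniformly in \<open>x\<close>.\<close>

lemma levy_tail_bound:
  assumes S: "open S" "x \<in> S" and \<phi>: "\<phi> \<in> C02_space" and one: "\<And>y. y \<in> S \<Longrightarrow> \<phi> y = 1"
  shows "(LINT y:-{0}|N x. 1 - \<phi> (x + y)) \<le> - L \<phi> x"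
proof -
  have "c x \<ge> 0" using levy by (simp add: levy_coefficients_def)
  then show ?thesis using Lp_flat(1)[OF S one] L_eq[OF \<phi>] by simp
qed

lemma cutoff_tail_integrable:
  assumes S: "open S" "x \<in> S" and \<phi>: "\<phi> \<in> C02_space" and one: "\<And>y. y \<in> S \<Longrightarrow> \<phi> y = 1"
    and range: "\<And>y. 0 \<le> \<phi> y" "\<And>y. \<phi> y \<le> 1"
  shows "set_integrable (N x) (- {0}) (\<lambda>y. 1 - \<phi> (x + y))"
proof (rule levy_tail_integrable[OF _ _ S])
  show "continuous_on UNIV (\<lambda>y. 1 - \<phi> y)"
    using \<phi> by (auto simp: C02_space_def C0_space_def intro!: continuous_intros)
  show "\<bar>1 - \<phi> y\<bar> \<le> 1" for y using range[of y] by auto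
qed (use one in auto)

text \<open>Suppose that the integral diverges; then it has the default value \<open>0\<close>, and so has the integral for \<open>f + \<phi>\<close>, where \<open>\<phi>\<close> is
  any cut-off function at \<open>x\<close>. Linearity of the generator forces \<open>\<integral>(1 - \<phi>(x + y))N(x,dy)\<close> to
  vanish, for all such \<open>\<phi>\<close>. So \<open>N(x, \<cdot>)\<close> is concentrated at \<open>0\<close> and the integral converges after all.\<close>

lemma levy_integrable:
  assumes f: "f \<in> C02_space"
  shows "set_integrable (N x) (- {0}) (levy_integrand f x)"
proof (rule ccontr)
  assume not: "\<not> ?thesis"
  have null: "AE y in N x. y = 0 \<or> norm y < r" if r: "r > 0" for r
  proof -
    obtain \<phi> where \<phi>: "\<phi> \<in> C02_space" "\<And>y. 0 \<le> \<phi> y" "\<And>y. \<phi> y \<le> 1"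
      "\<And>y. r/2 \<le> depth (ball x r) y \<Longrightarrow> \<phi> y = 1" "\<And>y. depth (ball x r) y < r/2/8 \<Longrightarrow> \<phi> y = 0"
      using cutoff[of "ball x r" "r/2"] r open_ball bounded_ball by (metis half_gt_zero)
    define S where "S = {y. r/2 < depth (ball x r) y}"
    have "r \<le> depth (ball x r) x"
      unfolding depth_def
    proof (subst infdist_notempty)
      show ne: "- ball x r \<noteq> {}" using bounded_ball not_bounded_UNIV by (metis Compl_empty_eq double_complement)
      show "r \<le> (INF a\<in>- ball x r. dist x a)" using ne by (intro cINF_greatest) auto
    qed
    then have S: "open S" "x \<in> S" and one: "\<And>y. y \<in> S \<Longrightarrow> \<phi> y = 1"
      using open_depth_greater[of "r/2" "ball x r"] \<phi>(4) r by (auto simp: S_def)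
    have C2S: "C2_on S f" using f C2_on_subset by (auto simp: C02_space_iff)
    note tail = cutoff_tail_integrable[OF S \<phi>(1) one \<phi>(2,3)]
    let ?g = "\<lambda>y. f y + \<phi> y"
    have loc: "gradient ?g x = gradient f x" "partial i (partial j ?g) x = partial i (partial j f) x" for i j
      using local_terms_cong[OF S C2S, of ?g 1] one by auto
    have g: "(\<lambda>y. 1 * f y + 1 * \<phi> y) \<in> C02_space" using f \<phi>(1) by (rule C02_space_lincomb)
    have eq: "levy_integrand ?g x y = levy_integrand f x y - (1 - \<phi> (x + y))" for y
      using one[OF S(2)] by (simp add: loc)
    have not': "\<not> set_integrable (N x) (- {0}) (levy_integrand ?g x)"
    proof
      assume "set_integrable (N x) (- {0}) (levy_integrand ?g x)"
      from set_integral_add(1)[OF this tail] show False using not by (simp add: eq)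
    qed
    have "(LINT y:-{0}|N x. levy_integrand f x y) = 0"
      using not unfolding set_lebesgue_integral_def set_integrable_def by (rule not_integrable_integral_eq)
    moreover have "(LINT y:-{0}|N x. levy_integrand ?g x y) = 0"
      using not' unfolding set_lebesgue_integral_def set_integrable_def by (rule not_integrable_integral_eq)
    ultimately have "Lp c l Q N ?g x = Lp c l Q N f x - c x"
      using one[OF S(2)] unfolding Lp_def loc by (simp add: algebra_simps)
    moreover have "L (\<lambda>y. 1 * f y + 1 * \<phi> y) = (\<lambda>y. 1 * L f y + 1 * L \<phi> y)"
      by (rule generator_eq[OF gen_lincomb]) (use f \<phi>(1) C02_gen in auto)
    ultimately have "L \<phi> x = - c x"
      using L_eq[OF f, of x] L_eq[OF g, of x] by (simp add: fun_eq_iff)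
    then have int0: "(LINT y:-{0}|N x. 1 - \<phi> (x + y)) = 0"
      using Lp_flat(1)[OF S one] L_eq[OF \<phi>(1), of x] by simp
    have "AE y in N x. indicator (- {0}) y *\<^sub>R (1 - \<phi> (x + y)) = 0"
      by (rule integral_nonneg_eq_0_iff_AE[THEN iffD1])
         (use tail int0 \<phi>(3) in \<open>auto simp: set_integrable_def set_lebesgue_integral_def\<close>)
    then show ?thesis
    proof eventually_elim
      case (elim y)
      have "\<phi> (x + y) = 0" if "r \<le> norm y"
        using \<phi>(5)[of "x + y"] that r depth_outside[of "x + y" "ball x r"] by (simp add: dist_norm)
      then show ?case using elim by (cases "y = 0"; cases "r \<le> norm y") auto
    qed
  qed
  have "AE y in N x. \<forall>n. y = 0 \<or> norm y < inverse (real (Suc n))"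
    unfolding AE_all_countable using null by simp
  then have AE0: "AE y in N x. y = 0"
  proof eventually_elim
    case (elim y)
    show ?case
    proof (rule ccontr)
      assume "y \<noteq> 0"
      then obtain n where "inverse (real (Suc n)) < norm y" using reals_Archimedean[of "norm y"] by auto
      then show False using elim \<open>y \<noteq> 0\<close> by (meson less_asym)
    qed
  qed
  have [measurable]: "f \<in> borel_measurable borel"
    using f by (auto simp: C02_space_def C0_space_def intro: borel_measurable_continuous_onI)
  have [measurable]: "ball (0 :: real ^ 'n) 1 \<in> sets borel" by simp
  have meas: "(\<lambda>y. indicator (- {0}) y *\<^sub>R levy_integrand f x y) \<in> borel_measurable (N x)"
    by measurable
  have "integrable (N x) (\<lambda>y. indicator (- {0}) y *\<^sub>R levy_integrand f x y) \<longleftrightarrow> integrable (N x) (\<lambda>y. 0::real)"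
    by (rule integrable_cong_AE[OF meas]) (use AE0 in auto)
  then show False using not by (simp add: set_integrable_def)
qed

text \<open>A function in \<open>C\<^sub>0\<^sup>2(\<Omega>)\<close> is replaced near the boundary by a close \<open>C\<^sub>0\<^sup>2(\<real>\<^sup>d)\<close> function. In the
  interior only the integral notices the change, and there the tail of \<open>N\<close> is controlled by the
  generator of a cut-off function.\<close>

lemma C02_dom_approx:
  assumes \<Omega>: "open \<Omega>" "bounded \<Omega>" and f: "f \<in> C02_dom \<Omega>" and a: "a > 0" and e: "e > 0"
  obtains F where "F \<in> C02_space" "\<And>y. \<bar>F y - f y\<bar> \<le> e"
    "\<And>x. a \<le> depth \<Omega> x \<Longrightarrow> \<bar>L F x - Lp c l Q N f x\<bar> \<le> e"
proof -
  have a2: "a/2 > 0" using a by simp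
  obtain \<phi> where \<phi>: "\<phi> \<in> C02_space" "\<And>y. 0 \<le> \<phi> y" "\<And>y. \<phi> y \<le> 1"
      "\<And>y. a/2 \<le> depth \<Omega> y \<Longrightarrow> \<phi> y = 1" "\<And>y. depth \<Omega> y < a/2/8 \<Longrightarrow> \<phi> y = 0"
    using cutoff[OF \<Omega> a2] by blast
  obtain B where B: "B \<ge> 0" "\<And>x. \<bar>L \<phi> x\<bar> \<le> B" using L_bounded[OF \<phi>(1)] by blast
  define k where "k = e / (1 + B)"
  have k: "k > 0" "k \<le> e" "k * B \<le> e" using e B(1) by (auto simp: k_def field_simps)
  have fC0: "f \<in> C0_space" and fC2: "C2_on \<Omega> f"
    using f C0_dom_imp_C0_space[OF \<Omega>] by (auto simp: C02_dom_iff)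
  obtain p where p: "p \<in> C02_space" "\<And>x. \<bar>p x - f x\<bar> \<le> k" using C02_dense[OF fC0 k(1)] by blast
  define w where "w = (\<lambda>y. (1 - \<phi> y) * (p y - f y))"
  have wle: "\<bar>w y\<bar> \<le> k * (1 - \<phi> y)" for y
    using mult_left_mono[OF p(2)[of y], of "1 - \<phi> y"] \<phi>(3)[of y] by (simp add: w_def abs_mult mult.commute)
  have wk: "\<bar>w y\<bar> \<le> k" for y
    using wle[of y] mult_left_mono[of "1 - \<phi> y" 1 k] \<phi>(2)[of y] k(1) by linarith
  have wc: "continuous_on UNIV w"
    unfolding w_def using \<phi>(1) p(1) fC0
    by (auto simp: C02_space_def C0_space_def intro!: continuous_intros)
  define F where "F = (\<lambda>y. \<phi> y * f y + (p y - \<phi> y * p y))"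
  have Fw: "F y = f y + w y" for y by (simp add: F_def w_def algebra_simps)
  have a16: "a/2/8 > 0" using a by simp
  have F: "F \<in> C02_space"
  proof -
    have 1: "(\<lambda>y. \<phi> y * f y) \<in> C02_space" by (rule cutoff_mult_C02(1)[OF \<Omega> a16 \<phi>(1,5) fC2])
    have "C2_on \<Omega> p" using p(1) C2_on_subset by (auto simp: C02_space_iff)
    from cutoff_mult_C02(1)[OF \<Omega> a16 \<phi>(1,5) this] have "(\<lambda>y. \<phi> y * p y) \<in> C02_space" by blast
    from C02_space_lincomb[OF 1 C02_space_diff[OF p(1) this], of 1 1] show ?thesis by (simp add: F_def)
  qed
  have "\<bar>L F x - Lp c l Q N f x\<bar> \<le> e" if x: "a \<le> depth \<Omega> x" for x
  proof -
    define S where "S = {y. a/2 < depth \<Omega> y}"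
    have S: "open S" "x \<in> S" and one: "\<And>y. y \<in> S \<Longrightarrow> \<phi> y = 1"
      using open_depth_greater[of "a/2" \<Omega>] \<phi>(4) x a by (auto simp: S_def)
    have w0: "\<And>y. y \<in> S \<Longrightarrow> w y = 0" using one by (simp add: w_def)
    have "S \<subseteq> \<Omega>"
      unfolding S_def using in_domain_if_depth_pos[OF a2 less_imp_le] by blast
    then have "C2_on S f" by (rule C2_on_subset[OF fC2])
    then have loc: "gradient F x = gradient f x" "partial i (partial j F) x = partial i (partial j f) x" for i j
      using local_terms_cong[OF S, of f F 0] w0 by (auto simp: Fw)
    have wint: "set_integrable (N x) (- {0}) (\<lambda>y. w (x + y))" by (rule levy_tail_integrable[OF wc wk S w0])
    have Fint: "set_integrable (N x) (- {0}) (levy_integrand F x)" by (rule levy_integrable[OF F])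
    have "(\<lambda>y. levy_integrand F x y - w (x + y)) = levy_integrand f x"
      using w0[OF S(2)] by (simp add: fun_eq_iff Fw loc)
    then have "(LINT y:-{0}|N x. levy_integrand f x y) =
        (LINT y:-{0}|N x. levy_integrand F x y) - (LINT y:-{0}|N x. w (x + y))"
      using set_integral_diff(2)[OF Fint wint] by simp
    moreover have "F x = f x" using w0[OF S(2)] by (simp add: Fw)
    then have "Lp c l Q N F x - Lp c l Q N f x =
        (LINT y:-{0}|N x. levy_integrand F x y) - (LINT y:-{0}|N x. levy_integrand f x y)"
      unfolding Lp_def loc by simp
    ultimately have "Lp c l Q N F x - Lp c l Q N f x = (LINT y:-{0}|N x. w (x + y))" by simp
    moreover have "\<bar>LINT y:-{0}|N x. w (x + y)\<bar> \<le> (LINT y:-{0}|N x. k * (1 - \<phi> (x + y)))"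
      unfolding set_lebesgue_integral_def
    proof (rule integral_abs_bound_integral)
      show "integrable (N x) (\<lambda>y. indicator (- {0}) y *\<^sub>R w (x + y))" using wint by (simp add: set_integrable_def)
      show "integrable (N x) (\<lambda>y. indicator (- {0}) y *\<^sub>R (k * (1 - \<phi> (x + y))))"
        using integrable_mult_right[OF cutoff_tail_integrable[OF S \<phi>(1) one \<phi>(2,3), unfolded set_integrable_def], of k]
        by (simp add: mult.left_commute)
      show "\<bar>indicator (- {0}) y *\<^sub>R w (x + y)\<bar> \<le> indicator (- {0}) y *\<^sub>R (k * (1 - \<phi> (x + y)))" for y
        using wle[of "x + y"] by (auto split: split_indicator)
    qed
    moreover have "(LINT y:-{0}|N x. k * (1 - \<phi> (x + y))) = k * (LINT y:-{0}|N x. 1 - \<phi> (x + y))"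
      by (rule set_integral_mult_right)
    moreover have "k * (LINT y:-{0}|N x. 1 - \<phi> (x + y)) \<le> k * B"
      using levy_tail_bound[OF S \<phi>(1) one] B(2)[of x] k(1) by (intro mult_left_mono) auto
    ultimately show ?thesis using k(3) L_eq[OF F, of x] by simp
  qed
  moreover have "\<bar>F y - f y\<bar> \<le> e" for y using wk[of y] k(2) by (simp add: Fw)
  ultimately show thesis using F that by blast
qed

end


section \<open>Paths that stay away from the boundary\<close>

lemma ext0_simps [simp]: "ext0 f None = 0" "ext0 f (Some y) = f y"
  by (simp_all add: ext0_def)

lemma ext0_diff: "ext0 (\<lambda>y. f y - g y) z = ext0 f z - ext0 g z"
  by (cases z) auto

lemma ext0_scale: "ext0 (\<lambda>y. a * f y) z = a * ext0 f z"
  by (cases z) auto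

lemma ext0_abs_le: "(\<And>y. \<bar>f y\<bar> \<le> b) \<Longrightarrow> 0 \<le> b \<Longrightarrow> \<bar>ext0 f z\<bar> \<le> b"
  by (cases z) auto

definition bounded_away :: "(real \<Rightarrow> real) \<Rightarrow> real \<Rightarrow> real \<Rightarrow> bool" where
  "bounded_away D s t \<longleftrightarrow> (\<exists>a>0. \<forall>u\<in>{s..t}. a \<le> D u)"

lemma bounded_away_combine:
  assumes "bounded_away D s t" "bounded_away D t u"
  shows "bounded_away D s u"
proof -
  obtain a b where "a > 0" "\<forall>v\<in>{s..t}. a \<le> D v" "b > 0" "\<forall>v\<in>{t..u}. b \<le> D v"
    using assms by (auto simp: bounded_away_def)
  then have "\<forall>v\<in>{s..u}. min a b \<le> D v" by (auto simp: min_le_iff_disj)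
  then show ?thesis unfolding bounded_away_def using \<open>a > 0\<close> \<open>b > 0\<close> by (intro exI[of _ "min a b"]) auto
qed

lemma bounded_away_steps:
  assumes "D 0 > 0" "\<And>j. j < n \<Longrightarrow> bounded_away D (real j * r) (real j * r + r)"
  shows "bounded_away D 0 (real n * r)"
  using assms(2)
proof (induction n)
  case 0
  then show ?case using assms(1) by (auto simp: bounded_away_def intro!: exI[of _ "D 0"])
next
  case (Suc n)
  have "bounded_away D 0 (real n * r + r)"
    by (rule bounded_away_combine[OF Suc.IH]) (use Suc.prems in auto)
  then show ?case by (simp add: algebra_simps)
qed

lemma right_continuous_dyadic_le:
  fixes D :: "real \<Rightarrow> real"
  assumes rc: "\<And>s. t \<le> s \<Longrightarrow> (D \<longlongrightarrow> D s) (at_right s)" and r: "0 \<le> r"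
    and le: "\<And>n j. j \<le> 2^n \<Longrightarrow> a \<le> D (t + real j * (r / 2^n))" and s: "s \<in> {t..t+r}"
  shows "a \<le> D s"
proof (cases "s = t + r")
  case True
  then show ?thesis using le[of 1 0] by simp
next
  case False
  then have s: "t \<le> s" "s < t + r" and r: "r > 0" using s by auto
  show ?thesis
  proof (rule ccontr)
    assume "\<not> ?thesis"
    then have "\<forall>\<^sub>F u in at_right s. D u < a" using rc[OF s(1)] by (intro order_tendstoD) auto
    then obtain b where b: "b > s" "\<And>u. s < u \<Longrightarrow> u < b \<Longrightarrow> D u < a"
      unfolding eventually_at_right_field by blast
    define d where "d = min (b - s) (t + r - s)"
    have d: "d > 0" using b(1) s by (simp add: d_def)
    obtain n where n: "r / d < 2^n" using real_arch_pow[of 2 "r/d"] by auto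
    have rn: "r / 2^n < d" "r / 2^n > 0" using n d r by (simp_all add: field_simps)
    define q where "q = r / 2^n"
    define j where "j = nat \<lfloor>(s - t) / q\<rfloor> + 1"
    have q: "0 < q" "0 \<le> (s - t) / q" using rn(2) s by (simp_all add: q_def)
    have j: "real j = of_int \<lfloor>(s - t) / q\<rfloor> + 1" using q by (simp add: j_def)
    have "(s - t) / q < real j" "real j \<le> (s - t) / q + 1"
      unfolding j by linarith+
    then have "s < t + real j * q" "t + real j * q \<le> s + q"
      using q(1) by (simp_all add: field_simps)
    then have u: "s < t + real j * (r / 2^n)" "t + real j * (r / 2^n) \<le> s + r / 2^n"
      unfolding q_def by auto
    have "t + real j * (r / 2^n) < b" "t + real j * (r / 2^n) < t + r"
      using u(2) rn(1) by (auto simp: d_def)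
    moreover from this(2) have "real j < 2^n" using r by (simp add: field_simps)
    then have "j \<le> 2^n" by (metis less_imp_le of_nat_less_iff of_nat_numeral of_nat_power)
    ultimately show False using b(2)[OF u(1)] le[of j n] by simp
  qed
qed

text \<open>If a right-continuous positive function approaches \<open>0\<close> from the left at \<open>\<sigma>\<close>, then the right
  end points of the first grid intervals on which its infimum is \<open>0\<close> approach \<open>\<sigma>\<close> from the
  right, where the function is close to its positive value at \<open>\<sigma>\<close>.\<close>

lemma first_dead_interval:
  fixes D :: "real \<Rightarrow> real"
  assumes rc: "\<And>s. 0 \<le> s \<Longrightarrow> (D \<longlongrightarrow> D s) (at_right s)" and h: "0 \<le> h"
    and pos: "\<And>s. s \<in> {0..h} \<Longrightarrow> D s > 0"
  obtains c \<eta> where "c > 0" "\<eta> > 0"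
    "\<And>s r. 0 \<le> s \<Longrightarrow> 0 < r \<Longrightarrow> r < \<eta> \<Longrightarrow> s + r \<le> h \<Longrightarrow> bounded_away D 0 s \<Longrightarrow>
      \<not> bounded_away D s (s + r) \<Longrightarrow> c \<le> D (s + r)"
proof -
  define S where "S = {s \<in> {0..h}. bounded_away D 0 s}"
  define \<sigma> where "\<sigma> = Sup S"
  have "0 \<in> S" using h pos[of 0] by (auto simp: S_def bounded_away_def intro!: exI[of _ "D 0"])
  have bdd: "bdd_above S" by (rule bdd_aboveI[of _ h]) (auto simp: S_def)
  have \<sigma>: "0 \<le> \<sigma>" "\<sigma> \<le> h"
    unfolding \<sigma>_def using \<open>0 \<in> S\<close> bdd by (auto intro: cSup_upper cSup_least simp: S_def)
  have D\<sigma>: "D \<sigma> > 0" using pos \<sigma> by simp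
  have "\<forall>\<^sub>F u in at_right \<sigma>. D \<sigma> / 2 < D u" using rc[OF \<sigma>(1)] D\<sigma> by (intro order_tendstoD) auto
  then obtain b where b: "b > \<sigma>" "\<And>u. \<sigma> < u \<Longrightarrow> u < b \<Longrightarrow> D \<sigma> / 2 < D u"
    unfolding eventually_at_right_field by blast
  show thesis
  proof (rule that[of "D \<sigma> / 2" "b - \<sigma>"])
    fix s r assume s: "0 \<le> s" "0 < r" "r < b - \<sigma>" "s + r \<le> h" "bounded_away D 0 s"
      "\<not> bounded_away D s (s + r)"
    have "s \<in> S" using s by (simp add: S_def)
    then have 1: "s \<le> \<sigma>" unfolding \<sigma>_def using bdd by (rule cSup_upper)
    have 2: "\<sigma> \<le> s + r"
      unfolding \<sigma>_def
    proof (rule cSup_least)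
      fix u assume u: "u \<in> S"
      show "u \<le> s + r"
      proof (rule ccontr)
        assume "\<not> u \<le> s + r"
        then have "bounded_away D s (s + r)"
          using u s(1) unfolding S_def bounded_away_def by fastforce
        then show False using s(6) by simp
      qed
    qed (use \<open>0 \<in> S\<close> in auto)
    show "D \<sigma> / 2 \<le> D (s + r)"
    proof (cases "s + r = \<sigma>")
      case False
      then show ?thesis using b(2)[of "s + r"] 1 2 s(3) by auto
    qed (use D\<sigma> in simp)
  qed (use D\<sigma> b(1) in auto)
qed

section \<open>The killed process along a grid\<close>

text \<open>One starting point \<open>x\<close> of a Feller process, with only those properties of its law that the argument uses:
  the simple Markov property with respect to a filtration \<open>F\<close> and right-continuity of \<open>f(X\<^sub>t)\<close> for
  \<open>f \<in> C\<^sub>0(\<real>\<^sup>d)\<close>. A function of the process is evaluated through \<open>ext0\<close>, so that killing is covered.\<close>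

locale feller_path = feller_semigroup T + prob_space \<PP>
  for T :: "real \<Rightarrow> (real ^ 'n \<Rightarrow> real) \<Rightarrow> real ^ 'n \<Rightarrow> real" and \<PP> :: "'w measure" +
  fixes F :: "real \<Rightarrow> 'w measure" and X :: "real \<Rightarrow> 'w \<Rightarrow> (real ^ 'n) option" and x :: "real ^ 'n"
    and \<Omega> :: "(real ^ 'n) set"
  assumes F_space: "space (F t) = space \<PP>"
    and F_sets: "t \<ge> 0 \<Longrightarrow> sets (F t) \<subseteq> sets \<PP>"
    and F_mono: "0 \<le> s \<Longrightarrow> s \<le> t \<Longrightarrow> sets (F s) \<subseteq> sets (F t)"
    and adapted: "0 \<le> t \<Longrightarrow> f \<in> C0_space \<Longrightarrow> (\<lambda>w. ext0 f (X t w)) \<in> borel_measurable (F t)"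
    and markov: "0 \<le> s \<Longrightarrow> 0 \<le> t \<Longrightarrow> A \<in> sets (F t) \<Longrightarrow> f \<in> C0_space \<Longrightarrow>
      (\<integral>w. indicator A w * ext0 f (X (t + s) w) \<partial>\<PP>) = (\<integral>w. indicator A w * ext0 (T s f) (X t w) \<partial>\<PP>)"
    and start: "AE w in \<PP>. X 0 w = Some x"
    and right_cont: "AE w in \<PP>. \<forall>f\<in>C0_space. \<forall>t\<ge>0. ((\<lambda>s. ext0 f (X s w)) \<longlongrightarrow> ext0 f (X t w)) (at_right t)"
    and open_dom: "open \<Omega>" and bounded_dom: "bounded \<Omega>" and start_in: "x \<in> \<Omega>"
begin

definition D :: "real \<Rightarrow> 'w \<Rightarrow> real" where
  "D s w = ext0 (depth \<Omega>) (X s w)"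

lemma D_nonneg: "0 \<le> D s w"
  by (cases "X s w") (auto simp: D_def depth_nonneg)

lemma D_pos_iff: "0 < D s w \<longleftrightarrow> X s w \<in> Some ` \<Omega>"
  using depth_pos[OF open_dom bounded_dom] depth_outside
  by (cases "X s w") (auto simp: D_def image_iff, force)

lemma D_geE:
  assumes "0 < a" "a \<le> D s w"
  obtains y where "X s w = Some y" "a \<le> depth \<Omega> y"
  using assms by (cases "X s w") (auto simp: D_def)

lemma small_if_shallow:
  assumes "\<And>y. depth \<Omega> y < a \<Longrightarrow> \<bar>f y\<bar> \<le> b" "0 \<le> b" "D s w < a"
  shows "\<bar>ext0 f (X s w)\<bar> \<le> b"
  using assms by (cases "X s w") (auto simp: D_def)

lemma F_subset: "0 \<le> s \<Longrightarrow> s \<le> t \<Longrightarrow> A \<in> sets (F s) \<Longrightarrow> A \<in> sets (F t)"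
  using F_mono by blast

lemma F_events: "0 \<le> t \<Longrightarrow> A \<in> sets (F t) \<Longrightarrow> A \<in> events"
  using F_sets by blast

lemma adapted_later:
  assumes "0 \<le> s" "s \<le> t" "f \<in> C0_space"
  shows "(\<lambda>w. ext0 f (X s w)) \<in> borel_measurable (F t)"
  using adapted[OF assms(1,3)] F_mono[OF assms(1,2)] F_space by (auto simp: measurable_def)

lemma measurable_X: "0 \<le> s \<Longrightarrow> f \<in> C0_space \<Longrightarrow> (\<lambda>w. ext0 f (X s w)) \<in> borel_measurable \<PP>"
  using adapted[of s f] F_sets[of s] F_space by (auto simp: measurable_def)

lemma integrable_indicator_X:
  assumes "A \<in> events" "f \<in> C0_space" "0 \<le> s"
  shows "integrable \<PP> (\<lambda>w. indicator A w * ext0 f (X s w))"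
proof -
  obtain B where B: "B \<ge> 0" "\<And>y. \<bar>f y\<bar> \<le> B" using C0_space_bounded[OF assms(2)] by blast
  have [measurable]: "(\<lambda>w. ext0 f (X s w)) \<in> borel_measurable \<PP>" "A \<in> events"
    using measurable_X assms by auto
  show ?thesis
    by (rule integrable_const_bound[of _ B])
       (use ext0_abs_le[of f B] B in \<open>auto split: split_indicator\<close>)
qed

lemma integrable_X: "f \<in> C0_space \<Longrightarrow> 0 \<le> s \<Longrightarrow> integrable \<PP> (\<lambda>w. ext0 f (X s w))"
proof (rule Bochner_Integration.integrable_cong[THEN iffD1, OF refl])
  assume "f \<in> C0_space" "0 \<le> s"
  then show "integrable \<PP> (\<lambda>w. indicator (space \<PP>) w * ext0 f (X s w))"
    by (intro integrable_indicator_X) auto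
qed auto

abbreviation expect_on :: "'w set \<Rightarrow> (real ^ 'n \<Rightarrow> real) \<Rightarrow> real \<Rightarrow> real" where
  "expect_on A f s \<equiv> \<integral>w. indicator A w * ext0 f (X s w) \<partial>\<PP>"

lemma integral_indicator_bound:
  assumes "A \<in> events" "f \<in> C0_space" "0 \<le> s" "\<And>w. w \<in> A \<Longrightarrow> \<bar>ext0 f (X s w)\<bar> \<le> b"
  shows "\<bar>expect_on A f s\<bar> \<le> b * prob A"
proof -
  have int: "integrable \<PP> (\<lambda>w. indicator A w * ext0 f (X s w))"
    by (rule integrable_indicator_X) fact+
  have "\<bar>expect_on A f s\<bar> \<le> (\<integral>w. \<bar>indicator A w * ext0 f (X s w)\<bar> \<partial>\<PP>)"
    by (rule integral_abs_bound)
  also have "\<dots> \<le> (\<integral>w. b * indicator A w \<partial>\<PP>)"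
  proof (rule integral_mono)
    show "integrable \<PP> (\<lambda>w. b * indicator A w)"
      using assms(1) by (intro integrable_mult_right integrable_real_indicator) (auto simp: less_top[symmetric])
    show "\<bar>indicator A w * ext0 f (X s w)\<bar> \<le> b * indicator A w" for w
      using assms(4) by (auto split: split_indicator)
  qed (use int in auto)
  also have "\<dots> = b * prob A" using assms(1) by simp
  finally show ?thesis .
qed

lemma expectation_X:
  assumes "0 \<le> s" "f \<in> C0_space"
  shows "(\<integral>w. ext0 f (X s w) \<partial>\<PP>) = T s f x"
proof -
  have Tf: "T s f \<in> C0_space" using assms by (rule T_C0)
  have "(\<integral>w. ext0 f (X s w) \<partial>\<PP>) = expect_on (space \<PP>) f (0 + s)"
    by (rule Bochner_Integration.integral_cong) auto
  also have "\<dots> = expect_on (space \<PP>) (T s f) 0"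
    by (rule markov) (use assms F_space sets.top in \<open>auto, metis F_space sets.top\<close>)
  also have "\<dots> = (\<integral>w. ext0 (T s f) (X 0 w) \<partial>\<PP>)"
    by (rule Bochner_Integration.integral_cong) auto
  also have "\<dots> = (\<integral>w. T s f x \<partial>\<PP>)"
    by (rule integral_cong_AE) (use start measurable_X[OF _ Tf] in auto)
  finally show ?thesis by (simp add: prob_space)
qed

text \<open>Walks along the grid \<open>t, t + \<delta>, t + 2\<delta>, \<dots>\<close>, observed on an event \<open>H\<close> of the past of \<open>t\<close>. The times strictly
  before the \<open>k\<close>-th one are tested, so that \<open>leaving H t \<delta> a k\<close> is the event that the \<open>k\<close>-th time is the first
  one at which the depth is below \<open>a\<close>; this event is decided at time \<open>t + k * \<delta>\<close>. On a grid the simple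
  Markov property is all that a stopping argument needs.\<close>

definition alive :: "'w set \<Rightarrow> real \<Rightarrow> real \<Rightarrow> real \<Rightarrow> nat \<Rightarrow> 'w set" where
  "alive H t \<delta> a k = {w \<in> H. \<forall>j<k. a \<le> D (t + real j * \<delta>) w}"

definition leaving :: "'w set \<Rightarrow> real \<Rightarrow> real \<Rightarrow> real \<Rightarrow> nat \<Rightarrow> 'w set" where
  "leaving H t \<delta> a k = alive H t \<delta> a k - alive H t \<delta> a (Suc k)"

lemma leaving_shallow: "w \<in> leaving H t \<delta> a k \<Longrightarrow> D (t + real k * \<delta>) w < a"
  by (auto simp: leaving_def alive_def less_Suc_eq not_le)

lemma D_level_set: "0 \<le> s \<Longrightarrow> s \<le> t \<Longrightarrow> {w \<in> space \<PP>. a \<le> D s w} \<in> sets (F t)"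
  using adapted_later[OF _ _ depth_in_C0_space[OF bounded_dom], of s t]
  unfolding D_def F_space[of t, symmetric] by measurable

lemma alive_sets:
  assumes H: "H \<in> sets (F t)" and t: "0 \<le> t" "0 \<le> \<delta>"
  shows "alive H t \<delta> a (Suc k) \<in> sets (F (t + real k * \<delta>))" "alive H t \<delta> a k \<in> sets (F (t + real k * \<delta>))"
proof -
  have sub: "H \<subseteq> space \<PP>" using sets.sets_into_space[OF H] F_space by simp
  have mono: "t + real j * \<delta> \<le> t + real k * \<delta>" if "j \<le> k" for j
    using that t by (simp add: mult_right_mono)
  have 1: "alive H t \<delta> a i \<in> sets (F (t + real k * \<delta>))" if "i \<le> Suc k" for i
  proof -
    have "alive H t \<delta> a i = H \<inter> (\<Inter>j<i. {w \<in> space \<PP>. a \<le> D (t + real j * \<delta>) w})" if "i > 0"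
      using sub that by (auto simp: alive_def)
    moreover have "(\<Inter>j<i. {w \<in> space \<PP>. a \<le> D (t + real j * \<delta>) w}) \<in> sets (F (t + real k * \<delta>))" if "i > 0"
      using that \<open>i \<le> Suc k\<close> t by (intro sets.finite_INT D_level_set mono) auto
    moreover have "H \<in> sets (F (t + real k * \<delta>))" using F_subset[OF t(1) _ H] t by simp
    ultimately show ?thesis by (cases "i = 0") (auto simp: alive_def)
  qed
  show "alive H t \<delta> a (Suc k) \<in> sets (F (t + real k * \<delta>))" "alive H t \<delta> a k \<in> sets (F (t + real k * \<delta>))"
    using 1[of "Suc k"] 1[of k] by auto
qed

lemma leaving_sets:
  assumes "H \<in> sets (F t)" "0 \<le> t" "0 \<le> \<delta>"
  shows "leaving H t \<delta> a k \<in> sets (F (t + real k * \<delta>))"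
  using alive_sets[OF assms] by (auto simp: leaving_def)

lemma alive_events:
  assumes "H \<in> sets (F t)" "0 \<le> t" "0 \<le> \<delta>"
  shows "alive H t \<delta> a k \<in> events" "leaving H t \<delta> a k \<in> events"
  using alive_sets(2)[OF assms] leaving_sets[OF assms] F_events[of "t + real k * \<delta>"] assms by auto

lemma indicator_dead:
  "(indicator (H - alive H t \<delta> a (Suc n)) w :: real) = (\<Sum>k\<le>n. indicator (leaving H t \<delta> a k) w)"
proof (induction n)
  case 0
  show ?case by (auto simp: leaving_def alive_def split: split_indicator)
next
  case (Suc n)
  have "indicator (H - alive H t \<delta> a (Suc (Suc n))) w =
      indicator (H - alive H t \<delta> a (Suc n)) w + (indicator (leaving H t \<delta> a (Suc n)) w :: real)"
    by (auto simp: leaving_def alive_def less_Suc_eq split: split_indicator)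
  then show ?case using Suc by simp
qed

text \<open>At the step at which the grid walk becomes shallow, \<open>f\<close> is small; the Markov property carries
  this over to the end of the interval, up to the modulus of continuity of the semigroup at \<open>f\<close>.\<close>

lemma grid_dead_bound:
  assumes H: "H \<in> sets (F t)" and t: "0 \<le> t" "0 \<le> \<delta>" and f: "f \<in> C0_space"
    and shallow: "\<And>y. depth \<Omega> y < a \<Longrightarrow> \<bar>f y\<bar> \<le> \<eta>" and \<eta>: "0 \<le> \<eta>"
    and e: "\<And>r y. 0 \<le> r \<Longrightarrow> r \<le> real n * \<delta> \<Longrightarrow> \<bar>T r f y - f y\<bar> \<le> e"
  shows "\<bar>expect_on (H - alive H t \<delta> a (Suc n)) f (t + real n * \<delta>)\<bar>
    \<le> (\<eta> + e) * prob (H - alive H t \<delta> a (Suc n))"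
proof -
  let ?E = "leaving H t \<delta> a" and ?d = "H - alive H t \<delta> a (Suc n)"
  have tn: "0 \<le> t + real k * \<delta>" for k using t by simp
  have ev: "?E k \<in> events" for k by (rule alive_events[OF H t])
  have e0: "0 \<le> e" using e[of 0 0] t by auto
  have k: "\<bar>expect_on (?E k) f (t + real n * \<delta>)\<bar> \<le> (\<eta> + e) * prob (?E k)"
    if "k \<le> n" for k
  proof -
    define r where "r = (real n - real k) * \<delta>"
    have r: "0 \<le> r" "r \<le> real n * \<delta>" using that t by (auto simp: r_def mult_right_mono)
    have tr: "t + real n * \<delta> = (t + real k * \<delta>) + r" by (simp add: r_def algebra_simps)
    have Tf: "T r f \<in> C0_space" using r(1) f by (rule T_C0)
    have "\<bar>T r f y\<bar> \<le> \<eta> + e" if "depth \<Omega> y < a" for y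
      using shallow[OF that] e[OF r, of y] by linarith
    then have "\<bar>expect_on (?E k) (T r f) (t + real k * \<delta>)\<bar> \<le> (\<eta> + e) * prob (?E k)"
      by (intro integral_indicator_bound[OF ev Tf tn] small_if_shallow[OF _ _ leaving_shallow]) (use \<eta> e0 in auto)
    then show ?thesis
      unfolding tr using markov[OF r(1) tn leaving_sets[OF H t] f] by simp
  qed
  have "expect_on ?d f (t + real n * \<delta>) =
      (\<integral>w. (\<Sum>k\<le>n. indicator (?E k) w * ext0 f (X (t + real n * \<delta>) w)) \<partial>\<PP>)"
    by (simp add: indicator_dead sum_distrib_right)
  also have "\<dots> = (\<Sum>k\<le>n. expect_on (?E k) f (t + real n * \<delta>))"
    by (rule Bochner_Integration.integral_sum) (rule integrable_indicator_X[OF ev f tn])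
  also have "\<bar>\<dots>\<bar> \<le> (\<Sum>k\<le>n. (\<eta> + e) * prob (?E k))"
    by (rule order_trans[OF sum_abs sum_mono]) (use k in auto)
  also have "\<dots> = (\<eta> + e) * (\<integral>w. (\<Sum>k\<le>n. indicat_real (?E k) w) \<partial>\<PP>)"
    using ev by (subst Bochner_Integration.integral_sum)
      (auto simp: sum_distrib_left less_top[symmetric] intro!: integrable_real_indicator)
  also have "(\<integral>w. (\<Sum>k\<le>n. indicat_real (?E k) w) \<partial>\<PP>) = (\<integral>w. indicat_real ?d w \<partial>\<PP>)"
    by (simp only: indicator_dead)
  also have "\<dots> = prob ?d" using alive_events(1)[OF H t] F_events[OF t(1) H] by simp
  finally show ?thesis .
qed

text \<open>A discrete Dynkin formula: along the grid walk stopped when it becomes shallow, the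
  expectation of a function changes by the accumulated one-step increments.\<close>

lemma grid_dynkin:
  assumes \<delta>: "0 \<le> \<delta>" and U: "U \<in> C0_space"
  shows "expect_on (alive (space \<PP>) 0 \<delta> a (Suc n)) U (real n * \<delta>) +
      (\<Sum>k\<le>n. expect_on (leaving (space \<PP>) 0 \<delta> a k) U (real k * \<delta>)) =
    U x + (\<Sum>k<n. expect_on (alive (space \<PP>) 0 \<delta> a (Suc k)) (\<lambda>y. T \<delta> U y - U y) (real k * \<delta>))"
proof -
  let ?A = "alive (space \<PP>) 0 \<delta> a" and ?E = "leaving (space \<PP>) 0 \<delta> a"
  have top: "space \<PP> \<in> sets (F 0)" using sets.top[of "F 0"] F_space by simp
  have ev: "?A k \<in> events" "?E k \<in> events" for k using alive_events[OF top _ \<delta>] by auto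
  have TU: "T \<delta> U \<in> C0_space" using \<delta> U by (rule T_C0)
  have int: "integrable \<PP> (\<lambda>w. indicator B w * ext0 f (X (real k * \<delta>) w))"
    if "B \<in> events" "f \<in> C0_space" for B f k
    using that \<delta> by (intro integrable_indicator_X) auto
  have split: "expect_on (?A k) U (real k * \<delta>) =
      expect_on (?A (Suc k)) U (real k * \<delta>) +
      expect_on (?E k) U (real k * \<delta>)" for k
    by (subst Bochner_Integration.integral_add[symmetric, OF int[OF ev(1) U] int[OF ev(2) U]])
       (auto intro!: Bochner_Integration.integral_cong simp: leaving_def alive_def less_Suc_eq split: split_indicator)
  show ?thesis
  proof (induction n)
    case 0
    have "expect_on (?A 0) U 0 = (\<integral>w. ext0 U (X 0 w) \<partial>\<PP>)"
      by (rule Bochner_Integration.integral_cong) (auto simp: alive_def)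
    then show ?case using split[of 0] expectation_X[OF _ U, of 0] by (simp add: T_zero[OF U])
  next
    case (Suc n)
    have "expect_on (?A (Suc n)) U (real (Suc n) * \<delta>) =
        expect_on (?A (Suc n)) (T \<delta> U) (real n * \<delta>)"
      using markov[OF \<delta> _ _ U, of "real n * \<delta>" "?A (Suc n)"] alive_sets(1)[OF top _ \<delta>, of a n] \<delta>
      by (simp add: algebra_simps)
    also have "\<dots> = expect_on (?A (Suc n)) U (real n * \<delta>) +
        expect_on (?A (Suc n)) (\<lambda>y. T \<delta> U y - U y) (real n * \<delta>)"
      by (subst Bochner_Integration.integral_add[symmetric, OF int[OF ev(1) U] int[OF ev(1) C0_space_diff[OF TU U]]])
         (simp add: ext0_diff algebra_simps)
    finally show ?case using Suc split[of "Suc n"] by simp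
  qed
qed

text \<open>The discrete Dynkin formula for \<open>U\<close>, read for a pair \<open>(f, g)\<close>
  that \<open>U\<close> and its difference quotient approximate inside the level set. The walk that has not become
  shallow collects \<open>\<delta> * g\<close> at each step, and \<open>g\<close> along the walk is close to \<open>g x\<close>.\<close>

lemma grid_generator_bound:
  assumes \<delta>: "0 < \<delta>" and U: "U \<in> C0_space" and f: "f \<in> C0_space" and g: "g \<in> C0_space"
    and Uf: "\<And>y. \<bar>U y - f y\<bar> \<le> \<epsilon>" and a: "0 < a"
    and step: "\<And>y. a \<le> depth \<Omega> y \<Longrightarrow> \<bar>T \<delta> U y - U y - \<delta> * g y\<bar> \<le> \<delta> * \<epsilon>"
    and shallow: "\<And>y. depth \<Omega> y < a \<Longrightarrow> \<bar>f y\<bar> \<le> \<eta>" "\<And>y. depth \<Omega> y < a \<Longrightarrow> \<bar>g y\<bar> \<le> \<eta>" and \<eta>: "0 \<le> \<eta>"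
    and e: "\<And>r y. 0 \<le> r \<Longrightarrow> r \<le> real n * \<delta> \<Longrightarrow> \<bar>T r g y - g y\<bar> \<le> e"
  shows "\<bar>expect_on (alive (space \<PP>) 0 \<delta> a (Suc n)) f (real n * \<delta>)
      - f x - real n * \<delta> * g x\<bar> \<le> 3 * \<epsilon> + \<eta> + real n * \<delta> * (\<epsilon> + \<eta> + 2 * e)"
proof -
  let ?A = "alive (space \<PP>) 0 \<delta> a" and ?E = "leaving (space \<PP>) 0 \<delta> a"
  have \<delta>0: "0 \<le> \<delta>" using \<delta> by simp
  have top: "space \<PP> \<in> sets (F 0)" using sets.top[of "F 0"] F_space by simp
  have ev: "?A k \<in> events" "?E k \<in> events" for k using alive_events[OF top _ \<delta>0] by auto
  have TU: "T \<delta> U \<in> C0_space" using \<delta>0 U by (rule T_C0)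
  have \<epsilon>0: "0 \<le> \<epsilon>" using Uf[of 0] by linarith
  have e0: "0 \<le> e" using e[of 0 0] \<delta>0 by auto
  have int: "integrable \<PP> (\<lambda>w. indicator B w * ext0 f (X (real k * \<delta>) w))"
    if "B \<in> events" "f \<in> C0_space" for B f k
    using that \<delta>0 by (intro integrable_indicator_X) auto
  have abs1: "\<bar>expect_on B f (real k * \<delta>)\<bar> \<le> b"
    if "B \<in> events" "f \<in> C0_space" "\<And>w. w \<in> B \<Longrightarrow> \<bar>ext0 f (X (real k * \<delta>) w)\<bar> \<le> b" "0 \<le> b" for B f k b
    using integral_indicator_bound[of B f "real k * \<delta>" b] that \<delta>0 mult_left_mono[OF prob_le_1[of B] that(4)] by simp

  \<comment> \<open>replacing \<open>U\<close> by \<open>f\<close> at the end point\<close>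
  have "expect_on (?A (Suc n)) (\<lambda>y. U y - f y) (real n * \<delta>) =
      expect_on (?A (Suc n)) U (real n * \<delta>) -
      expect_on (?A (Suc n)) f (real n * \<delta>)"
    by (subst Bochner_Integration.integral_diff[symmetric, OF int[OF ev(1) U] int[OF ev(1) f]])
       (simp add: ext0_diff algebra_simps)
  moreover have "\<bar>expect_on (?A (Suc n)) (\<lambda>y. U y - f y) (real n * \<delta>)\<bar> \<le> \<epsilon>"
    by (intro abs1[OF ev(1) C0_space_diff[OF U f]] ext0_abs_le Uf \<epsilon>0)
  ultimately have 1: "\<bar>expect_on (?A (Suc n)) U (real n * \<delta>) -
      expect_on (?A (Suc n)) f (real n * \<delta>)\<bar> \<le> \<epsilon>" by simp

  \<comment> \<open>the contribution of the stopped part is small because \<open>f\<close> is small near the boundary\<close>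
  have "\<bar>\<Sum>k\<le>n. expect_on (?E k) U (real k * \<delta>)\<bar> \<le> (\<Sum>k\<le>n. (\<epsilon> + \<eta>) * prob (?E k))"
  proof (rule order_trans[OF sum_abs sum_mono])
    fix k
    have Ush: "\<bar>U y\<bar> \<le> \<epsilon> + \<eta>" if "depth \<Omega> y < a" for y using shallow(1)[OF that] Uf[of y] by linarith
    have "\<bar>ext0 U (X (real k * \<delta>) w)\<bar> \<le> \<epsilon> + \<eta>" if "w \<in> ?E k" for w
      using small_if_shallow[of a U "\<epsilon> + \<eta>", OF Ush] leaving_shallow[OF that] \<epsilon>0 \<eta> by simp
    then show "\<bar>expect_on (?E k) U (real k * \<delta>)\<bar> \<le> (\<epsilon> + \<eta>) * prob (?E k)"
      using \<delta>0 by (intro integral_indicator_bound[OF ev(2) U]) auto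
  qed
  also have "\<dots> = (\<epsilon> + \<eta>) * (\<integral>w. (\<Sum>k\<le>n. indicat_real (?E k) w) \<partial>\<PP>)"
    using ev by (subst Bochner_Integration.integral_sum)
      (auto simp: sum_distrib_left less_top[symmetric] intro!: integrable_real_indicator)
  also have "\<dots> = (\<epsilon> + \<eta>) * prob (space \<PP> - ?A (Suc n))"
    using ev by (simp add: indicator_dead[symmetric])
  also have "\<dots> \<le> \<epsilon> + \<eta>" using mult_left_mono[OF prob_le_1, of "\<epsilon> + \<eta>"] \<epsilon>0 \<eta> by simp
  finally have 2: "\<bar>\<Sum>k\<le>n. expect_on (?E k) U (real k * \<delta>)\<bar> \<le> \<epsilon> + \<eta>" .

  \<comment> \<open>every one-step increment is close to \<open>\<delta> * g x\<close>\<close>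
  have "\<bar>expect_on (?A (Suc k)) (\<lambda>y. T \<delta> U y - U y) (real k * \<delta>) - \<delta> * g x\<bar>
      \<le> \<delta> * (\<epsilon> + \<eta> + 2 * e)" if k: "k < n" for k
  proof -
    have C: "(\<lambda>y. T \<delta> U y - U y - \<delta> * g y) \<in> C0_space"
      by (intro C0_space_diff C0_space_scale TU U g)
    have "expect_on (?A (Suc k)) (\<lambda>y. T \<delta> U y - U y - \<delta> * g y) (real k * \<delta>) =
        expect_on (?A (Suc k)) (\<lambda>y. T \<delta> U y - U y) (real k * \<delta>) -
        (\<integral>w. \<delta> * (indicator (?A (Suc k)) w * ext0 g (X (real k * \<delta>) w)) \<partial>\<PP>)"
      by (subst Bochner_Integration.integral_diff[symmetric, OF int[OF ev(1) C0_space_diff[OF TU U]]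
            integrable_mult_right[OF int[OF ev(1) g]]])
         (simp only: ext0_diff ext0_scale, simp add: algebra_simps)
    moreover have "\<bar>expect_on (?A (Suc k)) (\<lambda>y. T \<delta> U y - U y - \<delta> * g y) (real k * \<delta>)\<bar> \<le> \<delta> * \<epsilon>"
    proof (rule abs1[OF ev(1) C])
      fix w assume "w \<in> ?A (Suc k)"
      then have "a \<le> D (real k * \<delta>) w" by (auto simp: alive_def)
      then obtain y where "X (real k * \<delta>) w = Some y" "a \<le> depth \<Omega> y" using D_geE[OF a] by blast
      then show "\<bar>ext0 (\<lambda>y. T \<delta> U y - U y - \<delta> * g y) (X (real k * \<delta>) w)\<bar> \<le> \<delta> * \<epsilon>"
        using step[of y] by simp
    qed (use \<delta>0 \<epsilon>0 in auto)
    ultimately have s1: "\<bar>expect_on (?A (Suc k)) (\<lambda>y. T \<delta> U y - U y) (real k * \<delta>) -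
        \<delta> * expect_on (?A (Suc k)) g (real k * \<delta>)\<bar> \<le> \<delta> * \<epsilon>" by simp
    have ge: "\<bar>T r g y - g y\<bar> \<le> e" if "0 \<le> r" "r \<le> real k * \<delta>" for r y
      using e[of r y] that mult_right_mono[of "real k" "real n" \<delta>] k \<delta>0 by simp
    have "\<bar>expect_on (space \<PP> - ?A (Suc k)) g (real k * \<delta>)\<bar> \<le>
        (\<eta> + e) * prob (space \<PP> - ?A (Suc k))"
      using grid_dead_bound[OF top order_refl \<delta>0 g shallow(2) \<eta> ge] by (simp only: add_0)
    also have "\<dots> \<le> \<eta> + e" using mult_left_mono[OF prob_le_1, of "\<eta> + e"] \<eta> e0 by simp
    finally have "\<bar>expect_on (space \<PP> - ?A (Suc k)) g (real k * \<delta>)\<bar> \<le> \<eta> + e" .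
    moreover have "expect_on (?A (Suc k)) g (real k * \<delta>) +
        expect_on (space \<PP> - ?A (Suc k)) g (real k * \<delta>) = T (real k * \<delta>) g x"
    proof -
      have dead: "space \<PP> - ?A (Suc k) \<in> events" using ev(1) by auto
      have "(\<integral>w. ext0 g (X (real k * \<delta>) w) \<partial>\<PP>) = (\<integral>w. indicator (?A (Suc k)) w * ext0 g (X (real k * \<delta>) w) +
          indicator (space \<PP> - ?A (Suc k)) w * ext0 g (X (real k * \<delta>) w) \<partial>\<PP>)"
        by (rule Bochner_Integration.integral_cong) (auto simp: alive_def split: split_indicator)
      also have "\<dots> = expect_on (?A (Suc k)) g (real k * \<delta>) +
          expect_on (space \<PP> - ?A (Suc k)) g (real k * \<delta>)"
        by (rule Bochner_Integration.integral_add[OF int[OF ev(1) g] int[OF dead g]])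
      finally show ?thesis using expectation_X[of "real k * \<delta>" g] \<delta>0 g by simp
    qed
    moreover have "\<bar>T (real k * \<delta>) g x - g x\<bar> \<le> e" using ge[of "real k * \<delta>"] \<delta>0 by simp
    ultimately have "\<bar>expect_on (?A (Suc k)) g (real k * \<delta>) - g x\<bar> \<le> \<eta> + 2 * e"
      by linarith
    then have "\<bar>\<delta> * (expect_on (?A (Suc k)) g (real k * \<delta>) - g x)\<bar> \<le> \<delta> * (\<eta> + 2 * e)"
      unfolding abs_mult using \<delta>0 by (simp add: mult_left_mono)
    then show ?thesis using s1 unfolding right_diff_distrib distrib_left by linarith
  qed
  then have "\<bar>\<Sum>k<n. expect_on (?A (Suc k)) (\<lambda>y. T \<delta> U y - U y) (real k * \<delta>) - \<delta> * g x\<bar>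
      \<le> (\<Sum>k<n. \<delta> * (\<epsilon> + \<eta> + 2 * e))"
    by (intro order_trans[OF sum_abs sum_mono]) auto
  then have 3: "\<bar>(\<Sum>k<n. expect_on (?A (Suc k)) (\<lambda>y. T \<delta> U y - U y) (real k * \<delta>))
      - real n * \<delta> * g x\<bar> \<le> real n * \<delta> * (\<epsilon> + \<eta> + 2 * e)"
    by (simp add: sum_subtractf mult.assoc)
  show ?thesis
    using grid_dynkin[OF \<delta>0 U, of a n] 1 2 3 Uf[of x] by linarith
qed

end


section \<open>Refining the grid\<close>

context feller_path
begin

text \<open>Keeping a depth of at least \<open>a\<close> is tested at the dyadic points of \<open>[t, t + r]\<close> only, which makes the events
  measurable. Since the grids are nested, \<open>grid_safe\<close> decreases with the mesh, and \<open>safe\<close> is the event that the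
  depth stays bounded away from \<open>0\<close>. For \<open>t = 0\<close> it takes the place of \<open>{r < \<tau>\<^sub>\<Omega>}\<close>, whose measurability is not
  evident.\<close>

definition grid_safe :: "real \<Rightarrow> real \<Rightarrow> real \<Rightarrow> nat \<Rightarrow> 'w set" where
  "grid_safe t r a n = alive (space \<PP>) t (r / 2^n) a (Suc (2^n))"

definition level_safe :: "real \<Rightarrow> real \<Rightarrow> real \<Rightarrow> 'w set" where
  "level_safe t r a = (\<Inter>n. grid_safe t r a n)"

definition safe :: "real \<Rightarrow> real \<Rightarrow> 'w set" where
  "safe t r = (\<Union>m. level_safe t r (inverse (real (Suc m))))"

lemma grid_safe_iff:
  "w \<in> grid_safe t r a n \<longleftrightarrow> w \<in> space \<PP> \<and> (\<forall>j\<le>2^n. a \<le> D (t + real j * (r / 2^n)) w)"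
  by (auto simp: grid_safe_def alive_def less_Suc_eq_le)

lemma top_F: "space \<PP> \<in> sets (F t)"
  using sets.top[of "F t"] F_space by simp

lemma grid_safe_F: "0 \<le> t \<Longrightarrow> 0 \<le> r \<Longrightarrow> grid_safe t r a n \<in> sets (F (t + r))"
  using alive_sets(1)[OF top_F[of t], of "r / 2^n" a "2^n"] by (simp add: grid_safe_def)

lemma level_safe_F: "0 \<le> t \<Longrightarrow> 0 \<le> r \<Longrightarrow> level_safe t r a \<in> sets (F (t + r))"
  unfolding level_safe_def by (intro sets.countable_INT) (auto intro: grid_safe_F)

lemma safe_F: "0 \<le> t \<Longrightarrow> 0 \<le> r \<Longrightarrow> safe t r \<in> sets (F (t + r))"
  unfolding safe_def by (intro sets.countable_UN) (auto intro: level_safe_F)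

lemma safe_events:
  assumes "0 \<le> t" "0 \<le> r"
  shows "safe t r \<in> events" "level_safe t r a \<in> events" "grid_safe t r a n \<in> events"
  using safe_F[OF assms] level_safe_F[OF assms] grid_safe_F[OF assms] F_events[of "t + r"] assms by auto

lemma grid_safe_antimono: "m \<le> n \<Longrightarrow> grid_safe t r a n \<subseteq> grid_safe t r a m"
proof (rule lift_Suc_antimono_le[of "grid_safe t r a"])
  fix n show "grid_safe t r a (Suc n) \<subseteq> grid_safe t r a n"
  proof
    fix w assume w: "w \<in> grid_safe t r a (Suc n)"
    have "a \<le> D (t + real j * (r / 2^n)) w" if "j \<le> 2^n" for j
    proof -
      have "2 * j \<le> 2^Suc n" using that by simp
      then have "a \<le> D (t + real (2 * j) * (r / 2^Suc n)) w" using w unfolding grid_safe_iff by blast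
      then show ?thesis by simp
    qed
    then show "w \<in> grid_safe t r a n" using w by (simp add: grid_safe_iff)
  qed
qed

lemma level_safe_mono: "a \<le> b \<Longrightarrow> level_safe t r b \<subseteq> level_safe t r a"
  unfolding level_safe_def by (force simp: grid_safe_iff)

lemma tendsto_grid_dead:
  fixes g :: "'w \<Rightarrow> real"
  assumes "0 \<le> t" "0 \<le> r" "H \<in> events" and g: "integrable \<PP> g"
  shows "(\<lambda>n. \<integral>w. indicator (H - grid_safe t r a n) w * g w \<partial>\<PP>) \<longlonglongrightarrow>
    (\<integral>w. indicator (H - level_safe t r a) w * g w \<partial>\<PP>)"
proof (rule integral_dominated_convergence)
  have [measurable]: "g \<in> borel_measurable \<PP>" "H \<in> events" using g assms by auto
  note [measurable] = safe_events[OF assms(1,2)]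
  show "(\<lambda>w. indicator (H - level_safe t r a) w * g w) \<in> borel_measurable \<PP>"
    "\<And>n. (\<lambda>w. indicator (H - grid_safe t r a n) w * g w) \<in> borel_measurable \<PP>"
    by measurable
  show "integrable \<PP> (\<lambda>w. \<bar>g w\<bar>)" using g by simp
  show "AE w in \<PP>. norm (indicator (H - grid_safe t r a n) w * g w) \<le> \<bar>g w\<bar>" for n
    by (auto split: split_indicator)
  have "\<forall>\<^sub>F n in sequentially. indicator (H - grid_safe t r a n) w = (indicator (H - level_safe t r a) w :: real)" for w
  proof (cases "w \<in> level_safe t r a")
    case True
    then show ?thesis by (auto simp: level_safe_def split: split_indicator)
  next
    case False
    then obtain m where "w \<notin> grid_safe t r a m" by (auto simp: level_safe_def)
    then have "w \<notin> grid_safe t r a n" if "m \<le> n" for n using grid_safe_antimono[OF that] by blast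
    then show ?thesis using False unfolding eventually_sequentially
      by (intro exI[of _ m]) (auto split: split_indicator)
  qed
  then show "AE w in \<PP>. (\<lambda>n. indicator (H - grid_safe t r a n) w * g w) \<longlonglongrightarrow>
      indicator (H - level_safe t r a) w * g w"
    by (intro AE_I2 tendsto_mult tendsto_const tendsto_eventually) auto
qed

lemma tendsto_level_dead:
  fixes g :: "'w \<Rightarrow> real"
  assumes "0 \<le> t" "0 \<le> r" "H \<in> events" and g: "integrable \<PP> g"
  shows "(\<lambda>m. \<integral>w. indicator (H - level_safe t r (inverse (real (Suc m)))) w * g w \<partial>\<PP>) \<longlonglongrightarrow>
    (\<integral>w. indicator (H - safe t r) w * g w \<partial>\<PP>)"
proof (rule integral_dominated_convergence)
  have [measurable]: "g \<in> borel_measurable \<PP>" "H \<in> events" using g assms by auto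
  note [measurable] = safe_events[OF assms(1,2)]
  show "(\<lambda>w. indicator (H - safe t r) w * g w) \<in> borel_measurable \<PP>"
    "\<And>m. (\<lambda>w. indicator (H - level_safe t r (inverse (real (Suc m)))) w * g w) \<in> borel_measurable \<PP>"
    by measurable
  show "integrable \<PP> (\<lambda>w. \<bar>g w\<bar>)" using g by simp
  show "AE w in \<PP>. norm (indicator (H - level_safe t r (inverse (real (Suc m)))) w * g w) \<le> \<bar>g w\<bar>" for m
    by (auto split: split_indicator)
  have "\<forall>\<^sub>F m in sequentially. indicator (H - level_safe t r (inverse (real (Suc m)))) w =
      (indicator (H - safe t r) w :: real)" for w
  proof (cases "w \<in> safe t r")
    case False
    then show ?thesis by (auto simp: safe_def split: split_indicator)
  next
    case True
    then obtain k where k: "w \<in> level_safe t r (inverse (real (Suc k)))" by (auto simp: safe_def)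
    then have "w \<in> level_safe t r (inverse (real (Suc m)))" if "k \<le> m" for m
      using level_safe_mono[of "inverse (real (Suc m))" "inverse (real (Suc k))"] that by (auto simp: le_imp_inverse_le)
    then show ?thesis using True unfolding eventually_sequentially
      by (intro exI[of _ k]) (auto split: split_indicator)
  qed
  then show "AE w in \<PP>. (\<lambda>m. indicator (H - level_safe t r (inverse (real (Suc m)))) w * g w) \<longlonglongrightarrow>
      indicator (H - safe t r) w * g w"
    by (intro AE_I2 tendsto_mult tendsto_const tendsto_eventually) auto
qed

lemma tendsto_prob_dead:
  assumes "0 \<le> t" "0 \<le> r" "H \<in> events"
  shows "(\<lambda>n. prob (H - grid_safe t r a n)) \<longlonglongrightarrow> prob (H - level_safe t r a)"
    "(\<lambda>m. prob (H - level_safe t r (inverse (real (Suc m))))) \<longlonglongrightarrow> prob (H - safe t r)"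
proof -
  have 1: "(\<integral>w. indicator (H - B) w * (1::real) \<partial>\<PP>) = prob (H - B)" if "B \<in> events" for B
    using that assms(3) sets.sets_into_space[of "H - B" \<PP>] by (simp add: Int_absorb2 sets.Diff)
  have int1: "integrable \<PP> (\<lambda>_. 1::real)" by simp
  show "(\<lambda>n. prob (H - grid_safe t r a n)) \<longlonglongrightarrow> prob (H - level_safe t r a)"
    using tendsto_grid_dead[OF assms int1, of a] by (simp only: 1[OF safe_events(1)[OF assms(1,2)]] 1[OF safe_events(2)[OF assms(1,2)]]
        1[OF safe_events(3)[OF assms(1,2)]])
  show "(\<lambda>m. prob (H - level_safe t r (inverse (real (Suc m))))) \<longlonglongrightarrow> prob (H - safe t r)"
    using tendsto_level_dead[OF assms int1] by (simp only: 1[OF safe_events(1)[OF assms(1,2)]] 1[OF safe_events(2)[OF assms(1,2)]]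
        1[OF safe_events(3)[OF assms(1,2)]])
qed

text \<open>Paths that come arbitrarily close to the boundary during \<open>[t, t + r]\<close> contribute little at
  the end of the interval, because a function vanishing off \<open>\<Omega>\<close> was small when they were close.\<close>

lemma dead_bound:
  assumes H: "H \<in> sets (F t)" and t: "0 \<le> t" "0 \<le> r" and f: "f \<in> C0_space"
    and off: "\<And>y. y \<notin> \<Omega> \<Longrightarrow> f y = 0"
    and e: "\<And>s y. 0 \<le> s \<Longrightarrow> s \<le> r \<Longrightarrow> \<bar>T s f y - f y\<bar> \<le> e"
  shows "\<bar>expect_on (H - safe t r) f (t + r)\<bar> \<le> e * prob (H - safe t r)"
proof (rule field_le_epsilon)
  fix \<eta> :: real assume \<eta>: "\<eta> > 0"
  have Hev: "H \<in> events" using F_events[OF t(1) H] .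
  have Hs: "H \<subseteq> space \<PP>" using sets.sets_into_space[OF Hev] .
  have fint: "integrable \<PP> (\<lambda>w. ext0 f (X (t + r) w))" using t by (intro integrable_X f) auto
  obtain a where a: "0 < a" "\<And>y. depth \<Omega> y < a \<Longrightarrow> \<bar>f y\<bar> \<le> \<eta>"
    using small_near_boundary[OF open_dom bounded_dom f off \<eta>] by blast
  have grid: "\<bar>expect_on (H - grid_safe t r b n) f (t + r)\<bar> \<le>
      (\<eta> + e) * prob (H - grid_safe t r b n)" if "b \<le> a" for b n
  proof -
    have eq: "H - grid_safe t r b n = H - alive H t (r/2^n) b (Suc (2^n))"
      using Hs by (auto simp: grid_safe_def alive_def)
    have "\<bar>expect_on (H - alive H t (r/2^n) b (Suc (2^n))) f (t + real (2^n) * (r/2^n))\<bar>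
      \<le> (\<eta> + e) * prob (H - alive H t (r/2^n) b (Suc (2^n)))"
      by (rule grid_dead_bound[OF H t(1) _ f]) (use a(2) that t e \<eta> in auto)
    then show ?thesis unfolding eq by simp
  qed
  have level: "\<bar>expect_on (H - level_safe t r b) f (t + r)\<bar> \<le>
      (\<eta> + e) * prob (H - level_safe t r b)" if "b \<le> a" for b
    by (rule LIMSEQ_le[OF tendsto_rabs[OF tendsto_grid_dead[OF t Hev fint]]
          tendsto_mult_left[OF tendsto_prob_dead(1)[OF t Hev]]]) (use grid that in auto)
  obtain k where k: "inverse (real (Suc k)) < a" using reals_Archimedean[OF a(1)] by blast
  have le: "inverse (real (Suc m)) \<le> a" if "k \<le> m" for m
    using k that by (meson inverse_le_imp_le le_imp_inverse_le less_imp_le of_nat_0_less_iff of_nat_le_iff order_trans Suc_le_mono zero_less_Suc)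
  have "\<bar>expect_on (H - safe t r) f (t + r)\<bar> \<le> (\<eta> + e) * prob (H - safe t r)"
    by (rule LIMSEQ_le[OF tendsto_rabs[OF tendsto_level_dead[OF t Hev fint]]
          tendsto_mult_left[OF tendsto_prob_dead(2)[OF t Hev]]])
       (use level le in \<open>auto intro!: exI[of _ k]\<close>)
  also have "\<dots> \<le> e * prob (H - safe t r) + \<eta>"
    using mult_left_mono[OF prob_le_1, of \<eta> "H - safe t r"] \<eta> by (simp add: distrib_right)
  finally show "\<bar>expect_on (H - safe t r) f (t + r)\<bar> \<le> e * prob (H - safe t r) + \<eta>" .
qed

lemma safe_imp_bounded_away:
  assumes rc: "\<And>s. 0 \<le> s \<Longrightarrow> ((\<lambda>s. D s w) \<longlongrightarrow> D s w) (at_right s)" and t: "0 \<le> t" "0 \<le> r"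
    and w: "w \<in> safe t r"
  shows "bounded_away (\<lambda>s. D s w) t (t + r)"
proof -
  obtain m where m: "w \<in> level_safe t r (inverse (real (Suc m)))" using w by (auto simp: safe_def)
  have "inverse (real (Suc m)) \<le> D s w" if "s \<in> {t..t+r}" for s
    by (rule right_continuous_dyadic_le[OF _ t(2) _ that])
       (use rc t m in \<open>auto simp: level_safe_def grid_safe_iff\<close>)
  then show ?thesis unfolding bounded_away_def by (intro exI[of _ "inverse (real (Suc m))"]) auto
qed

lemma bounded_away_imp_safe:
  assumes b: "bounded_away (\<lambda>s. D s w) t (t + r)" and r: "0 \<le> r" and w: "w \<in> space \<PP>"
  shows "w \<in> safe t r"
proof -
  obtain a where a: "a > 0" "\<And>s. s \<in> {t..t+r} \<Longrightarrow> a \<le> D s w" using b by (auto simp: bounded_away_def)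
  obtain m where m: "inverse (real (Suc m)) < a" using reals_Archimedean[OF a(1)] by blast
  have "inverse (real (Suc m)) \<le> D (t + real j * (r / 2^n)) w" if "j \<le> 2^n" for j n
  proof -
    have "real j \<le> 2^n" using that by (metis of_nat_le_iff of_nat_numeral of_nat_power)
    then have "real j * (r / 2^n) \<le> 2^n * (r / 2^n)" using r by (intro mult_right_mono) auto
    then have "t + real j * (r / 2^n) \<in> {t..t+r}" using r by simp
    from a(2)[OF this] m show ?thesis by linarith
  qed
  then show ?thesis using w by (auto simp: safe_def level_safe_def grid_safe_iff)
qed

lemma AE_right_continuous_D:
  "AE w in \<PP>. \<forall>s\<ge>0. ((\<lambda>s. D s w) \<longlongrightarrow> D s w) (at_right s)"
  using right_cont unfolding D_def by eventually_elim (use depth_in_C0_space[OF bounded_dom] in blast)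

text \<open>Almost surely a path cannot approach the boundary without leaving \<open>\<Omega>\<close>; this is the part of
  quasi-left-continuity that is needed. In the \<open>p\<close>-th dyadic partition let \<open>J\<close> be the first interval
  on which the path comes arbitrarily close to the boundary. By \<open>dead_bound\<close> the expected depth
  at the end of the \<open>J\<close>-th interval is at most the modulus of continuity of the semigroup, which
  tends to \<open>0\<close>. On the other hand, along a path that stays inside \<open>\<Omega>\<close> this depth is bounded below by
  right-continuity.\<close>

lemma AE_inside_imp_safe:
  assumes h: "h > 0"
  shows "AE w in \<PP>. (\<forall>s\<in>{0<..h}. 0 < D s w) \<longrightarrow> w \<in> safe 0 h"
proof -
  define r where "r = (\<lambda>p::nat. h / 2^p)"
  define H where "H = (\<lambda>p j. {w \<in> space \<PP>. \<forall>i<j. w \<in> safe (real i * r p) (r p)})"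
  define B where "B = (\<lambda>p j. H p j - safe (real j * r p) (r p))"
  define Z where "Z = (\<lambda>p w. \<Sum>j<2^p. indicator (B p j) w * D (real j * r p + r p) w)"
  have r0: "0 \<le> r p" "0 < r p" for p using h by (auto simp: r_def)
  have dC0: "depth \<Omega> \<in> C0_space" by (rule depth_in_C0_space[OF bounded_dom])
  have HF: "H p j \<in> sets (F (real j * r p))" for p j
  proof -
    have "H p j = space \<PP> \<inter> (\<Inter>i<j. safe (real i * r p) (r p))" if "j > 0"
      using that by (auto simp: H_def)
    moreover have "safe (real i * r p) (r p) \<in> sets (F (real j * r p))" if "i < j" for i
    proof (rule F_subset)
      have "real (Suc i) * r p \<le> real j * r p" using that r0[of p] by (intro mult_right_mono) auto
      then show "real i * r p + r p \<le> real j * r p" by (simp add: algebra_simps)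
    qed (use r0[of p] in \<open>auto intro!: safe_F\<close>)
    ultimately show ?thesis using top_F
      by (cases "j = 0") (auto simp: H_def intro!: sets.Int sets.finite_INT)
  qed
  have Hev: "H p j \<in> events" for p j using F_events[OF _ HF] r0 by simp
  have sev: "safe (real j * r p) (r p) \<in> events" for p j using r0 by (intro safe_events) auto
  have DX: "D s w = ext0 (depth \<Omega>) (X s w)" for s w by (simp add: D_def)
  have int: "integrable \<PP> (\<lambda>w. indicator (B p j) w * D (real j * r p + r p) w)" for p j
    unfolding DX B_def using Hev sev r0 by (intro integrable_indicator_X dC0) auto
  have EZ: "(\<integral>w. Z p w \<partial>\<PP>) \<le> e"
    if e: "\<And>s y. 0 \<le> s \<Longrightarrow> s \<le> r p \<Longrightarrow> \<bar>T s (depth \<Omega>) y - depth \<Omega> y\<bar> \<le> e" for p e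
  proof -
    have e0: "0 \<le> e" using e[of 0 0] r0[of p] by auto
    have "(\<integral>w. Z p w \<partial>\<PP>) =
        (\<Sum>j<2^p. \<integral>w. indicator (B p j) w * D (real j * r p + r p) w \<partial>\<PP>)"
      unfolding Z_def by (rule Bochner_Integration.integral_sum) (rule int)
    also have "\<dots> \<le> (\<Sum>j<2^p. e * (prob (H p j) - prob (H p (Suc j))))"
    proof (rule sum_mono)
      fix j
      have "\<bar>\<integral>w. indicator (B p j) w * D (real j * r p + r p) w \<partial>\<PP>\<bar>
          \<le> e * prob (B p j)"
        unfolding DX B_def by (rule dead_bound[OF HF]) (use r0[of p] dC0 depth_outside e in auto)
      moreover have "B p j = H p j - H p (Suc j)"
        by (auto simp: B_def H_def less_Suc_eq)
      moreover have "prob (H p j - H p (Suc j)) = prob (H p j) - prob (H p (Suc j))"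
        by (rule finite_measure_Diff[OF Hev Hev]) (auto simp: H_def)
      ultimately show "(\<integral>w. indicator (B p j) w * D (real j * r p + r p) w \<partial>\<PP>)
          \<le> e * (prob (H p j) - prob (H p (Suc j)))" by simp
    qed
    also have "\<dots> = e * (prob (H p 0) - prob (H p (2^p)))"
      unfolding sum_distrib_left[symmetric]
      using sum_lessThan_telescope'[of "\<lambda>j. prob (H p j)" "2^p"] by simp
    also have "\<dots> \<le> e * 1" using e0 prob_le_1[of "H p 0"] measure_nonneg[of \<PP> "H p (2^p)"]
      by (intro mult_left_mono) linarith+
    finally show ?thesis by simp
  qed
  have Z0: "0 \<le> Z p w" for p w unfolding Z_def by (intro sum_nonneg mult_nonneg_nonneg) (auto simp: D_nonneg)
  have Zint: "integrable \<PP> (Z p)" for p unfolding Z_def by (intro Bochner_Integration.integrable_sum int)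
  have "(\<lambda>p. \<integral>w. Z p w \<partial>\<PP>) \<longlonglongrightarrow> 0"
  proof (rule LIMSEQ_I)
    fix e :: real assume e: "e > 0"
    obtain d where d: "d > 0" "\<And>s y. 0 \<le> s \<Longrightarrow> s < d \<Longrightarrow> \<bar>T s (depth \<Omega>) y - depth \<Omega> y\<bar> \<le> e/2"
      by (rule T_small[OF dC0, of "e/2"]) (use e in auto)
    have "r \<longlonglongrightarrow> 0" unfolding r_def by (rule LIMSEQ_divide_realpow_zero) simp
    then have "\<forall>\<^sub>F p in sequentially. r p < d" using d(1) by (rule order_tendstoD)
    then obtain p0 where p0: "\<And>p. p0 \<le> p \<Longrightarrow> r p < d"
      unfolding eventually_sequentially by blast
    have "norm ((\<integral>w. Z p w \<partial>\<PP>) - 0) < e" if "p0 \<le> p" for p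
    proof -
      have "(\<integral>w. Z p w \<partial>\<PP>) \<le> e/2" by (rule EZ) (use d(2) p0[OF that] in auto)
      moreover have "0 \<le> (\<integral>w. Z p w \<partial>\<PP>)" using Z0 by simp
      ultimately show ?thesis using e by simp
    qed
    then show "\<exists>no. \<forall>n\<ge>no. norm ((\<integral>w. Z n w \<partial>\<PP>) - 0) < e" by blast
  qed
  then have "(\<lambda>p. ennreal (\<integral>w. Z p w \<partial>\<PP>)) \<longlonglongrightarrow> ennreal 0" by (rule tendsto_ennrealI)
  moreover have "(\<integral>\<^sup>+w. ennreal (Z p w) \<partial>\<PP>) = ennreal (\<integral>w. Z p w \<partial>\<PP>)" for p
    by (rule nn_integral_eq_integral[OF Zint]) (simp add: Z0)
  ultimately have lim: "liminf (\<lambda>p. \<integral>\<^sup>+w. ennreal (Z p w) \<partial>\<PP>) = 0"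
    by (simp add: lim_imp_Liminf)
  have Zm: "(\<lambda>w. ennreal (Z p w)) \<in> borel_measurable \<PP>" for p using Zint[of p] by auto
  have "(\<integral>\<^sup>+w. liminf (\<lambda>p. ennreal (Z p w)) \<partial>\<PP>) \<le> 0"
    using nn_integral_liminf[of "\<lambda>p w. ennreal (Z p w)" \<PP>] Zm unfolding lim by blast
  then have "AE w in \<PP>. liminf (\<lambda>p. ennreal (Z p w)) = 0"
    using Zm by (subst nn_integral_0_iff_AE[symmetric]) auto
  with AE_right_continuous_D start AE_space show ?thesis
  proof eventually_elim
    case (elim w)
    let ?D = "\<lambda>s. D s w"
    show ?case
    proof (intro impI, rule ccontr)
      assume inside: "\<forall>s\<in>{0<..h}. 0 < D s w" and dead: "w \<notin> safe 0 h"
      have rc: "\<And>s. 0 \<le> s \<Longrightarrow> (?D \<longlongrightarrow> ?D s) (at_right s)" using elim(1) by blast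
      have D0: "0 < D 0 w" using elim(2) start_in by (simp add: D_pos_iff)
      obtain c \<eta> where c: "c > 0" "\<eta> > 0"
        "\<And>s r. 0 \<le> s \<Longrightarrow> 0 < r \<Longrightarrow> r < \<eta> \<Longrightarrow> s + r \<le> h \<Longrightarrow> bounded_away ?D 0 s \<Longrightarrow>
          \<not> bounded_away ?D s (s + r) \<Longrightarrow> c \<le> ?D (s + r)"
        by (rule first_dead_interval[of ?D h]) (use rc h inside D0 in \<open>auto simp: le_less\<close>)
      have "r \<longlonglongrightarrow> 0" unfolding r_def by (rule LIMSEQ_divide_realpow_zero) simp
      then have "\<forall>\<^sub>F p in sequentially. r p < \<eta>" using c(2) by (rule order_tendstoD)
      then have "\<forall>\<^sub>F p in sequentially. ennreal c \<le> ennreal (Z p w)"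
      proof eventually_elim
        case (elim p)
        have "\<exists>j<2^p. \<not> bounded_away ?D (real j * r p) (real j * r p + r p)"
        proof (rule ccontr)
          assume "\<not> ?thesis"
          then have "bounded_away ?D 0 (real (2^p) * r p)" by (intro bounded_away_steps D0) auto
          then have "bounded_away ?D 0 (0 + h)" by (simp add: r_def)
          then show False using bounded_away_imp_safe[of w 0 h] h dead \<open>w \<in> space \<PP>\<close> by simp
        qed
        then obtain j where j: "j < 2^p" "\<not> bounded_away ?D (real j * r p) (real j * r p + r p)"
          and "\<forall>i<j. \<not> (i < 2^p \<and> \<not> bounded_away ?D (real i * r p) (real i * r p + r p))"
          by (subst (asm) exists_least_iff) blast
        then have least: "bounded_away ?D (real i * r p) (real i * r p + r p)" if "i < j" for i
          using that by auto
        have "w \<in> H p j"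
          using least bounded_away_imp_safe r0 \<open>w \<in> space \<PP>\<close> by (auto simp: H_def)
        moreover have "w \<notin> safe (real j * r p) (r p)"
          using j(2) safe_imp_bounded_away[OF rc, of "real j * r p" "r p"] r0[of p] by auto
        ultimately have ind: "indicator (B p j) w = (1::real)" by (simp add: B_def)
        have "real (Suc j) \<le> 2^p"
          using j(1) by (metis Suc_leI of_nat_le_iff of_nat_numeral of_nat_power)
        then have "real (Suc j) * r p \<le> 2^p * r p"
          using r0[of p] by (intro mult_right_mono) auto
        moreover have "real (Suc j) * r p = real j * r p + r p" "2^p * r p = h"
          by (simp add: distrib_right, simp add: r_def)
        ultimately have "real j * r p + r p \<le> h" by linarith
        then have "c \<le> D (real j * r p + r p) w"
          using c(3)[of "real j * r p" "r p"] r0[of p] elim j(2) bounded_away_steps[OF D0 least] by auto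
        also have "\<dots> \<le> Z p w"
          unfolding Z_def using member_le_sum[of j "{..<2^p}"
              "\<lambda>j. indicator (B p j) w * D (real j * r p + r p) w"] j(1) ind
          by (simp add: D_nonneg)
        finally show ?case by (rule ennreal_leI)
      qed
      then have "ennreal c \<le> liminf (\<lambda>p. ennreal (Z p w))" by (rule Liminf_bounded)
      then have "ennreal c \<le> 0" unfolding elim(4) .
      then show False using c(1) by simp
    qed
  qed
qed

section \<open>The killed semigroup\<close>

text \<open>A path that keeps a positive depth up to time \<open>h\<close> stays in \<open>\<Omega>\<close> a little longer by right-continuity; the
  converse is the fact shown above that paths do not approach the boundary without leaving.\<close>

lemma AE_exit_iff_safe:
  assumes h: "h > 0"
  shows "AE w in \<PP>. ereal h < exit_time X \<Omega> w \<longleftrightarrow> w \<in> safe 0 h"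
  using AE_inside_imp_safe[OF h] AE_right_continuous_D
proof eventually_elim
  case (elim w)
  show ?case
  proof
    assume exit: "ereal h < exit_time X \<Omega> w"
    have "X s w \<in> Some ` \<Omega>" if s: "s \<in> {0<..h}" for s
    proof (rule ccontr)
      assume "X s w \<notin> Some ` \<Omega>"
      then have "exit_time X \<Omega> w \<le> ereal s" unfolding exit_time_def using s by (intro Inf_lower) auto
      then have "ereal h < ereal s" using exit by (rule less_le_trans[rotated])
      then show False using s by simp
    qed
    then show "w \<in> safe 0 h" using elim(1) by (simp add: D_pos_iff)
  next
    assume "w \<in> safe 0 h"
    then have "bounded_away (\<lambda>s. D s w) 0 (0 + h)"
      by (intro safe_imp_bounded_away) (use elim(2) h in auto)
    then have pos: "0 < D s w" if "0 \<le> s" "s \<le> h" for s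
      using that by (auto simp: bounded_away_def intro: less_le_trans)
    have "\<forall>\<^sub>F s in at_right h. 0 < D s w"
      using elim(2) h pos[of h] by (intro order_tendstoD(1)[of _ "D h w"]) auto
    then obtain b where b: "h < b" "\<And>s. h < s \<Longrightarrow> s < b \<Longrightarrow> 0 < D s w"
      unfolding eventually_at_right_field by blast
    have "b \<le> t" if "0 < t" "X t w \<notin> Some ` \<Omega>" for t
    proof (rule ccontr)
      assume "\<not> b \<le> t"
      then have "0 < D t w" using pos[of t] b(2)[of t] \<open>0 < t\<close> by (cases "t \<le> h") auto
      then show False using that(2) by (simp add: D_pos_iff)
    qed
    then have "ereal b \<le> exit_time X \<Omega> w" unfolding exit_time_def by (intro Inf_greatest) auto
    then show "ereal h < exit_time X \<Omega> w" by (rule less_le_trans[rotated]) (simp add: b(1))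
  qed
qed

text \<open>The exit event agrees almost surely with a measurable event; the completed measure turns this into
  measurability of the killed process.\<close>

lemma killed_expectation:
  assumes h: "h > 0" and f: "f \<in> C0_space"
  shows "(\<integral>w. ext0 f (killed X \<Omega> h w) \<partial>completion \<PP>) = expect_on (safe 0 h) f h"
proof -
  let ?g = "\<lambda>w. indicator (safe 0 h) w * ext0 f (X h w)"
  have gm: "?g \<in> borel_measurable \<PP>"
  proof -
    have [measurable]: "safe 0 h \<in> events" "(\<lambda>w. ext0 f (X h w)) \<in> borel_measurable \<PP>"
      using safe_events(1)[of 0 h] measurable_X[of h f] h f by auto
    show ?thesis by measurable
  qed
  have ae: "AE w in \<PP>. ?g w = ext0 f (killed X \<Omega> h w)"
    using AE_exit_iff_safe[OF h] by eventually_elim (auto simp: killed_def)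
  have gc: "?g \<in> borel_measurable (completion \<PP>)" using gm by (rule measurable_completion)
  have ae': "AE w in completion \<PP>. ?g w = ext0 f (killed X \<Omega> h w)" using ae by (rule AE_completion)
  have "(\<lambda>w. ext0 f (killed X \<Omega> h w)) \<in> borel_measurable (completion \<PP>)"
  proof (rule measurableI)
    fix B :: "real set" assume B: "B \<in> sets borel"
    have "AE w in completion \<PP>. w \<in> ?g -` B \<inter> space (completion \<PP>) \<longleftrightarrow>
        w \<in> (\<lambda>w. ext0 f (killed X \<Omega> h w)) -` B \<inter> space (completion \<PP>)"
      using ae' by eventually_elim auto
    then show "(\<lambda>w. ext0 f (killed X \<Omega> h w)) -` B \<inter> space (completion \<PP>) \<in> sets (completion \<PP>)"
      by (rule completion.in_sets_AE) (use measurable_sets[OF gc B] in auto)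
  qed simp
  then have "(\<integral>w. ext0 f (killed X \<Omega> h w) \<partial>completion \<PP>) = (\<integral>w. ?g w \<partial>completion \<PP>)"
    by (intro integral_cong_AE gc) (use ae' in \<open>auto elim: eventually_mono\<close>)
  also have "\<dots> = (\<integral>w. ?g w \<partial>\<PP>)" by (rule integral_completion[OF gm])
  finally show ?thesis .
qed

end


context feller_path
begin

text \<open>Starting where a cut-off function \<open>\<phi>\<close> is \<open>1\<close>, its expectation drops by at most \<open>h * B\<close> in time \<open>h\<close>. Paths that
  come close to the boundary contribute almost nothing to this expectation, so there cannot be many of them.\<close>

lemma dead_probability_bound:
  assumes h: "h > 0" and \<phi>: "(\<phi>, L\<phi>) \<in> gen" and range: "\<And>y. 0 \<le> \<phi> y" "\<And>y. \<phi> y \<le> 1"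
    and off: "\<And>y. y \<notin> \<Omega> \<Longrightarrow> \<phi> y = 0" and one: "\<phi> x = 1"
    and B: "\<And>y. \<bar>L\<phi> y\<bar> \<le> B" and hB: "h * B \<le> 1/2"
  shows "prob (space \<PP> - safe 0 h) \<le> 2 * h * B"
proof -
  have \<phi>C: "\<phi> \<in> C0_space" using \<phi> by (simp add: gen_iff)
  have B0: "0 \<le> B" using B[of 0] by linarith
  have sev: "safe 0 h \<in> events" using safe_events(1)[of 0 h] h by simp
  then have dev: "space \<PP> - safe 0 h \<in> events" by auto
  let ?d = "prob (space \<PP> - safe 0 h)"
  have osc: "\<bar>T s \<phi> y - \<phi> y\<bar> \<le> h * B" if "0 \<le> s" "s \<le> h" for s y
    using T_gen_le[OF \<phi> B that(1), of y] mult_right_mono[OF that(2) B0] by linarith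
  have h0: "0 \<le> h" using h by simp
  have "\<bar>expect_on (space \<PP> - safe 0 h) \<phi> (0 + h)\<bar> \<le> h * B * ?d"
    by (rule dead_bound[OF top_F order_refl h0 \<phi>C off osc])
  then have dead: "\<bar>expect_on (space \<PP> - safe 0 h) \<phi> h\<bar> \<le> h * B * ?d"
    by simp
  have "1 - h * B \<le> T h \<phi> x" using T_gen_le[OF \<phi> B, of h x] h one by simp
  also have "T h \<phi> x = (\<integral>w. ext0 \<phi> (X h w) \<partial>\<PP>)" using expectation_X[OF _ \<phi>C, of h] h by simp
  also have "\<dots> = (\<integral>w. indicator (safe 0 h) w * ext0 \<phi> (X h w) + indicator (space \<PP> - safe 0 h) w * ext0 \<phi> (X h w) \<partial>\<PP>)"
    by (rule Bochner_Integration.integral_cong) (auto split: split_indicator)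
  also have "\<dots> = expect_on (safe 0 h) \<phi> h +
      expect_on (space \<PP> - safe 0 h) \<phi> h"
    by (rule Bochner_Integration.integral_add) (use sev dev \<phi>C h in \<open>auto intro!: integrable_indicator_X\<close>)
  also have "expect_on (safe 0 h) \<phi> h \<le> 1 * prob (safe 0 h)"
    using integral_indicator_bound[OF sev \<phi>C _ ext0_abs_le, of h 1] range h by (simp add: abs_le_iff order_trans[OF _ range(1)])
  also have "prob (safe 0 h) = 1 - ?d" using prob_compl[OF sev] by simp
  also have "expect_on (space \<PP> - safe 0 h) \<phi> h \<le> h * B * ?d"
    using dead by linarith
  finally have "?d - h * B * ?d \<le> h * B" by simp
  moreover have "h * B * ?d \<le> 1/2 * ?d" using hB by (intro mult_right_mono) auto
  ultimately show ?thesis by simp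
qed

text \<open>The quantitative heart of the closedness part: if \<open>(f, g)\<close> is, in the interior of \<open>\<Omega>\<close>, a limit of pairs
  from the graph of the generator of \<open>X\<close>, then \<open>h * g\<close> is the first-order increment of the killed
  semigroup, with an error governed by the modulus of continuity of the semigroup at \<open>g\<close>. The mesh
  of the grid tends to \<open>0\<close> first, then the level sets exhaust \<open>\<Omega>\<close>, then the approximation improves.\<close>

lemma killed_increment:
  assumes h: "h > 0" and f: "f \<in> C0_space" "\<And>y. y \<notin> \<Omega> \<Longrightarrow> f y = 0"
    and g: "g \<in> C0_space" "\<And>y. y \<notin> \<Omega> \<Longrightarrow> g y = 0"
    and approx: "\<And>a \<epsilon>. 0 < a \<Longrightarrow> 0 < \<epsilon> \<Longrightarrow> \<exists>U V. (U, V) \<in> gen \<and> (\<forall>y. \<bar>U y - f y\<bar> \<le> \<epsilon>) \<and>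
      (\<forall>y. a \<le> depth \<Omega> y \<longrightarrow> \<bar>V y - g y\<bar> \<le> \<epsilon>)"
    and e: "\<And>s y. 0 \<le> s \<Longrightarrow> s \<le> h \<Longrightarrow> \<bar>T s g y - g y\<bar> \<le> e"
  shows "\<bar>expect_on (safe 0 h) f h - f x - h * g x\<bar> \<le> 2 * h * e"
proof -
  let ?I = "\<lambda>A. expect_on A f h"
  have h0: "0 \<le> h" using h by simp
  have fint: "integrable \<PP> (\<lambda>w. ext0 f (X h w))" by (rule integrable_X[OF f(1) h0])
  have compl: "?I A = (\<integral>w. ext0 f (X h w) \<partial>\<PP>) - ?I (space \<PP> - A)" if "A \<in> events" for A
  proof -
    have "?I A + ?I (space \<PP> - A) = (\<integral>w. indicator A w * ext0 f (X h w) + indicator (space \<PP> - A) w * ext0 f (X h w) \<partial>\<PP>)"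
      by (rule Bochner_Integration.integral_add[symmetric])
         (use that f(1) h0 in \<open>auto intro!: integrable_indicator_X\<close>)
    also have "\<dots> = (\<integral>w. ext0 f (X h w) \<partial>\<PP>)"
      by (rule Bochner_Integration.integral_cong) (use sets.sets_into_space[OF that] in \<open>auto split: split_indicator\<close>)
    finally show ?thesis by simp
  qed
  have top: "space \<PP> \<in> events" by simp
  note sev = safe_events[OF order_refl h0]
  have lim1: "(\<lambda>n. ?I (grid_safe 0 h a n)) \<longlonglongrightarrow> ?I (level_safe 0 h a)" for a
    unfolding compl[OF sev(2)] compl[OF sev(3)]
    by (intro tendsto_diff tendsto_const tendsto_grid_dead[OF order_refl h0 top fint])
  have lim2: "(\<lambda>m. ?I (level_safe 0 h (inverse (real (Suc m))))) \<longlonglongrightarrow> ?I (safe 0 h)"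
    unfolding compl[OF sev(1)] compl[OF sev(2)]
    by (intro tendsto_diff tendsto_const tendsto_level_dead[OF order_refl h0 top fint])
  have main: "\<bar>?I (safe 0 h) - f x - h * g x\<bar> \<le> 2 * h * e + \<kappa> * (7 + 3 * h)" if \<kappa>: "\<kappa> > 0" for \<kappa>
  proof -
    obtain a1 where a1: "0 < a1" "\<And>y. depth \<Omega> y < a1 \<Longrightarrow> \<bar>f y\<bar> \<le> \<kappa>"
      using small_near_boundary[OF open_dom bounded_dom f \<kappa>] by blast
    obtain a2 where a2: "0 < a2" "\<And>y. depth \<Omega> y < a2 \<Longrightarrow> \<bar>g y\<bar> \<le> \<kappa>"
      using small_near_boundary[OF open_dom bounded_dom g \<kappa>] by blast
    have level: "\<bar>?I (level_safe 0 h a) - f x - h * g x\<bar> \<le> 2 * h * e + \<kappa> * (7 + 3 * h)"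
      if a: "0 < a" "a < a1" "a < a2" for a
    proof -
      obtain U V where UV: "(U, V) \<in> gen" "\<And>y. \<bar>U y - f y\<bar> \<le> \<kappa>"
        "\<And>y. a \<le> depth \<Omega> y \<Longrightarrow> \<bar>V y - g y\<bar> \<le> \<kappa>" using approx[OF a(1) \<kappa>] by blast
      obtain d where d: "d > 0" "\<And>t y. 0 < t \<Longrightarrow> t < d \<Longrightarrow> \<bar>(T t U y - U y) / t - V y\<bar> < \<kappa>"
        using gen_quotient_close[OF UV(1) \<kappa>] by blast
      have "(\<lambda>n. h / 2^n) \<longlonglongrightarrow> 0" by (rule LIMSEQ_divide_realpow_zero) simp
      then have "\<forall>\<^sub>F n in sequentially. h / 2^n < d" using d(1) by (rule order_tendstoD)
      then have "\<forall>\<^sub>F n in sequentially. \<bar>?I (grid_safe 0 h a n) - f x - h * g x\<bar> \<le> 2 * h * e + \<kappa> * (7 + 3 * h)"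
      proof eventually_elim
        case (elim n)
        have \<delta>: "0 < h / 2^n" using h by simp
        have nd: "real (2^n) * (h / 2^n) = h" by simp
        have step: "\<bar>T (h/2^n) U y - U y - h/2^n * g y\<bar> \<le> h/2^n * (2 * \<kappa>)" if "a \<le> depth \<Omega> y" for y
        proof -
          have "\<bar>(T (h/2^n) U y - U y) / (h/2^n) - g y\<bar> \<le> 2 * \<kappa>"
            using d(2)[OF \<delta> elim, of y] UV(3)[OF that] by linarith
          then have "h/2^n * \<bar>(T (h/2^n) U y - U y) / (h/2^n) - g y\<bar> \<le> h/2^n * (2 * \<kappa>)"
            using \<delta> by (intro mult_left_mono) auto
          moreover have "T (h/2^n) U y - U y - h/2^n * g y = h/2^n * ((T (h/2^n) U y - U y) / (h/2^n) - g y)"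
            using h by (simp add: field_simps)
          ultimately show ?thesis using \<delta> by (simp only: abs_mult abs_of_pos)
        qed
        have Uf: "\<bar>U y - f y\<bar> \<le> 2 * \<kappa>" for y using UV(2)[of y] \<kappa> by linarith
        have UC: "U \<in> C0_space" using UV(1) by (simp add: gen_iff)
        have "\<bar>expect_on (alive (space \<PP>) 0 (h/2^n) a (Suc (2^n))) f (real (2^n) * (h/2^n))
            - f x - real (2^n) * (h/2^n) * g x\<bar>
          \<le> 3 * (2 * \<kappa>) + \<kappa> + real (2^n) * (h/2^n) * (2 * \<kappa> + \<kappa> + 2 * e)"
        proof (rule grid_generator_bound[OF \<delta> UC f(1) g(1) Uf a(1) step])
          show "\<bar>T r g y - g y\<bar> \<le> e" if "0 \<le> r" "r \<le> real (2^n) * (h/2^n)" for r y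
            using e that unfolding nd by blast
        qed (use a a1(2) a2(2) \<kappa> in auto)
        moreover have "3 * (2 * \<kappa>) + \<kappa> + h * (2 * \<kappa> + \<kappa> + 2 * e) = 2 * h * e + \<kappa> * (7 + 3 * h)"
          by (simp add: algebra_simps)
        ultimately show ?case unfolding nd by (simp only: grid_safe_def)
      qed
      then show ?thesis
        by (intro tendsto_upperbound[OF tendsto_rabs[OF tendsto_diff[OF tendsto_diff[OF lim1 tendsto_const] tendsto_const]]]) auto
    qed
    have "(\<lambda>m. inverse (real (Suc m))) \<longlonglongrightarrow> 0" by (rule LIMSEQ_inverse_real_of_nat)
    then have "\<forall>\<^sub>F m in sequentially. inverse (real (Suc m)) < min a1 a2" using a1(1) a2(1) by (intro order_tendstoD) auto
    then have "\<forall>\<^sub>F m in sequentially. \<bar>?I (level_safe 0 h (inverse (real (Suc m)))) - f x - h * g x\<bar> \<le> 2 * h * e + \<kappa> * (7 + 3 * h)"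
      by eventually_elim (use level in auto)
    then show ?thesis
      by (intro tendsto_upperbound[OF tendsto_rabs[OF tendsto_diff[OF tendsto_diff[OF lim2 tendsto_const] tendsto_const]]]) auto
  qed
  show ?thesis
  proof (rule field_le_epsilon)
    fix \<epsilon> :: real assume \<epsilon>: "\<epsilon> > 0"
    have k: "7 + 3 * h > 0" using h by simp
    then have "\<bar>?I (safe 0 h) - f x - h * g x\<bar> \<le> 2 * h * e + \<epsilon> / (7 + 3 * h) * (7 + 3 * h)"
      using \<epsilon> by (intro main) auto
    then show "\<bar>?I (safe 0 h) - f x - h * g x\<bar> \<le> 2 * h * e + \<epsilon>" using k by simp
  qed
qed

end

section \<open>The generator of the killed semigroup\<close>

locale killed_feller = feller_levy T c l Q N
  for T :: "real \<Rightarrow> (real ^ 'n \<Rightarrow> real) \<Rightarrow> real ^ 'n \<Rightarrow> real"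
    and c :: "real ^ 'n \<Rightarrow> real" and l :: "real ^ 'n \<Rightarrow> real ^ 'n"
    and Q :: "real ^ 'n \<Rightarrow> real ^ 'n ^ 'n" and N :: "real ^ 'n \<Rightarrow> (real ^ 'n) measure" +
  fixes P :: "real ^ 'n \<Rightarrow> 'w measure" and F :: "real \<Rightarrow> 'w measure"
    and X :: "real \<Rightarrow> 'w \<Rightarrow> (real ^ 'n) option" and \<Omega> :: "(real ^ 'n) set"
  assumes \<Omega>: "open \<Omega>" "bounded \<Omega>"
    and path: "x \<in> \<Omega> \<Longrightarrow> feller_path T (P x) F X x \<Omega>"
begin

abbreviation killed_T :: "real \<Rightarrow> (real ^ 'n \<Rightarrow> real) \<Rightarrow> real ^ 'n \<Rightarrow> real" where
  "killed_T \<equiv> transition P (killed X \<Omega>)"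

abbreviation killed_gen :: "((real ^ 'n \<Rightarrow> real) \<times> (real ^ 'n \<Rightarrow> real)) set" where
  "killed_gen \<equiv> generator_graph \<Omega> (C0_dom \<Omega>) (killed_T)"

lemma C0_domD:
  assumes "f \<in> C0_dom \<Omega>"
  shows "f \<in> C0_space" "\<And>y. y \<notin> \<Omega> \<Longrightarrow> f y = 0"
  using C0_dom_imp_C0_space[OF \<Omega> assms] assms by (auto simp: C0_dom_def)

lemma killed_gen_iff:
  "(f, g) \<in> killed_gen \<longleftrightarrow> f \<in> C0_dom \<Omega> \<and> g \<in> C0_dom \<Omega> \<and>
     (\<forall>e>0. \<exists>\<delta>>0. \<forall>t>0. t < \<delta> \<longrightarrow> (\<forall>x\<in>\<Omega>. \<bar>(killed_T t f x - f x) / t - g x\<bar> < e))"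
  unfolding generator_graph_def uniform_limit_iff eventually_at_right_field
  by (simp add: dist_real_def)

lemma killed_generator_eq:
  assumes "(f, g) \<in> killed_gen"
  shows "generator \<Omega> (C0_dom \<Omega>) (killed_T) f = g"
  unfolding generator_def
proof (rule the_equality)
  fix g' assume g': "(f, g') \<in> killed_gen"
  have "g' x = g x" for x
  proof (cases "x \<in> \<Omega>")
    case True
    have "uniform_limit \<Omega> (\<lambda>t x. (killed_T t f x - f x) / t) g (at_right 0)"
      "uniform_limit \<Omega> (\<lambda>t x. (killed_T t f x - f x) / t) g' (at_right 0)"
      using assms g' by (auto simp: generator_graph_def)
    then show ?thesis
      using tendsto_unique[OF trivial_limit_at_right_real] True by (meson tendsto_uniform_limitI)
  next
    case False
    have "g \<in> C0_dom \<Omega>" "g' \<in> C0_dom \<Omega>" using assms g' by (auto simp: generator_graph_def)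
    from this[THEN C0_domD(2), OF False] show ?thesis by simp
  qed
  then show "g' = g" by blast
qed (rule assms)

lemma killed_transition:
  assumes "x \<in> \<Omega>" "h > 0" "f \<in> C0_space"
  shows "killed_T h f x = (\<integral>w. indicator (feller_path.safe (P x) X \<Omega> 0 h) w * ext0 f (X h w) \<partial>P x)"
proof -
  interpret feller_path T "P x" F X x \<Omega> by (rule path[OF assms(1)])
  show ?thesis unfolding transition_def by (rule killed_expectation[OF assms(2,3)])
qed

text \<open>Divided by \<open>h\<close>, the error in the increment estimate is \<open>2 e(h)\<close>. It does not depend on the starting
  point, so the difference quotients converge uniformly on \<open>\<Omega>\<close>.\<close>

lemma killed_genI:
  assumes f: "f \<in> C0_dom \<Omega>" and g: "g \<in> C0_dom \<Omega>"
    and approx: "\<And>a \<epsilon>. 0 < a \<Longrightarrow> 0 < \<epsilon> \<Longrightarrow> \<exists>U V. (U, V) \<in> gen \<and> (\<forall>y. \<bar>U y - f y\<bar> \<le> \<epsilon>) \<and>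
      (\<forall>y. a \<le> depth \<Omega> y \<longrightarrow> \<bar>V y - g y\<bar> \<le> \<epsilon>)"
  shows "(f, g) \<in> killed_gen"
  unfolding killed_gen_iff
proof (intro conjI allI impI f g)
  fix e :: real assume e: "e > 0"
  obtain \<delta> where \<delta>: "\<delta> > 0" "\<And>r x. 0 \<le> r \<Longrightarrow> r < \<delta> \<Longrightarrow> \<bar>T r g x - g x\<bar> \<le> e/3"
    by (rule T_small[OF C0_domD(1)[OF g], of "e/3"]) (use e in auto)
  have "\<bar>(killed_T t f x - f x) / t - g x\<bar> < e" if t: "t > 0" "t < \<delta>" and x: "x \<in> \<Omega>" for t x
  proof -
    interpret path: feller_path T "P x" F X x \<Omega> by (rule path[OF x])
    have osc: "\<bar>T s g y - g y\<bar> \<le> e/3" if "0 \<le> s" "s \<le> t" for s y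
      using \<delta>(2)[of s y] that t(2) by simp
    have "\<bar>killed_T t f x - f x - t * g x\<bar> \<le> 2 * t * (e/3)"
      unfolding killed_transition[OF x t(1) C0_domD(1)[OF f]]
      by (rule path.killed_increment[OF t(1) C0_domD[OF f] C0_domD[OF g] approx osc])
    moreover have "(killed_T t f x - f x) / t - g x = (killed_T t f x - f x - t * g x) / t"
      using t(1) by (simp add: field_simps)
    ultimately have "\<bar>(killed_T t f x - f x) / t - g x\<bar> \<le> 2 * (e/3)"
      using t(1) by (simp add: abs_divide pos_divide_le_eq algebra_simps)
    then show ?thesis using e by linarith
  qed
  then show "\<exists>\<delta>>0. \<forall>t>0. t < \<delta> \<longrightarrow> (\<forall>x\<in>\<Omega>. \<bar>(killed_T t f x - f x) / t - g x\<bar> < e)"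
    using \<delta>(1) by blast
qed

text \<open>The killed and the original process differ only on paths that leave \<open>\<Omega>\<close>, which from an interior
  point has probability \<open>O(h)\<close>, and on these paths \<open>f\<close> contributes only \<open>o(1)\<close>. So the
  difference quotients of both semigroups have the same limit, locally uniformly.\<close>

lemma killed_close:
  assumes f: "f \<in> C0_dom \<Omega>" and x: "x \<in> \<Omega>" and h: "h > 0"
    and \<phi>: "\<phi> \<in> C02_space" and range: "\<And>y. 0 \<le> \<phi> y" "\<And>y. \<phi> y \<le> 1"
    and off: "\<And>y. y \<notin> \<Omega> \<Longrightarrow> \<phi> y = 0" and one: "\<phi> x = 1"
    and B: "\<And>y. \<bar>L \<phi> y\<bar> \<le> B" and hB: "h * B \<le> 1/2"
    and e: "\<And>s y. 0 \<le> s \<Longrightarrow> s \<le> h \<Longrightarrow> \<bar>T s f y - f y\<bar> \<le> e"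
  shows "\<bar>T h f x - killed_T h f x\<bar> \<le> e * (2 * h * B)"
proof -
  interpret path: feller_path T "P x" F X x \<Omega> by (rule path[OF x])
  note fC = C0_domD[OF f]
  have h0: "0 \<le> h" using h by simp
  have e0: "0 \<le> e" using e[of 0 0] h by auto
  have sev: "path.safe 0 h \<in> path.events" by (rule path.safe_events(1)[OF order_refl h0])
  then have dev: "space (P x) - path.safe 0 h \<in> path.events" by auto
  have "(\<integral>w. ext0 f (X h w) \<partial>P x) = (\<integral>w. indicator (path.safe 0 h) w * ext0 f (X h w) +
      indicator (space (P x) - path.safe 0 h) w * ext0 f (X h w) \<partial>P x)"
    by (rule Bochner_Integration.integral_cong) (auto split: split_indicator)
  also have "\<dots> = (\<integral>w. indicator (path.safe 0 h) w * ext0 f (X h w) \<partial>P x) +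
      (\<integral>w. indicator (space (P x) - path.safe 0 h) w * ext0 f (X h w) \<partial>P x)"
    by (rule Bochner_Integration.integral_add) (use sev dev fC h0 in \<open>auto intro!: path.integrable_indicator_X\<close>)
  finally have "T h f x - killed_T h f x =
      (\<integral>w. indicator (space (P x) - path.safe 0 h) w * ext0 f (X h w) \<partial>P x)"
    using path.expectation_X[OF h0 fC(1)] killed_transition[OF x h fC(1)] by simp
  moreover have "\<bar>\<integral>w. indicator (space (P x) - path.safe 0 h) w * ext0 f (X (0 + h) w) \<partial>P x\<bar>
      \<le> e * path.prob (space (P x) - path.safe 0 h)"
    by (rule path.dead_bound[OF path.top_F order_refl h0 fC e])
  moreover have "path.prob (space (P x) - path.safe 0 h) \<le> 2 * h * B"
    by (rule path.dead_probability_bound[OF h C02_gen[OF \<phi>] range off one B hB])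
  then have "e * path.prob (space (P x) - path.safe 0 h) \<le> e * (2 * h * B)" using e0 by (rule mult_left_mono)
  ultimately show ?thesis by simp
qed

text \<open>Approximation by \<open>C\<^sub>0\<^sup>2(\<Omega>)\<close>. Inside \<open>\<Omega>\<close> the difference quotient of the original semigroup at \<open>f\<close> is close to
  \<open>g\<close>. It is the generator of a time average of the orbit of \<open>f\<close>, which the core approximates by some
  \<open>p \<in> C\<^sub>0\<^sup>2(\<real>\<^sup>d)\<close>. Cutting \<open>p\<close> off very close to the boundary, where it is small, changes its generator
  in the interior only slightly.\<close>

lemma killed_gen_approx:
  assumes fg: "(f, g) \<in> killed_gen" and a: "a > 0" and \<epsilon>: "\<epsilon> > 0"
  obtains v where "v \<in> C02_dom \<Omega>" "\<And>y. \<bar>v y - f y\<bar> \<le> \<epsilon>"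
    "\<And>x. a \<le> depth \<Omega> x \<Longrightarrow> \<bar>Lp c l Q N v x - g x\<bar> \<le> \<epsilon>"
proof -
  have f: "f \<in> C0_dom \<Omega>" using fg by (simp add: killed_gen_iff)
  note fC = C0_domD[OF f]
  obtain \<phi> where \<phi>: "\<phi> \<in> C02_space" "\<And>y. 0 \<le> \<phi> y" "\<And>y. \<phi> y \<le> 1"
      "\<And>y. a \<le> depth \<Omega> y \<Longrightarrow> \<phi> y = 1" "\<And>y. depth \<Omega> y < a/8 \<Longrightarrow> \<phi> y = 0"
    using cutoff[OF \<Omega> a] by blast
  have \<phi>off: "\<phi> y = 0" if "y \<notin> \<Omega>" for y using \<phi>(5)[of y] depth_outside[OF that] a by simp
  obtain B where B: "B \<ge> 0" "\<And>y. \<bar>L \<phi> y\<bar> \<le> B" using L_bounded[OF \<phi>(1)] by blast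
  define \<kappa> where "\<kappa> = \<epsilon> / (5 + 5 * B)"
  have "\<kappa> * (5 + 5 * B) = \<epsilon>" unfolding \<kappa>_def using B(1) by simp
  moreover have "\<kappa> > 0" unfolding \<kappa>_def using \<epsilon> B(1) by (simp add: add_pos_nonneg)
  ultimately have \<kappa>: "\<kappa> > 0" "5 * \<kappa> + 5 * (B * \<kappa>) = \<epsilon>" by (simp_all add: algebra_simps)
  have B\<kappa>: "0 \<le> B * \<kappa>" using B(1) \<kappa>(1) by simp

  \<comment> \<open>a time step so small that the difference quotient of the original semigroup is close to \<open>g\<close>\<close>
  obtain d1 where d1: "d1 > 0" "\<And>r y. 0 \<le> r \<Longrightarrow> r < d1 \<Longrightarrow> \<bar>T r f y - f y\<bar> \<le> \<kappa>"
    using T_small[OF fC(1) \<kappa>(1)] by blast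
  have "\<forall>e>0. \<exists>\<delta>>0. \<forall>t>0. t < \<delta> \<longrightarrow> (\<forall>x\<in>\<Omega>. \<bar>(killed_T t f x - f x) / t - g x\<bar> < e)"
    using fg unfolding killed_gen_iff by simp
  from this[rule_format, OF \<kappa>(1)] obtain d2 where d2: "d2 > 0" "\<And>t x. 0 < t \<Longrightarrow> t < d2 \<Longrightarrow> x \<in> \<Omega> \<Longrightarrow>
      \<bar>(killed_T t f x - f x) / t - g x\<bar> < \<kappa>"
    by auto
  define h where "h = min (min (d1/2) (d2/2)) (1 / (2 * (B + 1)))"
  have h: "h > 0" "h < d1" "h < d2" using d1(1) d2(1) B(1) by (auto simp: h_def)
  have hB: "h * B \<le> 1/2"
  proof -
    have "h * (B + 1) \<le> 1 / (2 * (B + 1)) * (B + 1)" using B(1) by (intro mult_right_mono) (auto simp: h_def)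
    also have "\<dots> = 1/2" using B(1) by (simp add: field_simps)
    finally show ?thesis using h(1) by (simp add: distrib_left)
  qed
  have quot: "\<bar>(T h f x - f x) / h - g x\<bar> \<le> \<kappa> + 2 * (B * \<kappa>)" if x: "a \<le> depth \<Omega> x" for x
  proof -
    have x\<Omega>: "x \<in> \<Omega>" by (rule in_domain_if_depth_pos[OF a x])
    have "\<bar>T h f x - killed_T h f x\<bar> \<le> \<kappa> * (2 * h * B)"
      by (rule killed_close[OF f x\<Omega> h(1) \<phi>(1-3) \<phi>off \<phi>(4)[OF x] B(2) hB]) (use d1(2) h in auto)
    then have "\<bar>(T h f x - killed_T h f x) / h\<bar> \<le> 2 * (B * \<kappa>)"
      using h(1) by (simp add: abs_divide pos_divide_le_eq mult_ac)
    moreover have "(T h f x - f x) / h = (T h f x - killed_T h f x) / h +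
        (killed_T h f x - f x) / h"
      using h(1) by (simp add: field_simps)
    ultimately show ?thesis using d2(2)[OF h(1,3) x\<Omega>] by linarith
  qed

  \<comment> \<open>time averages have this difference quotient as their generator, and the core approximates them\<close>
  obtain u where u: "(u, (\<lambda>x. (T h f x - f x) / h)) \<in> gen"
      "\<And>x e. (\<And>s y. 0 \<le> s \<Longrightarrow> s \<le> h \<Longrightarrow> \<bar>T s f y - f y\<bar> \<le> e) \<Longrightarrow> \<bar>u x - f x\<bar> \<le> e"
    using gen_average[OF fC(1) h(1)] by blast
  have uf: "\<bar>u x - f x\<bar> \<le> \<kappa>" for x by (rule u(2)) (use d1(2) h in auto)
  obtain p where p: "p \<in> C02_space" "\<And>x. \<bar>p x - u x\<bar> \<le> \<kappa>" "\<And>x. \<bar>L p x - (T h f x - f x) / h\<bar> \<le> \<kappa>"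
    using core_approx[OF u(1) \<kappa>(1)] by blast
  have pf: "\<bar>p x - f x\<bar> \<le> 2 * \<kappa>" for x using uf[of x] p(2)[of x] by linarith
  have Lp: "\<bar>L p x - g x\<bar> \<le> 2 * \<kappa> + 2 * (B * \<kappa>)" if "a \<le> depth \<Omega> x" for x
    using quot[OF that] p(3)[of x] by linarith

  \<comment> \<open>cutting off where \<open>p\<close> is small anyway and beyond the support of \<open>\<phi>\<close>\<close>
  obtain b0 where b0: "0 < b0" "\<And>y. depth \<Omega> y < b0 \<Longrightarrow> \<bar>f y\<bar> \<le> \<kappa>"
    using small_near_boundary[OF \<Omega> fC \<kappa>(1)] by blast
  define b where "b = min b0 (a/8)"
  have b: "0 < b" using b0(1) a by (simp add: b_def)
  obtain \<psi> where \<psi>: "\<psi> \<in> C02_space" "\<And>y. 0 \<le> \<psi> y" "\<And>y. \<psi> y \<le> 1"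
      "\<And>y. b \<le> depth \<Omega> y \<Longrightarrow> \<psi> y = 1" "\<And>y. depth \<Omega> y < b/8 \<Longrightarrow> \<psi> y = 0"
    using cutoff[OF \<Omega> b] by blast
  define v where "v = (\<lambda>y. \<psi> y * p y)"
  have "C2_on \<Omega> p" using p(1) C2_on_subset by (auto simp: C02_space_iff)
  moreover have "b/8 > 0" using b by simp
  ultimately have v: "v \<in> C02_space" "v \<in> C02_dom \<Omega>"
    unfolding v_def using cutoff_mult_C02[OF \<Omega> _ \<psi>(1,5), of "b/8" p] by auto
  have pv: "\<bar>p y - v y\<bar> \<le> 3 * \<kappa> * (1 - \<phi> y)" for y
  proof (cases "b \<le> depth \<Omega> y")
    case True
    then show ?thesis using \<psi>(4)[OF True] \<phi>(3)[of y] \<kappa>(1) by (simp add: v_def)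
  next
    case False
    then have "depth \<Omega> y < a/8" "depth \<Omega> y < b0" by (auto simp: b_def)
    then have "\<phi> y = 0" "\<bar>p y\<bar> \<le> 3 * \<kappa>" using \<phi>(5) b0(2)[of y] pf[of y] by auto
    moreover have "\<bar>p y - v y\<bar> = (1 - \<psi> y) * \<bar>p y\<bar>"
      using \<psi>(3)[of y] abs_mult[of "1 - \<psi> y" "p y"] by (simp add: v_def left_diff_distrib)
    moreover have "(1 - \<psi> y) * \<bar>p y\<bar> \<le> 1 * \<bar>p y\<bar>" using \<psi>(2)[of y] by (intro mult_right_mono) auto
    ultimately show ?thesis by simp
  qed
  show thesis
  proof (rule that[OF v(2)])
    fix y
    have "3 * \<kappa> * (1 - \<phi> y) \<le> 3 * \<kappa> * 1" using \<phi>(2)[of y] \<kappa>(1) by (intro mult_left_mono) auto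
    then show "\<bar>v y - f y\<bar> \<le> \<epsilon>" using pv[of y] pf[of y] \<kappa>(2) B\<kappa> by linarith
  next
    fix x assume x: "a \<le> depth \<Omega> x"
    have "\<bar>L p x - L v x\<bar> \<le> - (3 * \<kappa>) * L \<phi> x"
      by (rule gen_far_bound[OF gen_diff[OF C02_gen[OF p(1)] C02_gen[OF v(1)]] C02_gen[OF \<phi>(1)] \<phi>(4)[OF x] pv])
         (use \<kappa>(1) in simp)
    also have "\<dots> = 3 * \<kappa> * (- L \<phi> x)" by simp
    also have "\<dots> \<le> 3 * \<kappa> * B" using B(2)[of x] \<kappa>(1) by (intro mult_left_mono) auto
    also have "\<dots> = 3 * (B * \<kappa>)" by simp
    finally have "\<bar>L v x - g x\<bar> \<le> \<epsilon>" using Lp[OF x] \<kappa> by linarith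
    then show "\<bar>Lp c l Q N v x - g x\<bar> \<le> \<epsilon>" by (simp add: L_eq[OF v(1)])
  qed
qed

end


section \<open>From the process to its semigroup\<close>

lemma measurable_ext0:
  assumes f: "f \<in> borel_measurable borel"
  shows "ext0 f \<in> borel_measurable state_borel"
proof (rule measurableI)
  have sets: "sets (state_borel :: 'a option measure) = sigma_sets UNIV ((`) Some ` sets borel)"
    unfolding state_borel_def by (rule sets_measure_of) simp
  have sp: "space (state_borel :: 'a option measure) = UNIV"
    by (simp add: state_borel_def space_measure_of_conv)
  have Some: "Some ` A \<in> sets (state_borel :: 'a option measure)" if "A \<in> sets borel" for A
    unfolding sets using that by (intro sigma_sets.Basic) auto
  have "{None} = space (state_borel :: 'a option measure) - Some ` UNIV"
    by (auto simp: sp) (metis not_None_eq rangeI)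
  then have None: "{None} \<in> sets (state_borel :: 'a option measure)" using Some[of UNIV] by auto
  fix B :: "real set" assume B: "B \<in> sets borel"
  have fB: "f -` B \<in> sets borel" using measurable_sets[OF f B] by simp
  have "ext0 f -` B \<inter> space state_borel = Some ` (f -` B) \<union> (if 0 \<in> B then {None} else {})"
    by (auto simp: sp ext0_def split: option.splits)
  then show "ext0 f -` B \<inter> space state_borel \<in> sets state_borel" using Some[OF fB] sets.Un[OF Some[OF fB] None] by simp
qed simp

text \<open>The set where \<open>f\<close> is far from \<open>0\<close> is compact, so the extension by \<open>0\<close> is continuous at the added point.\<close>

lemma tendsto_ext0:
  assumes f: "f \<in> C0_space" and lim: "limitin (Alexandroff_compactification euclidean) Y z G"
  shows "((\<lambda>s. ext0 f (Y s)) \<longlongrightarrow> ext0 f z) G"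
proof (rule topological_tendstoI)
  fix V :: "real set" assume V: "open V" "ext0 f z \<in> V"
  have cont: "continuous_on UNIV f" using f by (simp add: C0_space_def)
  have "openin (Alexandroff_compactification euclidean) {u. ext0 f u \<in> V}"
  proof (cases "0 \<in> V")
    case False
    have "{u. ext0 f u \<in> V} = Some ` (f -` V)"
      using False by (auto simp: ext0_def image_iff split: option.splits)
    moreover have "open (f -` V)" using cont V(1) by (simp add: continuous_on_open_vimage)
    ultimately show ?thesis unfolding openin_Alexandroff_compactification by auto
  next
    case True
    define C where "C = - (f -` V)"
    have "u \<in> {u. ext0 f u \<in> V} \<longleftrightarrow> u \<in> insert None (Some ` (topspace euclidean - C))" for u
      using True by (cases u) (auto simp: C_def)
    then have eq: "{u. ext0 f u \<in> V} = insert None (Some ` (topspace euclidean - C))" by blast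
    have cl: "closed C" unfolding C_def using cont V(1) by (simp add: continuous_on_open_vimage closed_Compl)
    obtain e where e: "e > 0" "ball 0 e \<subseteq> V" using V(1) True openE by blast
    obtain R where R: "\<And>y. R \<le> norm y \<Longrightarrow> \<bar>f y\<bar> < e" using f e(1) unfolding C0_space_iff by blast
    have "norm y \<le> R" if "y \<in> C" for y
    proof (rule ccontr)
      assume "\<not> norm y \<le> R"
      then have "f y \<in> ball 0 e" using R[of y] by simp
      then show False using e(2) that by (auto simp: C_def)
    qed
    then have "bounded C" by (auto simp: bounded_iff)
    then have "compact C" using cl by (simp add: compact_eq_bounded_closed)
    then show ?thesis unfolding openin_Alexandroff_compactification eq using cl by auto
  qed
  then show "\<forall>\<^sub>F s in G. ext0 f (Y s) \<in> V" using lim V(2) unfolding limitin_def by auto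
qed

lemma
  fixes M :: "'w measure" and P :: "real ^ 'n \<Rightarrow> 'w measure" and X :: "real \<Rightarrow> 'w \<Rightarrow> (real ^ 'n) option"
  assumes fp: "feller_process M P X"
  shows transition_feller_semigroup: "feller_semigroup (transition P X)"
    and feller_path_of_process: "open \<Omega> \<Longrightarrow> bounded \<Omega> \<Longrightarrow> x \<in> \<Omega> \<Longrightarrow>
      feller_path (transition P X) (P x) (natural_filtration M X) X x \<Omega>"
proof -
  have mp: "markov_process M P X" and rp: "regular_paths P X"
    and cs: "contraction_semigroup UNIV C0_space (transition P X)"
    using fp by (auto simp: feller_process_def)
  have prob: "prob_space (P x)" and sets: "sets (P x) = sets M" for x
    using mp by (auto simp: markov_process_def)
  have space: "space (P x) = space M" for x using sets_eq_imp_space_eq[OF sets] .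
  have XM: "X t \<in> measurable M state_borel" if "t \<ge> 0" for t using mp that by (auto simp: markov_process_def)
  have bor: "f \<in> borel_measurable borel" if "f \<in> C0_space" for f :: "real ^ 'n \<Rightarrow> real"
    using that by (auto simp: C0_space_def intro: borel_measurable_continuous_onI)
  have meas: "(\<lambda>w. ext0 f (X t w)) \<in> borel_measurable (P x)" if "t \<ge> 0" "f \<in> C0_space" for t f x
    using measurable_compose[OF XM[OF that(1)] measurable_ext0[OF bor[OF that(2)]]] sets
    by (simp cong: measurable_cong_sets)
  have trans: "transition P X t f x = (\<integral>w. ext0 f (X t w) \<partial>P x)" if "t \<ge> 0" "f \<in> C0_space" for t f x
    unfolding transition_def by (rule integral_completion[OF meas[OF that]])
  have int: "integrable (P x) (\<lambda>w. ext0 f (X t w))" if tf: "t \<ge> 0" "f \<in> C0_space" for t f x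
  proof -
    interpret prob_space "P x" by (rule prob)
    obtain B where B: "B \<ge> 0" "\<And>y. \<bar>f y\<bar> \<le> B" using C0_space_bounded[OF tf(2)] by blast
    show ?thesis
      by (rule integrable_const_bound[of _ B]) (use ext0_abs_le[of f B] B meas[OF tf] in auto)
  qed
  have cs': "\<And>t f. t \<ge> 0 \<Longrightarrow> f \<in> C0_space \<Longrightarrow> transition P X t f \<in> C0_space"
    "\<And>t f g a b x. t \<ge> 0 \<Longrightarrow> f \<in> C0_space \<Longrightarrow> g \<in> C0_space \<Longrightarrow>
      transition P X t (\<lambda>y. a * f y + b * g y) x = a * transition P X t f x + b * transition P X t g x"
    "\<And>f x. f \<in> C0_space \<Longrightarrow> transition P X 0 f x = f x"
    "\<And>s t f x. s \<ge> 0 \<Longrightarrow> t \<ge> 0 \<Longrightarrow> f \<in> C0_space \<Longrightarrow>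
      transition P X (s + t) f x = transition P X s (transition P X t f) x"
    "\<And>f. f \<in> C0_space \<Longrightarrow> uniform_limit UNIV (\<lambda>t. transition P X t f) f (at_right 0)"
    using cs unfolding contraction_semigroup_def by blast+
  show sg: "feller_semigroup (transition P X)"
  proof
    fix t B :: real and f :: "real ^ 'n \<Rightarrow> real" and x assume t: "t \<ge> 0" and f: "f \<in> C0_space" and B: "B \<ge> 0" "\<And>y. f y \<le> B"
    interpret prob_space "P x" by (rule prob)
    have "ext0 f z \<le> B" for z using B by (cases z) auto
    then have "(\<integral>w. ext0 f (X t w) \<partial>P x) \<le> (\<integral>w. B \<partial>P x)" by (intro integral_mono int[OF t f]) auto
    then show "transition P X t f x \<le> B" by (simp add: trans[OF t f] prob_space)
  qed (fact cs')+
  interpret sg: feller_semigroup "transition P X" by (rule sg)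
  assume \<Omega>: "open \<Omega>" "bounded \<Omega>" "x \<in> \<Omega>"
  interpret prob_space "P x" by (rule prob)
  let ?F = "natural_filtration M X"
  define G where "G = (\<lambda>t. \<Union>u\<in>{0..t}. {X u -` A \<inter> space M | A. A \<in> sets (state_borel :: (real ^ 'n) option measure)})"
  have GM: "G t \<subseteq> sets M" for t using measurable_sets[OF XM] by (auto simp: G_def)
  then have GP: "G t \<subseteq> Pow (space M)" for t using sets.sets_into_space by blast
  have Fsets: "sets (?F t) = sigma_sets (space M) (G t)" for t
    unfolding natural_filtration_def using GP[of t] by (simp add: G_def sets_measure_of)
  have Fspace: "space (?F t) = space (P x)" for t
    by (simp add: natural_filtration_def space_measure_of_conv space)
  have Fsub: "sets (?F t) \<subseteq> sets (P x)" for t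
    unfolding Fsets sets using GM by (rule sets.sigma_sets_subset)
  show "feller_path (transition P X) (P x) ?F X x \<Omega>"
  proof
    fix s t :: real assume "0 \<le> s" "s \<le> t"
    then have "G s \<subseteq> G t" unfolding G_def by fastforce
    then show "sets (?F s) \<subseteq> sets (?F t)" unfolding Fsets by (rule sigma_sets_mono')
  next
    fix t :: real and f :: "real ^ 'n \<Rightarrow> real" assume t: "0 \<le> t" and f: "f \<in> C0_space"
    have "X t \<in> measurable (?F t) state_borel"
    proof (rule measurableI)
      fix A assume "A \<in> sets (state_borel :: (real ^ 'n) option measure)"
      then have "X t -` A \<inter> space M \<in> G t" using t by (auto simp: G_def intro!: bexI[of _ t] exI[of _ A])
      then show "X t -` A \<inter> space (?F t) \<in> sets (?F t)" unfolding Fsets Fspace space by (rule sigma_sets.Basic)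
    qed (simp add: state_borel_def space_measure_of_conv)
    then show "(\<lambda>w. ext0 f (X t w)) \<in> borel_measurable (?F t)"
      by (rule measurable_compose) (rule measurable_ext0[OF bor[OF f]])
  next
    fix s t :: real and A and f :: "real ^ 'n \<Rightarrow> real"
    assume s: "0 \<le> s" and t: "0 \<le> t" and A: "A \<in> sets (?F t)" and f: "f \<in> C0_space"
    interpret finite_measure_subalgebra "P x" "?F t"
      by unfold_locales (use Fspace Fsub in \<open>auto simp: subalgebra_def\<close>)
    obtain B where "\<And>y. \<bar>f y\<bar> \<le> B" using C0_space_bounded[OF f] by blast
    then have "bounded (range f)" by (auto simp: bounded_iff)
    then have ae: "AE w in P x. real_cond_exp (P x) (?F t) (\<lambda>w. ext0 f (X (t + s) w)) w
        = ext0 (transition P X s f) (X t w)"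
      using mp s t bor[OF f] by (auto simp: markov_process_def)
    have ts: "0 \<le> t + s" using s t by simp
    have AP: "A \<in> sets (P x)" using A Fsub by blast
    have "(\<integral>w. indicator A w * ext0 f (X (t + s) w) \<partial>P x) =
        (\<integral>w. indicator A w * real_cond_exp (P x) (?F t) (\<lambda>w. ext0 f (X (t + s) w)) w \<partial>P x)"
      using real_cond_exp_intA[OF int[OF ts f] A] by (simp add: set_lebesgue_integral_def)
    also have "\<dots> = (\<integral>w. indicator A w * ext0 (transition P X s f) (X t w) \<partial>P x)"
    proof (rule integral_cong_AE)
      show "(\<lambda>w. indicator A w * real_cond_exp (P x) (?F t) (\<lambda>w. ext0 f (X (t + s) w)) w) \<in> borel_measurable (P x)"
        using AP by measurable
      show "(\<lambda>w. indicator A w * ext0 (transition P X s f) (X t w)) \<in> borel_measurable (P x)"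
        using AP meas[OF t cs'(1)[OF s f]] by measurable
      show "AE w in P x. indicator A w * real_cond_exp (P x) (?F t) (\<lambda>w. ext0 f (X (t + s) w)) w =
          indicator A w * ext0 (transition P X s f) (X t w)"
        using ae by eventually_elim simp
    qed
    finally show "(\<integral>w. indicator A w * ext0 f (X (t + s) w) \<partial>P x) =
        (\<integral>w. indicator A w * ext0 (transition P X s f) (X t w) \<partial>P x)" .
  next
    show "AE w in P x. X 0 w = Some x" using mp by (auto simp: markov_process_def)
  next
    have "AE w in P x. \<forall>t\<ge>0. limitin (Alexandroff_compactification euclidean) (\<lambda>s. X s w) (X t w) (at_right t)"
      using rp unfolding regular_paths_def by (auto elim: eventually_mono)
    then show "AE w in P x. \<forall>f\<in>C0_space. \<forall>t\<ge>0. ((\<lambda>s. ext0 f (X s w)) \<longlongrightarrow> ext0 f (X t w)) (at_right t)"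
      by eventually_elim (auto intro: tendsto_ext0)
  qed (use Fspace Fsub \<Omega> in auto)
qed

section \<open>A core for the killed generator\<close>

text \<open>The first part is the approximation lemma for the killed generator along \<open>a = \<epsilon> = 1 / (n + 1)\<close>. For the
  second part a single good \<open>f\<^sub>n\<close> is replaced by a \<open>C\<^sub>0\<^sup>2(\<real>\<^sup>d)\<close> function, which exhibits \<open>(f, g)\<close> as a local limit of the graph of \<open>L\<close>. The third part
  is the second one for a constant sequence.\<close>

theorem theorem2p7:
  fixes M :: "'w measure"
    and P :: "real ^ 'n \<Rightarrow> 'w measure"
    and X :: "real \<Rightarrow> 'w \<Rightarrow> (real ^ 'n) option"
    and \<Omega> :: "(real ^ 'n) set"
    and c :: "real ^ 'n \<Rightarrow> real" and l :: "real ^ 'n \<Rightarrow> real ^ 'n"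
    and Q :: "real ^ 'n \<Rightarrow> real ^ 'n ^ 'n" and N :: "real ^ 'n \<Rightarrow> (real ^ 'n) measure"
    and L L\<^sub>\<Omega> :: "(real ^ 'n \<Rightarrow> real) \<Rightarrow> real ^ 'n \<Rightarrow> real"
    and D\<^sub>\<Omega> :: "(real ^ 'n \<Rightarrow> real) set"
  defines "L \<equiv> generator UNIV C0_space (transition P X)"
    and "L\<^sub>\<Omega> \<equiv> generator \<Omega> (C0_dom \<Omega>) (transition P (killed X \<Omega>))"
    and "D\<^sub>\<Omega> \<equiv> generator_dom \<Omega> (C0_dom \<Omega>) (transition P (killed X \<Omega>))"
  assumes "doubly_feller M P X"
    and "open \<Omega>" "connected \<Omega>" "bounded \<Omega>"
    and "regular_domain P X \<Omega>"
    and "levy_coefficients c l Q N"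
    and "is_core UNIV C0_space (transition P X) C02_space"
    and "\<forall>f \<in> C02_space. \<forall>x. L f x = pointwise_generator (transition P X) f x \<and> L f x = Lp c l Q N f x"
  shows "(\<forall>f \<in> D\<^sub>\<Omega>. \<exists>fn :: nat \<Rightarrow> real ^ 'n \<Rightarrow> real. (\<forall>n. fn n \<in> C02_dom \<Omega>) \<and>
            uniform_limit \<Omega> fn f sequentially \<and>
            (\<forall>K. compact K \<and> K \<subseteq> \<Omega> \<longrightarrow>
               uniform_limit K (\<lambda>n. Lp c l Q N (fn n)) (L\<^sub>\<Omega> f) sequentially)) \<and>
         (\<forall>(fn :: nat \<Rightarrow> real ^ 'n \<Rightarrow> real) f g.
            (\<forall>n. fn n \<in> C02_dom \<Omega>) \<and> f \<in> C0_dom \<Omega> \<and> g \<in> C0_dom \<Omega> \<and>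
            uniform_limit \<Omega> fn f sequentially \<and>
            (\<forall>K. compact K \<and> K \<subseteq> \<Omega> \<longrightarrow>
               uniform_limit K (\<lambda>n. Lp c l Q N (fn n)) g sequentially)
            \<longrightarrow> f \<in> D\<^sub>\<Omega> \<and> L\<^sub>\<Omega> f = g) \<and>
         (\<forall>f \<in> C02_dom \<Omega>. (\<lambda>x. if x \<in> \<Omega> then Lp c l Q N f x else 0) \<in> C0_dom \<Omega>
            \<longrightarrow> f \<in> D\<^sub>\<Omega> \<and> (\<forall>x\<in>\<Omega>. L\<^sub>\<Omega> f x = Lp c l Q N f x))"
proof -
  note \<Omega> = \<open>open \<Omega>\<close> \<open>bounded \<Omega>\<close>
  have fp: "feller_process M P X" using \<open>doubly_feller M P X\<close> by (simp add: doubly_feller_def)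
  interpret killed_feller "transition P X" c l Q N P "natural_filtration M X" X \<Omega>
  proof (intro killed_feller.intro feller_levy.intro feller_core.intro feller_core_axioms.intro
      feller_levy_axioms.intro killed_feller_axioms.intro)
    show "feller_semigroup (transition P X)" by (rule transition_feller_semigroup[OF fp])
    show "is_core UNIV C0_space (transition P X) C02_space" "levy_coefficients c l Q N" by fact+
    show "open \<Omega>" "bounded \<Omega>" by (fact \<Omega>)+
    show "generator UNIV C0_space (transition P X) f x = Lp c l Q N f x" if "f \<in> C02_space" for f x
      using assms(11) that unfolding L_def by blast
    show "feller_path (transition P X) (P x) (natural_filtration M X) X x \<Omega>" if "x \<in> \<Omega>" for x
      by (rule feller_path_of_process[OF fp \<Omega> that])
  qed
  have dom: "f \<in> D\<^sub>\<Omega> \<and> L\<^sub>\<Omega> f = g" if "(f, g) \<in> killed_gen" for f g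
    using that killed_generator_eq[OF that] by (auto simp: D\<^sub>\<Omega>_def L\<^sub>\<Omega>_def generator_dom_def)

  have core: "\<exists>fn :: nat \<Rightarrow> real ^ 'n \<Rightarrow> real. (\<forall>n. fn n \<in> C02_dom \<Omega>) \<and>
      uniform_limit \<Omega> fn f sequentially \<and>
      (\<forall>K. compact K \<and> K \<subseteq> \<Omega> \<longrightarrow> uniform_limit K (\<lambda>n. Lp c l Q N (fn n)) (L\<^sub>\<Omega> f) sequentially)"
    if fD: "f \<in> D\<^sub>\<Omega>" for f
  proof -
    obtain g where fg: "(f, g) \<in> killed_gen" using fD by (auto simp: D\<^sub>\<Omega>_def generator_dom_def)
    let ?\<epsilon> = "\<lambda>n. inverse (real (Suc n))"
    have "\<exists>v. v \<in> C02_dom \<Omega> \<and> (\<forall>y. \<bar>v y - f y\<bar> \<le> ?\<epsilon> n) \<and>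
        (\<forall>x. ?\<epsilon> n \<le> depth \<Omega> x \<longrightarrow> \<bar>Lp c l Q N v x - g x\<bar> \<le> ?\<epsilon> n)" for n
      by (rule killed_gen_approx[OF fg, of "?\<epsilon> n" "?\<epsilon> n"]) auto
    then obtain fn where fn: "\<And>n. fn n \<in> C02_dom \<Omega>" "\<And>n y. \<bar>fn n y - f y\<bar> \<le> ?\<epsilon> n"
      "\<And>n x. ?\<epsilon> n \<le> depth \<Omega> x \<Longrightarrow> \<bar>Lp c l Q N (fn n) x - g x\<bar> \<le> ?\<epsilon> n" by metis
    have small: "\<forall>\<^sub>F n in sequentially. ?\<epsilon> n < e" if "e > 0" for e
      using LIMSEQ_inverse_real_of_nat that by (rule order_tendstoD)
    have "uniform_limit \<Omega> fn f sequentially"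
    proof (rule uniform_limitI)
      fix e :: real assume "e > 0"
      from small[OF this] show "\<forall>\<^sub>F n in sequentially. \<forall>x\<in>\<Omega>. dist (fn n x) (f x) < e"
        by eventually_elim (auto simp: dist_real_def intro: le_less_trans[OF fn(2)])
    qed
    moreover have "uniform_limit K (\<lambda>n. Lp c l Q N (fn n)) (L\<^sub>\<Omega> f) sequentially" if K: "compact K" "K \<subseteq> \<Omega>" for K
    proof (rule uniform_limitI)
      fix e :: real assume "e > 0"
      obtain a where a: "0 < a" "\<And>x. x \<in> K \<Longrightarrow> a \<le> depth \<Omega> x" using compact_depth_bound[OF \<Omega> K] by blast
      from small[OF \<open>e > 0\<close>] small[OF a(1)]
      show "\<forall>\<^sub>F n in sequentially. \<forall>x\<in>K. dist (Lp c l Q N (fn n) x) (L\<^sub>\<Omega> f x) < e"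
      proof eventually_elim
        case (elim n)
        have "\<bar>Lp c l Q N (fn n) x - g x\<bar> < e" if "x \<in> K" for x
          using fn(3)[of n x] a(2)[OF that] elim by linarith
        then show ?case using dom[OF fg] by (simp add: dist_real_def)
      qed
    qed
    ultimately show ?thesis using fn(1) by blast
  qed

  have closed: "f \<in> D\<^sub>\<Omega> \<and> L\<^sub>\<Omega> f = g"
    if fn: "\<forall>n. fn n \<in> C02_dom \<Omega>" and f: "f \<in> C0_dom \<Omega>" and g: "g \<in> C0_dom \<Omega>"
      and lim: "uniform_limit \<Omega> fn f sequentially"
      and Llim: "\<forall>K. compact K \<and> K \<subseteq> \<Omega> \<longrightarrow> uniform_limit K (\<lambda>n. Lp c l Q N (fn n)) g sequentially"
    for fn :: "nat \<Rightarrow> real ^ 'n \<Rightarrow> real" and f g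
  proof (rule dom, rule killed_genI[OF f g])
    fix a \<epsilon> :: real assume a: "0 < a" and \<epsilon>: "0 < \<epsilon>"
    let ?K = "{y. a \<le> depth \<Omega> y}"
    have K: "compact ?K" "?K \<subseteq> \<Omega>"
      using compact_depth_ge[OF \<Omega>(2) a] in_domain_if_depth_pos[OF a] by auto
    have e2: "\<epsilon>/2 > 0" using \<epsilon> by simp
    have "\<forall>\<^sub>F n in sequentially. (\<forall>x\<in>\<Omega>. dist (fn n x) (f x) < \<epsilon>/2) \<and>
        (\<forall>x\<in>?K. dist (Lp c l Q N (fn n) x) (g x) < \<epsilon>/2)"
      using uniform_limitD[OF lim e2] uniform_limitD[OF Llim[rule_format, OF conjI[OF K]] e2]
      by (rule eventually_conj)
    then obtain n where n: "\<And>x. x \<in> \<Omega> \<Longrightarrow> \<bar>fn n x - f x\<bar> < \<epsilon>/2"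
      "\<And>x. a \<le> depth \<Omega> x \<Longrightarrow> \<bar>Lp c l Q N (fn n) x - g x\<bar> < \<epsilon>/2"
      unfolding eventually_sequentially by (auto simp: dist_real_def)
    have fnC: "fn n \<in> C02_dom \<Omega>" using fn by blast
    then have fn0: "fn n \<in> C0_dom \<Omega>" by (simp add: C02_dom_iff)
    obtain U where U: "U \<in> C02_space" "\<And>y. \<bar>U y - fn n y\<bar> \<le> \<epsilon>/2"
      "\<And>x. a \<le> depth \<Omega> x \<Longrightarrow> \<bar>generator UNIV C0_space (transition P X) U x - Lp c l Q N (fn n) x\<bar> \<le> \<epsilon>/2"
      using C02_dom_approx[OF \<Omega> fnC a e2] by blast
    have "\<bar>U y - f y\<bar> \<le> \<epsilon>" for y
    proof (cases "y \<in> \<Omega>")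
      case True
      then show ?thesis using U(2)[of y] n(1)[of y] by linarith
    next
      case False
      then show ?thesis using U(2)[of y] C0_domD(2)[OF f] C0_domD(2)[OF fn0] \<epsilon> by simp
    qed
    moreover have "\<bar>generator UNIV C0_space (transition P X) U y - g y\<bar> \<le> \<epsilon>" if "a \<le> depth \<Omega> y" for y
      using U(3)[OF that] n(2)[OF that] by linarith
    ultimately show "\<exists>U V. (U, V) \<in> gen \<and> (\<forall>y. \<bar>U y - f y\<bar> \<le> \<epsilon>) \<and> (\<forall>y. a \<le> depth \<Omega> y \<longrightarrow> \<bar>V y - g y\<bar> \<le> \<epsilon>)"
      using C02_gen[OF U(1)] by blast
  qed

  have smooth: "f \<in> D\<^sub>\<Omega> \<and> (\<forall>x\<in>\<Omega>. L\<^sub>\<Omega> f x = Lp c l Q N f x)"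
    if f: "f \<in> C02_dom \<Omega>" and Lf: "(\<lambda>x. if x \<in> \<Omega> then Lp c l Q N f x else 0) \<in> C0_dom \<Omega>" for f
  proof -
    let ?g = "\<lambda>x. if x \<in> \<Omega> then Lp c l Q N f x else 0"
    have "f \<in> D\<^sub>\<Omega> \<and> L\<^sub>\<Omega> f = ?g"
    proof (rule closed[of "\<lambda>_. f"])
      show "uniform_limit \<Omega> (\<lambda>_. f) f sequentially" by (simp add: uniform_limit_iff)
      show "\<forall>K. compact K \<and> K \<subseteq> \<Omega> \<longrightarrow> uniform_limit K (\<lambda>_. Lp c l Q N f) ?g sequentially"
        by (auto simp: uniform_limit_iff subset_iff)
    qed (use f Lf in \<open>auto simp: C02_dom_iff\<close>)
    then show ?thesis by simp
  qed
  show ?thesis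
    by (rule conjI[OF ballI[OF core] conjI])
       (assumption, intro allI impI, elim conjE, rule closed, assumption+, intro ballI impI, rule smooth)
qed

end
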